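(* Let $L$ be a line bundle on $\mathcal{C}_{2,3}$ corresponding to a vector $\mathbf{w}=(1,w_1,w_2)$ in the GIT chamber $\{w_1>1,\ w_2>1,\ w_1+w_2<3\}\subset\Delta(\mathcal{C}_{2,3})$. Then there exists an isomorphism $$\phi^{lab}:\ \mathcal{C}_{2,3}^{s}(L)/SL(3)\ \longrightarrow\ M^{(1,3)lab}_{pairs}\left(\tfrac32-\epsilon\right)\ \cong\ \mathbb{P}(1,2,2,3).$$
   Context: Work over $\mathbb{C}$. $\mathcal{C}_{2,3}\subset \mathbb{P}(\Gamma(\mathbb{P}^2,\mathcal{O}(3)))\times(\mathbb{P}^2)^2$ is the closed subvariety of tuples $(C,p_1,p_2)$ where $C$ is a plane cubic curve and $p_1,p_2$ are points of $C$. $SL(3)$ acts by $g\cdot(C,p_1,p_2)=(g\cdot C,g\cdot p_1,g\cdot p_2)$. A vector $(\gamma,w_1,w_2)$ of positive rationals corresponds to the line bundle obtained, after clearing denominators, by restricting $\mathcal{O}(\gamma)\boxtimes\mathcal{O}(w_1)\boxtimes\mathcal{O}(w_2)$ to $\mathcal{C}_{2,3}$, with its unique $SL(3)$-linearization. $\mathcal{C}_{2,3}^{s}(L)$ is the stable locus in the sense of GIT, and $\mathcal{C}_{2,3}^{s}(L)/SL(3)$ is the geometric quotient. $\Lambda(\mathcal{C}_{2,3})$ is the cone of vectors $(\gamma,w_1,w_2)$ for which the line bundle is ample and has non-empty semi-stable locus, and the linearization polytope $\Delta(\mathcal{C}_{2,3})$ is its section by the hyperplane $\{\gamma=1\}$.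 Degree $3$ pairs (Laza): a degree $3$ pair $(C,\ell)$ consists of a plane cubic $C$ and a line $\ell\subset\mathbb{P}^2$. $M^{1,3}_{pairs}(t)$ is the GIT quotient of $\mathbb{P}(\Gamma(\mathbb{P}^2,\mathcal{O}(3)))\times\mathbb{P}(\Gamma(\mathbb{P}^2,\mathcal{O}(1)))$ by $SL(3)$ with respect to the linearization of slope $t$, i.e. proportional to $\mathcal{O}(1)\boxtimes\mathcal{O}(t)$. For $0<\epsilon\ll1$, $M^{1,3}_{pairs}(\frac32-\epsilon)$ is the moduli space of pairs $(C,\ell)$ where $C$ has at worst isolated singularities of type $A_k$ and $\ell$ intersects $C$ transversely. $M^{(1,3)lab}_{pairs}(\frac32-\epsilon)$ is the corresponding moduli space of degree $3$ pairs with labeled intersection, i.e. of such pairs $(C,\ell)$ together with an ordering of the three points of $C\cap\ell$, up to projective equivalence. $\mathbb{P}(1,2,2,3)$ is the weighted projective space. *)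

theory Defs
  imports "HOL-Analysis.Analysis"
begin

section \<open>Varieties as spaces with functions\<close>

text \<open>
  Varieties over the complex numbers are treated classically: a variety is its set of closed
  points with the Zariski topology and the sheaf of complex-valued regular functions. The set
  \<open>fs_regular X U\<close> is meant for open \<open>U\<close>; its members are total functions of which only the
  values on \<open>U\<close> matter.
\<close>

record 'a fspace =
  fs_top :: "'a topology"
  fs_regular :: "'a set \<Rightarrow> ('a \<Rightarrow> complex) set"

definition fs_morphism :: "'a fspace \<Rightarrow> 'b fspace \<Rightarrow> ('a \<Rightarrow> 'b) \<Rightarrow> bool" where
  "fs_morphism X Y \<phi> \<longleftrightarrow>
     continuous_map (fs_top X) (fs_top Y) \<phi> \<and>
     (\<forall>V h. openin (fs_top Y) V \<and> h \<in> fs_regular Y V \<longrightarrow>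
        h \<circ> \<phi> \<in> fs_regular X {x \<in> topspace (fs_top X). \<phi> x \<in> V})"

definition fs_isomorphism :: "'a fspace \<Rightarrow> 'b fspace \<Rightarrow> ('a \<Rightarrow> 'b) \<Rightarrow> bool" where
  "fs_isomorphism X Y \<phi> \<longleftrightarrow>
     fs_morphism X Y \<phi> \<and>
     (\<exists>\<psi>. fs_morphism Y X \<psi> \<and>
        (\<forall>x \<in> topspace (fs_top X). \<psi> (\<phi> x) = x) \<and>
        (\<forall>y \<in> topspace (fs_top Y). \<phi> (\<psi> y) = y))"

text \<open>For an open subset \<open>U\<close>.\<close>

definition fs_open_sub :: "'a fspace \<Rightarrow> 'a set \<Rightarrow> 'a fspace" where
  "fs_open_sub X U = \<lparr> fs_top = subtopology (fs_top X) U, fs_regular = fs_regular X \<rparr>"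

text \<open>
  The polynomial functions in a given set \<open>K\<close> of coordinate functions.
\<close>

inductive_set polyfuns :: "('a \<Rightarrow> complex) set \<Rightarrow> ('a \<Rightarrow> complex) set"
  for K :: "('a \<Rightarrow> complex) set" where
  const: "(\<lambda>x. c) \<in> polyfuns K"
| coord: "k \<in> K \<Longrightarrow> k \<in> polyfuns K"
| add: "p \<in> polyfuns K \<Longrightarrow> q \<in> polyfuns K \<Longrightarrow> (\<lambda>x. p x + q x) \<in> polyfuns K"
| mult: "p \<in> polyfuns K \<Longrightarrow> q \<in> polyfuns K \<Longrightarrow> (\<lambda>x. p x * q x) \<in> polyfuns K"

text \<open>
  The (reduced) quasi-affine variety on a locally closed subset \<open>S\<close> of an affine space with
  coordinate functions \<open>K\<close>: regular functions are locally quotients of polynomials.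
\<close>

definition zariski_top :: "('a \<Rightarrow> complex) set \<Rightarrow> 'a set \<Rightarrow> 'a topology" where
  "zariski_top K S = topology_generated_by ((\<lambda>p. {x \<in> S. p x \<noteq> 0}) ` polyfuns K)"

definition quasi_affine :: "('a \<Rightarrow> complex) set \<Rightarrow> 'a set \<Rightarrow> 'a fspace" where
  "quasi_affine K S = \<lparr>
     fs_top = zariski_top K S,
     fs_regular = (\<lambda>U. {h. \<forall>x \<in> U. \<exists>V p q. openin (zariski_top K S) V \<and> x \<in> V \<and> V \<subseteq> U \<and>
        p \<in> polyfuns K \<and> q \<in> polyfuns K \<and> (\<forall>y \<in> V. q y \<noteq> 0 \<and> h y = p y / q y)}) \<rparr>"

lemma topspace_zariski_top: "topspace (zariski_top K S) = S"
proof -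
  have "S \<in> (\<lambda>p. {x \<in> S. p x \<noteq> 0}) ` polyfuns K"
    by (rule image_eqI[OF _ polyfuns.const[of 1]]) simp
  then have "S \<subseteq> \<Union>((\<lambda>p. {x \<in> S. p x \<noteq> 0}) ` polyfuns K)"
    by (rule Union_upper)
  moreover have "\<Union>((\<lambda>p. {x \<in> S. p x \<noteq> 0}) ` polyfuns K) \<subseteq> S"
    by (rule Union_least) (erule imageE, simp)
  ultimately show ?thesis
    unfolding zariski_top_def topology_generated_by_topspace by (rule subset_antisym[rotated])
qed

text \<open>
  The image of \<open>X\<close> under a surjection \<open>\<pi>\<close>, with the quotient topology and with the functions
  that become regular after composition with \<open>\<pi>\<close>. If \<open>\<pi>\<close> is the map to the set of orbits of a
  group action, this is the structure that a geometric quotient has (fibres are the orbits, \<open>U\<close>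
  is open iff its preimage is, and the functions on \<open>U\<close> are the invariant functions on the
  preimage).
\<close>

definition quotient_top :: "('a \<Rightarrow> 'b) \<Rightarrow> 'a topology \<Rightarrow> 'b topology" where
  "quotient_top \<pi> T =
     topology (\<lambda>U. U \<subseteq> \<pi> ` topspace T \<and> openin T {x \<in> topspace T. \<pi> x \<in> U})"

definition fs_quotient :: "('a \<Rightarrow> 'b) \<Rightarrow> 'a fspace \<Rightarrow> 'b fspace" where
  "fs_quotient \<pi> X = \<lparr>
     fs_top = quotient_top \<pi> (fs_top X),
     fs_regular = (\<lambda>U. {h. h \<circ> \<pi> \<in> fs_regular X {x \<in> topspace (fs_top X). \<pi> x \<in> U}}) \<rparr>"

lemma openin_quotient_top:
  "openin (quotient_top \<pi> T) U \<longleftrightarrow>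
     U \<subseteq> \<pi> ` topspace T \<and> openin T {x \<in> topspace T. \<pi> x \<in> U}"
proof -
  have "istopology (\<lambda>U. U \<subseteq> \<pi> ` topspace T \<and> openin T {x \<in> topspace T. \<pi> x \<in> U})"
    unfolding istopology_def
  proof (intro conjI allI impI)
    fix A B
    assume A: "A \<subseteq> \<pi> ` topspace T \<and> openin T {x \<in> topspace T. \<pi> x \<in> A}"
      and B: "B \<subseteq> \<pi> ` topspace T \<and> openin T {x \<in> topspace T. \<pi> x \<in> B}"
    show "A \<inter> B \<subseteq> \<pi> ` topspace T" using A by blast
    have "{x \<in> topspace T. \<pi> x \<in> A \<inter> B} =
        {x \<in> topspace T. \<pi> x \<in> A} \<inter> {x \<in> topspace T. \<pi> x \<in> B}" by blast
    then show "openin T {x \<in> topspace T. \<pi> x \<in> A \<inter> B}"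
      using openin_Int[OF conjunct2[OF A] conjunct2[OF B]] by (simp only:)
  next
    fix F
    assume F: "\<forall>A\<in>F. A \<subseteq> \<pi> ` topspace T \<and> openin T {x \<in> topspace T. \<pi> x \<in> A}"
    show "\<Union>F \<subseteq> \<pi> ` topspace T" using F by blast
    have "{x \<in> topspace T. \<pi> x \<in> \<Union>F} = (\<Union>A\<in>F. {x \<in> topspace T. \<pi> x \<in> A})" by blast
    then show "openin T {x \<in> topspace T. \<pi> x \<in> \<Union>F}"
      using F openin_Union[of "(\<lambda>A. {x \<in> topspace T. \<pi> x \<in> A}) ` F" T] by (simp only: ball_simps) blast
  qed
  then show ?thesis unfolding quotient_top_def by (subst topology_inverse') (assumption, rule refl)
qed

lemma topspace_quotient_top: "topspace (quotient_top \<pi> T) = \<pi> ` topspace T"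
proof -
  have "{x \<in> topspace T. \<pi> x \<in> \<pi> ` topspace T} = topspace T" by blast
  then have "openin (quotient_top \<pi> T) (\<pi> ` topspace T)" by (simp add: openin_quotient_top)
  then have "\<pi> ` topspace T \<subseteq> topspace (quotient_top \<pi> T)" by (rule openin_subset)
  moreover have "topspace (quotient_top \<pi> T) \<subseteq> \<pi> ` topspace T"
    using openin_topspace[of "quotient_top \<pi> T"] unfolding openin_quotient_top by blast
  ultimately show ?thesis by blast
qed


section \<open>Plane curves\<close>

definition plane_forms :: "nat \<Rightarrow> (complex^3 \<Rightarrow> complex) set" where
  "plane_forms d = {f \<in> polyfuns {\<lambda>v. v $ i | i. True}. \<forall>c v. f (c *s v) = c ^ d * f v}"

text \<open>
  The classes of a nonzero vector in \<open>\<bbbP>\<^sup>2\<close> and of a nonzero form in the projective space of forms.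
\<close>

definition proj_pt :: "complex^3 \<Rightarrow> (complex^3) set" where
  "proj_pt v = {c *s v | c. c \<noteq> 0}"

definition proj_form :: "(complex^3 \<Rightarrow> complex) \<Rightarrow> (complex^3 \<Rightarrow> complex) set" where
  "proj_form f = {(\<lambda>v. c * f v) | c. c \<noteq> 0}"

definition dir_deriv :: "(complex^3 \<Rightarrow> complex) \<Rightarrow> complex^3 \<Rightarrow> complex^3 \<Rightarrow> complex" where
  "dir_deriv f v u = deriv (\<lambda>t. f (v + t *s u)) 0"

definition singular_at :: "(complex^3 \<Rightarrow> complex) \<Rightarrow> complex^3 \<Rightarrow> bool" where
  "singular_at f v \<longleftrightarrow> f v = 0 \<and> (\<forall>u. dir_deriv f v u = 0)"

text \<open>
  Local biholomorphisms of an open set in \<open>\<complex>\<^sup>2\<close>; \<open>a b c d\<close> are the entries of the complex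
  Jacobian matrix.
\<close>

definition local_biholo :: "(complex \<times> complex \<Rightarrow> complex \<times> complex) \<Rightarrow> (complex \<times> complex) set \<Rightarrow> bool" where
  "local_biholo \<phi> U \<longleftrightarrow> open U \<and>
     (\<forall>z \<in> U. \<exists>a b c d. a * d - b * c \<noteq> 0 \<and>
        (\<phi> has_derivative (\<lambda>(h, k). (a * h + b * k, c * h + d * k))) (at z))"

text \<open>
  The curve \<open>f = 0\<close> has a singularity of type \<open>A\<^sub>k\<close> at \<open>v\<close>: in some affine chart centred at \<open>v\<close> the
  germ of \<open>f\<close> is \<open>x\<^sup>2 + y\<^sup>k\<^sup>+\<^sup>1\<close> in suitable analytic coordinates. Allowing an additional unit factor
  would make no difference, since roots of it can be absorbed into the coordinates.
\<close>

definition A_sing :: "nat \<Rightarrow> (complex^3 \<Rightarrow> complex) \<Rightarrow> complex^3 \<Rightarrow> bool" where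
  "A_sing k f v \<longleftrightarrow> k \<ge> 1 \<and>
     (\<exists>e1 e2 \<phi> U. det (vector [v, e1, e2] :: complex^3^3) \<noteq> 0 \<and>
        (0, 0) \<in> U \<and> local_biholo \<phi> U \<and> \<phi> (0, 0) = (0, 0) \<and>
        (\<forall>(x, y) \<in> U. f (v + x *s e1 + y *s e2) = (fst (\<phi> (x, y)))^2 + (snd (\<phi> (x, y)))^(k + 1)))"

definition at_worst_A_sings :: "(complex^3 \<Rightarrow> complex) \<Rightarrow> bool" where
  "at_worst_A_sings f \<longleftrightarrow> (\<forall>v. v \<noteq> 0 \<and> singular_at f v \<longrightarrow> (\<exists>k. A_sing k f v))"

text \<open>
  The curve \<open>f = 0\<close> and the line \<open>l = 0\<close> meet transversely: at every common point \<open>f\<close> is smooth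
  and its tangent line is not \<open>l\<close>.
\<close>

definition transverse :: "(complex^3 \<Rightarrow> complex) \<Rightarrow> (complex^3 \<Rightarrow> complex) \<Rightarrow> bool" where
  "transverse f l \<longleftrightarrow>
     (\<forall>v. v \<noteq> 0 \<and> f v = 0 \<and> l v = 0 \<longrightarrow> \<not> (\<exists>c. \<forall>u. dir_deriv f v u = c * l u))"


section \<open>The group \<open>SL(3)\<close>\<close>

definition SL3 :: "(complex^3^3) set" where
  "SL3 = {g. det g = 1}"

definition act_form :: "complex^3^3 \<Rightarrow> (complex^3 \<Rightarrow> complex) \<Rightarrow> (complex^3 \<Rightarrow> complex)" where
  "act_form g f = (\<lambda>v. f (matrix_inv g *v v))"


section \<open>Plane cubics with two points\<close>

type_synonym C23_vec = "(complex^3 \<Rightarrow> complex) \<times> (complex^3) \<times> (complex^3)"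
type_synonym C23_pt = "(complex^3 \<Rightarrow> complex) set \<times> (complex^3) set \<times> (complex^3) set"

text \<open>
  Evaluations at vectors span the linear functions of a form, so they may serve as coordinates
  on the space of cubic forms in place of the coefficients.
\<close>

definition C23_coords :: "(C23_vec \<Rightarrow> complex) set" where
  "C23_coords = {\<lambda>(f, v1, v2). f u | u. True} \<union>
     {\<lambda>(f, v1, v2). v1 $ i | i. True} \<union> {\<lambda>(f, v1, v2). v2 $ i | i. True}"

definition C23_cone :: "C23_vec set" where
  "C23_cone = {(f, v1, v2). f \<in> plane_forms 3 \<and> f \<noteq> (\<lambda>_. 0) \<and> v1 \<noteq> 0 \<and> v2 \<noteq> 0 \<and>
     f v1 = 0 \<and> f v2 = 0}"

definition C23_proj :: "C23_vec \<Rightarrow> C23_pt" where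
  "C23_proj = (\<lambda>(f, v1, v2). (proj_form f, proj_pt v1, proj_pt v2))"

text \<open>
  The quotient of the multicone by the torus \<open>(\<complex>\<^sup>*)\<^sup>3\<close>, so the closed sets are given by
  multihomogeneous equations and the regular functions are locally quotients of multihomogeneous
  polynomials of equal multidegree.
\<close>

definition C23 :: "C23_pt fspace" where
  "C23 = fs_quotient C23_proj (quasi_affine C23_coords C23_cone)"

definition C23_act_vec :: "complex^3^3 \<Rightarrow> C23_vec \<Rightarrow> C23_vec" where
  "C23_act_vec g = (\<lambda>(f, v1, v2). (act_form g f, g *v v1, g *v v2))"

definition C23_act :: "complex^3^3 \<Rightarrow> C23_pt \<Rightarrow> C23_pt" where
  "C23_act g = (\<lambda>(C, p1, p2). (act_form g ` C, (*v) g ` p1, (*v) g ` p2))"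

definition C23_orbit :: "C23_pt \<Rightarrow> C23_pt set" where
  "C23_orbit x = {C23_act g x | g. g \<in> SL3}"

text \<open>
  A triple \<open>(d, a1, a2)\<close> of positive integers stands for the restriction of
  \<open>O(d) \<boxtimes> O(a1) \<boxtimes> O(a2)\<close>. A vector of positive rationals corresponds to those line bundles that
  are obtained from it by clearing denominators.
\<close>

type_synonym line_bundle = "nat \<times> nat \<times> nat"

definition corresponds_to :: "line_bundle \<Rightarrow> rat \<times> rat \<times> rat \<Rightarrow> bool" where
  "corresponds_to = (\<lambda>(d, a1, a2) (\<gamma>, w1, w2). \<exists>m::nat. m > 0 \<and>
     of_nat d = of_nat m * \<gamma> \<and> of_nat a1 = of_nat m * w1 \<and> of_nat a2 = of_nat m * w2)"

text \<open>
  Global sections of the \<open>n\<close>-th power of the line bundle are the regular functions on the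
  multicone that are multihomogeneous of the corresponding degree. The group acts on them through
  its linear action on the multicone, which is the linearization.
\<close>

definition C23_sections :: "line_bundle \<Rightarrow> nat \<Rightarrow> (C23_vec \<Rightarrow> complex) set" where
  "C23_sections = (\<lambda>(d, a1, a2) n.
     {s \<in> fs_regular (quasi_affine C23_coords C23_cone) C23_cone.
        \<forall>(f, v1, v2) \<in> C23_cone. \<forall>c b1 b2. c \<noteq> 0 \<and> b1 \<noteq> 0 \<and> b2 \<noteq> 0 \<longrightarrow>
          s ((\<lambda>v. c * f v), b1 *s v1, b2 *s v2) =
            c ^ (n * d) * b1 ^ (n * a1) * b2 ^ (n * a2) * s (f, v1, v2)})"

definition C23_invariant_sections :: "line_bundle \<Rightarrow> nat \<Rightarrow> (C23_vec \<Rightarrow> complex) set" where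
  "C23_invariant_sections L n =
     {s \<in> C23_sections L n. \<forall>g \<in> SL3. \<forall>z \<in> C23_cone. s (C23_act_vec g z) = s z}"

definition C23_nonvanishing :: "(C23_vec \<Rightarrow> complex) \<Rightarrow> C23_pt set" where
  "C23_nonvanishing s = C23_proj ` {z \<in> C23_cone. s z \<noteq> 0}"

text \<open>
  Stable points in the usual sense (properly stable in the original terminology of Mumford):
  some invariant section \<open>s\<close> of a positive power is nonzero at \<open>x\<close>, the orbits are closed in the
  locus where \<open>s\<close> does not vanish, and the stabilizer of \<open>x\<close> is finite. That this locus is affine
  need not be demanded, because the line bundles considered are ample.
\<close>

definition C23_stable :: "line_bundle \<Rightarrow> C23_pt set" where
  "C23_stable L = {x \<in> topspace (fs_top C23). \<exists>n \<ge> 1. \<exists>s \<in> C23_invariant_sections L n.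
     x \<in> C23_nonvanishing s \<and>
     (\<forall>y \<in> C23_nonvanishing s.
        closedin (subtopology (fs_top C23) (C23_nonvanishing s)) (C23_orbit y)) \<and>
     finite {g \<in> SL3. C23_act g x = x}}"

definition C23_quotient :: "line_bundle \<Rightarrow> C23_pt set fspace" where
  "C23_quotient L = fs_quotient C23_orbit (fs_open_sub C23 (C23_stable L))"


section \<open>Degree 3 pairs\<close>

type_synonym pair_vec = "(complex^3 \<Rightarrow> complex) \<times> (complex^3 \<Rightarrow> complex)"

definition pair_coords :: "(pair_vec \<Rightarrow> complex) set" where
  "pair_coords = {\<lambda>(f, l). f u | u. True} \<union> {\<lambda>(f, l). l u | u. True}"

definition pair_cone :: "pair_vec set" where
  "pair_cone = {(f, l). f \<in> plane_forms 3 \<and> f \<noteq> (\<lambda>_. 0) \<and> l \<in> plane_forms 1 \<and> l \<noteq> (\<lambda>_. 0)}"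

text \<open>The \<open>SL(3)\<close>-invariant sections of \<open>O(d) \<boxtimes> O(a)\<close> on the space of all pairs.\<close>

definition pair_invariant_sections :: "nat \<Rightarrow> nat \<Rightarrow> (pair_vec \<Rightarrow> complex) set" where
  "pair_invariant_sections d a =
     {s \<in> fs_regular (quasi_affine pair_coords pair_cone) pair_cone.
        (\<forall>(f, l) \<in> pair_cone. \<forall>c b. c \<noteq> 0 \<and> b \<noteq> 0 \<longrightarrow>
           s ((\<lambda>v. c * f v), (\<lambda>v. b * l v)) = c ^ d * b ^ a * s (f, l)) \<and>
        (\<forall>g \<in> SL3. \<forall>(f, l) \<in> pair_cone. s (act_form g f, act_form g l) = s (f, l))}"

text \<open>
  Semistability for the linearization of slope \<open>t\<close>: the positive powers of a line bundle
  proportional to \<open>O(1) \<boxtimes> O(t)\<close> are of the form \<open>O(d) \<boxtimes> O(a)\<close> with \<open>a = t d\<close>.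
\<close>

definition pair_semistable :: "rat \<Rightarrow> pair_vec set" where
  "pair_semistable t = {z \<in> pair_cone. \<exists>d a. d > 0 \<and> of_nat a = t * of_nat d \<and>
     (\<exists>s \<in> pair_invariant_sections d a. s z \<noteq> 0)}"


section \<open>Degree 3 pairs with labeled intersection\<close>

type_synonym lab_vec = "(complex^3 \<Rightarrow> complex) \<times> (complex^3 \<Rightarrow> complex) \<times> (complex^3) \<times> (complex^3) \<times> (complex^3)"
type_synonym lab_pt =
  "(complex^3 \<Rightarrow> complex) set \<times> (complex^3 \<Rightarrow> complex) set \<times> (complex^3) set \<times> (complex^3) set \<times> (complex^3) set"

definition lab_coords :: "(lab_vec \<Rightarrow> complex) set" where
  "lab_coords = {\<lambda>(f, l, v1, v2, v3). f u | u. True} \<union> {\<lambda>(f, l, v1, v2, v3). l u | u. True} \<union>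
     {\<lambda>(f, l, v1, v2, v3). v1 $ i | i. True} \<union> {\<lambda>(f, l, v1, v2, v3). v2 $ i | i. True} \<union>
     {\<lambda>(f, l, v1, v2, v3). v3 $ i | i. True}"

text \<open>
  Pairs of slope \<open>t\<close> with an ordering of the three points of intersection, where the cubic has
  at worst singularities of type \<open>A\<^sub>k\<close> and the line is transverse to it. The space is meant for
  slopes \<open>t\<close> just below \<open>3/2\<close>; there these two conditions describe precisely the
  semistable pairs, all of which are stable, so that the moduli space is an orbit space.
\<close>

definition lab_cone :: "rat \<Rightarrow> lab_vec set" where
  "lab_cone t = {(f, l, v1, v2, v3).
     (f, l) \<in> pair_semistable t \<and> at_worst_A_sings f \<and> transverse f l \<and>
     v1 \<noteq> 0 \<and> v2 \<noteq> 0 \<and> v3 \<noteq> 0 \<and> distinct [proj_pt v1, proj_pt v2, proj_pt v3] \<and>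
     {proj_pt v | v. v \<noteq> 0 \<and> f v = 0 \<and> l v = 0} = {proj_pt v1, proj_pt v2, proj_pt v3}}"

definition lab_proj :: "lab_vec \<Rightarrow> lab_pt" where
  "lab_proj = (\<lambda>(f, l, v1, v2, v3). (proj_form f, proj_form l, proj_pt v1, proj_pt v2, proj_pt v3))"

definition lab_pairs :: "rat \<Rightarrow> lab_pt fspace" where
  "lab_pairs t = fs_quotient lab_proj (quasi_affine lab_coords (lab_cone t))"

definition lab_act :: "complex^3^3 \<Rightarrow> lab_pt \<Rightarrow> lab_pt" where
  "lab_act g = (\<lambda>(C, l, q1, q2, q3).
     (act_form g ` C, act_form g ` l, (*v) g ` q1, (*v) g ` q2, (*v) g ` q3))"

definition lab_orbit :: "lab_pt \<Rightarrow> lab_pt set" where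
  "lab_orbit x = {lab_act g x | g. g \<in> SL3}"

definition M_lab_pairs :: "rat \<Rightarrow> lab_pt set fspace" where
  "M_lab_pairs t = fs_quotient lab_orbit (lab_pairs t)"


section \<open>Weighted projective space\<close>

definition weighted_class :: "nat^'n \<Rightarrow> complex^'n \<Rightarrow> (complex^'n) set" where
  "weighted_class q x = {\<chi> i. t ^ (q $ i) * x $ i | t. t \<noteq> 0}"

definition weighted_proj_space :: "nat^('n::finite) \<Rightarrow> (complex^'n) set fspace" where
  "weighted_proj_space q =
     fs_quotient (weighted_class q) (quasi_affine {\<lambda>x. x $ i | i. True} {x. x \<noteq> 0})"

lemma vector_4:
  "(vector [x, y, z, w] :: ('a::zero)^4) $ 1 = x" "(vector [x, y, z, w] :: ('a::zero)^4) $ 2 = y"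
  "(vector [x, y, z, w] :: ('a::zero)^4) $ 3 = z" "(vector [x, y, z, w] :: ('a::zero)^4) $ 4 = w"
  unfolding vector_def by simp_all

end

theory Submission
  imports Defs
begin

text \<open>
  Let \<open>F\<close> be the polarization of a cubic \<open>f\<close> through \<open>v\<^sub>1\<close>, \<open>v\<^sub>2\<close>, put \<open>a = F(v\<^sub>1,v\<^sub>1,v\<^sub>2)\<close>, \<open>b = F(v\<^sub>1,v\<^sub>2,v\<^sub>2)\<close>, and
  let \<open>w\<close> be the intersection of the lines \<open>F(v\<^sub>1,v\<^sub>1,\<sqdot>) = 0\<close> and \<open>F(v\<^sub>2,v\<^sub>2,\<sqdot>) = 0\<close>. If \<open>a, b \<noteq> 0\<close>, then
  \<open>v\<^sub>1/3a, v\<^sub>2/3b, w\<close> is a frame in which \<open>f\<close> is proportional to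
  \<open>x y (x + y) + m\<^sub>1 x y z + (m\<^sub>2 x + m\<^sub>3 y) z\<^sup>2 + m\<^sub>4 z\<^sup>3\<close>, and the only remaining freedom is the scaling of \<open>z\<close>,
  which acts on \<open>(m\<^sub>1, \<dots>, m\<^sub>4)\<close> with weights \<open>1, 2, 2, 3\<close>. For \<open>a, b, m \<noteq> 0\<close> the orbit space is therefore
  \<open>\<bbbP>(1,2,2,3)\<close>; adding the line \<open>z = 0\<close> and its third intersection with the cubic to the data does not
  change it. It remains to see that \<open>a, b, m \<noteq> 0\<close> describes the stable locus on both sides.

  In the chamber, the points with \<open>a = 0\<close>, \<open>b = 0\<close> or \<open>m = 0\<close> are destabilized by explicit one-parameter
  subgroups. Conversely, the products \<open>a\<^sup>i b\<^sup>j X\<^sup>k Y\<^sup>l\<close>, where \<open>X, Y\<close> are polynomial invariants that agree on the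
  relevant locus with some \<open>m\<^sub>i\<close> times powers of \<open>a\<close> and \<open>b\<close>, have exactly the right degrees. For
  pairs, transversality gives \<open>a, b \<noteq> 0\<close>, and \<open>m = 0\<close> means that the cubic is three concurrent lines, which
  is excluded because an ordinary triple point is not of type \<open>A\<^sub>k\<close>.
\<close>

section \<open>Isomorphisms of iterated quotients\<close>

text \<open>The two quotients are not compared directly. Each is matched with P(1,2,2,3) by
  polynomial maps on vectors, \<open>moduli\<close> in one direction and \<open>slice\<close> (or
  \<open>slice_lab\<close>) in the other, which are inverse only up to orbits; multiplying the
  coefficients by \<open>9 a b\<close> is what makes \<open>moduli\<close> polynomial. The hard part
  is to supply invariant sections. In the chamber, a product of invariants must have a multidegree
  exactly proportional to \<open>(d, a1, a2)\<close>, however close the linearization is to a wall,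
  so several invariants of different shape are needed. For pairs, no point of the intersection may
  be singled out, so the invariants are built from contractions along the line. The discriminant of
  the three points has bidegree \<open>(4, 6)\<close>, slope exactly 3/2, and the other invariants
  have slope at most 9/7; their products reach every slope in \<open>[9/7, 3/2)\<close>, whence the
  bound 3/14 on the distance to 3/2. Semistability of pairs is established on the slice, into which
  transversality and the A_k condition carry every labeled pair.\<close>

lemma polyfuns_compose:
  assumes "p \<in> polyfuns K'" and "\<And>k. k \<in> K' \<Longrightarrow> (\<lambda>x. k (\<mu> x)) \<in> polyfuns K"
  shows "(\<lambda>x. p (\<mu> x)) \<in> polyfuns K"
  using assms(1) by induction (auto intro: polyfuns.intros assms(2))

text \<open>A product of polynomials is nonzero exactly where both factors are, so the generating
  sets are closed under intersection and form a base, not merely a subbase.\<close>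

lemma openin_zariski_top:
  "openin (zariski_top K S) V \<longleftrightarrow>
     V \<subseteq> S \<and> (\<forall>x\<in>V. \<exists>p\<in>polyfuns K. p x \<noteq> 0 \<and> {y\<in>S. p y \<noteq> 0} \<subseteq> V)"
proof
  assume "openin (zariski_top K S) V"
  then have "generate_topology_on ((\<lambda>p. {x \<in> S. p x \<noteq> 0}) ` polyfuns K) V"
    by (simp add: zariski_top_def openin_topology_generated_by_iff)
  then show "V \<subseteq> S \<and> (\<forall>x\<in>V. \<exists>p\<in>polyfuns K. p x \<noteq> 0 \<and> {y\<in>S. p y \<noteq> 0} \<subseteq> V)"
  proof induction
    case (Int a b)
    have "\<exists>p\<in>polyfuns K. p x \<noteq> 0 \<and> {y\<in>S. p y \<noteq> 0} \<subseteq> a \<inter> b" if x: "x \<in> a" "x \<in> b" for x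
    proof -
      obtain p where "p \<in> polyfuns K" "p x \<noteq> 0" "{y\<in>S. p y \<noteq> 0} \<subseteq> a"
        using bspec[OF conjunct2[OF Int.IH(1)] x(1)] by (elim bexE conjE)
      moreover obtain q where "q \<in> polyfuns K" "q x \<noteq> 0" "{y\<in>S. q y \<noteq> 0} \<subseteq> b"
        using bspec[OF conjunct2[OF Int.IH(2)] x(2)] by (elim bexE conjE)
      ultimately show ?thesis
        by (intro bexI[of _ "\<lambda>x. p x * q x"] polyfuns.mult) auto
    qed
    with Int.IH show ?case by auto
  next
    case (UN F)
    show ?case
    proof (intro conjI ballI)
      show "\<Union>F \<subseteq> S" using UN.IH by auto
      fix x assume "x \<in> \<Union>F"
      then obtain A where A: "A \<in> F" "x \<in> A" by auto
      then obtain p where "p \<in> polyfuns K" "p x \<noteq> 0" "{y\<in>S. p y \<noteq> 0} \<subseteq> A"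
        using bspec[OF conjunct2[OF UN.IH[OF A(1)]] A(2)] by (elim bexE conjE)
      with A show "\<exists>p\<in>polyfuns K. p x \<noteq> 0 \<and> {y\<in>S. p y \<noteq> 0} \<subseteq> \<Union>F"
        by (intro bexI[of _ p]) auto
    qed
  qed auto
next
  assume R: "V \<subseteq> S \<and> (\<forall>x\<in>V. \<exists>p\<in>polyfuns K. p x \<noteq> 0 \<and> {y\<in>S. p y \<noteq> 0} \<subseteq> V)"
  show "openin (zariski_top K S) V"
  proof (subst openin_subopen, intro ballI)
    fix x assume x: "x \<in> V"
    then obtain p where p: "p \<in> polyfuns K" "p x \<noteq> 0" "{y\<in>S. p y \<noteq> 0} \<subseteq> V"
      using bspec[OF conjunct2[OF R] x] by (elim bexE conjE)
    have "openin (zariski_top K S) {y\<in>S. p y \<noteq> 0}"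
      unfolding zariski_top_def by (rule topology_generated_by_Basis) (rule imageI[OF p(1)])
    moreover have "x \<in> {y\<in>S. p y \<noteq> 0}" using x R p(2) by blast
    ultimately show "\<exists>T. openin (zariski_top K S) T \<and> x \<in> T \<and> T \<subseteq> V" using p(3) by blast
  qed
qed

lemma openin_zariski_basic: "p \<in> polyfuns K \<Longrightarrow> openin (zariski_top K S) {x\<in>S. p x \<noteq> 0}"
  by (auto simp: openin_zariski_top)

lemma zariski_preimage_open:
  assumes "openin (zariski_top K S) S0" "openin (zariski_top K' S') V" "\<mu> ` S0 \<subseteq> S'"
    and "\<And>k. k \<in> K' \<Longrightarrow> (\<lambda>x. k (\<mu> x)) \<in> polyfuns K"
  shows "openin (zariski_top K S) {x\<in>S0. \<mu> x \<in> V}"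
  unfolding openin_zariski_top
proof (intro conjI ballI)
  show "{x\<in>S0. \<mu> x \<in> V} \<subseteq> S" using assms(1) by (auto simp: openin_zariski_top)
  fix x assume x: "x \<in> {x\<in>S0. \<mu> x \<in> V}"
  obtain p where p: "p \<in> polyfuns K'" "p (\<mu> x) \<noteq> 0" "{y\<in>S'. p y \<noteq> 0} \<subseteq> V"
    using assms(2) x unfolding openin_zariski_top by auto
  obtain q where q: "q \<in> polyfuns K" "q x \<noteq> 0" "{y\<in>S. q y \<noteq> 0} \<subseteq> S0"
    using assms(1) x unfolding openin_zariski_top by auto
  \<comment> \<open>The factor \<open>q\<close> confines the basic open set to \<open>S0\<close>;
    outside it \<mu> need not land in \<open>S'\<close>.\<close>
  have "(\<lambda>x. p (\<mu> x) * q x) \<in> polyfuns K"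
    using p(1) q(1) by (intro polyfuns.mult polyfuns_compose[OF _ assms(4)])
  then show "\<exists>p\<in>polyfuns K. p x \<noteq> 0 \<and> {y \<in> S. p y \<noteq> 0} \<subseteq> {x \<in> S0. \<mu> x \<in> V}"
    using p q assms(3) by (intro bexI[of _ "\<lambda>x. p (\<mu> x) * q x"]) auto
qed

lemma regular_quasi_affine:
  "h \<in> fs_regular (quasi_affine K S) U \<longleftrightarrow>
    (\<forall>x \<in> U. \<exists>V p q. openin (zariski_top K S) V \<and> x \<in> V \<and> V \<subseteq> U \<and>
        p \<in> polyfuns K \<and> q \<in> polyfuns K \<and> (\<forall>y \<in> V. q y \<noteq> 0 \<and> h y = p y / q y))"
  by (simp add: quasi_affine_def)

lemma top_quasi_affine [simp]: "fs_top (quasi_affine K S) = zariski_top K S"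
  by (simp add: quasi_affine_def)

lemma regular_quasi_affine_cong:
  assumes "h \<in> fs_regular (quasi_affine K S) U" "\<And>x. x \<in> U \<Longrightarrow> h x = h' x"
  shows "h' \<in> fs_regular (quasi_affine K S) U"
  unfolding regular_quasi_affine
proof
  fix x assume "x \<in> U"
  with assms(1) have "\<exists>V p q. openin (zariski_top K S) V \<and> x \<in> V \<and> V \<subseteq> U \<and>
      p \<in> polyfuns K \<and> q \<in> polyfuns K \<and> (\<forall>y \<in> V. q y \<noteq> 0 \<and> h y = p y / q y)"
    unfolding regular_quasi_affine by (rule bspec)
  then obtain V p q where V: "openin (zariski_top K S) V" "x \<in> V" "V \<subseteq> U"
    "p \<in> polyfuns K" "q \<in> polyfuns K" "\<forall>y \<in> V. q y \<noteq> 0 \<and> h y = p y / q y"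
    by (elim exE conjE)
  then have "\<forall>y \<in> V. q y \<noteq> 0 \<and> h' y = p y / q y" using assms(2) by (metis subset_iff)
  with V show "\<exists>V p q. openin (zariski_top K S) V \<and> x \<in> V \<and> V \<subseteq> U \<and>
      p \<in> polyfuns K \<and> q \<in> polyfuns K \<and> (\<forall>y \<in> V. q y \<noteq> 0 \<and> h' y = p y / q y)"
    by (intro exI conjI)
qed

lemma polyfuns_regular:
  assumes "p \<in> polyfuns K"
  shows "p \<in> fs_regular (quasi_affine K S) S"
proof -
  have "openin (zariski_top K S) S"
    using openin_topspace[of "zariski_top K S"] by (simp add: topspace_zariski_top)
  moreover have "\<forall>y\<in>S. (1::complex) \<noteq> 0 \<and> p y = p y / 1" by simp
  ultimately show ?thesis
    unfolding regular_quasi_affine using assms polyfuns.const[of 1 K] by blast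
qed

lemma regular_pullback:
  assumes "openin (zariski_top K S) S0" "\<mu> ` S0 \<subseteq> S'"
    and "\<And>k. k \<in> K' \<Longrightarrow> (\<lambda>x. k (\<mu> x)) \<in> polyfuns K"
    and h: "h \<in> fs_regular (quasi_affine K' S') V"
  shows "(\<lambda>x. h (\<mu> x)) \<in> fs_regular (quasi_affine K S) {x\<in>S0. \<mu> x \<in> V}"
  unfolding regular_quasi_affine
proof
  fix x assume x: "x \<in> {x\<in>S0. \<mu> x \<in> V}"
  then have "\<mu> x \<in> V" by simp
  with h have "\<exists>V0 p q. openin (zariski_top K' S') V0 \<and> \<mu> x \<in> V0 \<and> V0 \<subseteq> V \<and>
      p \<in> polyfuns K' \<and> q \<in> polyfuns K' \<and> (\<forall>y \<in> V0. q y \<noteq> 0 \<and> h y = p y / q y)"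
    unfolding regular_quasi_affine by (rule bspec)
  then obtain V0 p q where V0: "openin (zariski_top K' S') V0" "\<mu> x \<in> V0" "V0 \<subseteq> V"
    "p \<in> polyfuns K'" "q \<in> polyfuns K'" "\<forall>y \<in> V0. q y \<noteq> 0 \<and> h y = p y / q y"
    by (elim exE conjE)
  have "openin (zariski_top K S) {x\<in>S0. \<mu> x \<in> V0}"
    by (rule zariski_preimage_open[OF assms(1) V0(1) assms(2,3)])
  moreover have "(\<lambda>x. p (\<mu> x)) \<in> polyfuns K" "(\<lambda>x. q (\<mu> x)) \<in> polyfuns K"
    using V0(4,5) by (auto intro: polyfuns_compose[OF _ assms(3)])
  moreover have "x \<in> {x\<in>S0. \<mu> x \<in> V0}" "{x\<in>S0. \<mu> x \<in> V0} \<subseteq> {x \<in> S0. \<mu> x \<in> V}"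
    "\<forall>y\<in>{x\<in>S0. \<mu> x \<in> V0}. q (\<mu> y) \<noteq> 0 \<and> h (\<mu> y) = p (\<mu> y) / q (\<mu> y)"
    using V0(2,3,6) x by auto
  ultimately show "\<exists>V' p q. openin (zariski_top K S) V' \<and> x \<in> V' \<and> V' \<subseteq> {x \<in> S0. \<mu> x \<in> V} \<and>
      p \<in> polyfuns K \<and> q \<in> polyfuns K \<and> (\<forall>y\<in>V'. q y \<noteq> 0 \<and> h (\<mu> y) = p y / q y)"
    by (intro exI conjI)
qed

section \<open>Quotients of cones and the morphisms induced by polynomial maps\<close>

lemma top_fs_quotient [simp]: "fs_top (fs_quotient \<pi> X) = quotient_top \<pi> (fs_top X)"
  by (simp add: fs_quotient_def)

lemma regular_fs_quotient: "h \<in> fs_regular (fs_quotient \<pi> X) U \<longleftrightarrow>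
    h \<circ> \<pi> \<in> fs_regular X {x \<in> topspace (fs_top X). \<pi> x \<in> U}"
  by (simp add: fs_quotient_def)

lemma fs_open_sub_topspace: "fs_open_sub X (topspace (fs_top X)) = (X :: 'a fspace)"
  by (simp add: fs_open_sub_def)

text \<open>Topology and regular functions of \<open>Z\<close> are tested after pulling back along
  \<pi> to the open part \<open>S0\<close> of a single quasi-affine space. A quotient of an open
  part of a quotient is thereby flattened to one map from vectors to orbits, and morphisms can be
  given by polynomials in vectors.\<close>

definition presented :: "'b fspace \<Rightarrow> ('a \<Rightarrow> complex) set \<Rightarrow> 'a set \<Rightarrow> 'a set \<Rightarrow> ('a \<Rightarrow> 'b) \<Rightarrow> bool" where
  "presented Z K S S0 \<pi> \<longleftrightarrow> openin (zariski_top K S) S0 \<and>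
     (\<forall>U. openin (fs_top Z) U \<longleftrightarrow> U \<subseteq> \<pi> ` S0 \<and> openin (zariski_top K S) {z\<in>S0. \<pi> z \<in> U}) \<and>
     (\<forall>U h. h \<in> fs_regular Z U \<longleftrightarrow> (\<lambda>z. h (\<pi> z)) \<in> fs_regular (quasi_affine K S) {z\<in>S0. \<pi> z \<in> U})"

lemma presented_topspace:
  assumes "presented Z K S S0 \<pi>" shows "topspace (fs_top Z) = \<pi> ` S0"
proof
  show "topspace (fs_top Z) \<subseteq> \<pi> ` S0"
    using assms openin_topspace[of "fs_top Z"] unfolding presented_def by blast
  have "{z\<in>S0. \<pi> z \<in> \<pi> ` S0} = S0" by blast
  then have "openin (fs_top Z) (\<pi> ` S0)" using assms by (simp add: presented_def)
  then show "\<pi> ` S0 \<subseteq> topspace (fs_top Z)" by (rule openin_subset)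
qed

lemma presented_quotient: "presented (fs_quotient \<kappa> (quasi_affine K S)) K S S \<kappa>"
proof -
  have "openin (zariski_top K S) S"
    using openin_topspace[of "zariski_top K S"] by (simp add: topspace_zariski_top)
  then show ?thesis
    by (simp add: presented_def openin_quotient_top topspace_zariski_top regular_fs_quotient comp_def)
qed

text \<open>In the applications \<pi> is projectivization, \<open>T\<close> the locus whose quotient
  is taken and \<rho> the passage to orbits. Open sets and functions are pulled back twice, so only
  the preimage of \<open>T\<close> among vectors remains.\<close>

lemma presented_double_quotient:
  assumes T: "T \<subseteq> \<pi> ` S" and T_open: "openin (zariski_top K S) {z\<in>S. \<pi> z \<in> T}"
  shows "presented (fs_quotient \<rho> (fs_open_sub (fs_quotient \<pi> (quasi_affine K S)) T)) K S {z\<in>S. \<pi> z \<in> T} (\<lambda>z. \<rho> (\<pi> z))"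
    (is "presented ?Z K S ?S0 _")
  unfolding presented_def
proof (intro conjI allI T_open)
  have T_open': "openin (quotient_top \<pi> (zariski_top K S)) T"
    using T T_open by (simp add: openin_quotient_top topspace_zariski_top)
  have top_sub: "topspace (fs_top (fs_open_sub (fs_quotient \<pi> (quasi_affine K S)) T)) = T"
    using T by (auto simp: fs_open_sub_def topspace_quotient_top topspace_zariski_top)
  have pre: "{x \<in> S. \<pi> x \<in> {x \<in> T. \<rho> x \<in> U}} = {z\<in>?S0. \<rho> (\<pi> z) \<in> U}" for U by auto
  have im: "\<rho> ` T = (\<lambda>z. \<rho> (\<pi> z)) ` ?S0" using T by auto
  show "openin (fs_top ?Z) U \<longleftrightarrow>
      U \<subseteq> (\<lambda>z. \<rho> (\<pi> z)) ` ?S0 \<and> openin (zariski_top K S) {z\<in>?S0. \<rho> (\<pi> z) \<in> U}" for U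
  proof -
    have "openin (fs_top ?Z) U \<longleftrightarrow> U \<subseteq> \<rho> ` T \<and>
        openin (subtopology (quotient_top \<pi> (zariski_top K S)) T) {x \<in> T. \<rho> x \<in> U}"
      using top_sub unfolding top_fs_quotient openin_quotient_top by (simp add: fs_open_sub_def)
    also have "\<dots> \<longleftrightarrow> U \<subseteq> \<rho> ` T \<and> openin (quotient_top \<pi> (zariski_top K S)) {x \<in> T. \<rho> x \<in> U}"
      using openin_open_subtopology[OF T_open'] by auto
    also have "\<dots> \<longleftrightarrow> U \<subseteq> \<rho> ` T \<and> openin (zariski_top K S) {x \<in> S. \<pi> x \<in> {x \<in> T. \<rho> x \<in> U}}"
      using T by (auto simp: openin_quotient_top topspace_zariski_top)
    finally show ?thesis unfolding pre im .
  qed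
  show "h \<in> fs_regular ?Z U \<longleftrightarrow>
      (\<lambda>z. h (\<rho> (\<pi> z))) \<in> fs_regular (quasi_affine K S) {z\<in>?S0. \<rho> (\<pi> z) \<in> U}" for h U
  proof -
    have "h \<in> fs_regular ?Z U \<longleftrightarrow> h \<circ> \<rho> \<in> fs_regular (fs_quotient \<pi> (quasi_affine K S)) {x \<in> T. \<rho> x \<in> U}"
      unfolding regular_fs_quotient[of h \<rho>] top_sub by (simp add: fs_open_sub_def)
    also have "\<dots> \<longleftrightarrow> h \<circ> \<rho> \<circ> \<pi> \<in> fs_regular (quasi_affine K S) {x \<in> S. \<pi> x \<in> {x \<in> T. \<rho> x \<in> U}}"
      unfolding regular_fs_quotient[of _ \<pi>] top_quasi_affine topspace_zariski_top ..
    finally show ?thesis unfolding pre by (simp add: comp_def)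
  qed
qed

lemma presented_morphism:
  assumes X: "presented X K S S0 \<pi>" and Y: "presented Y K' S' S0' \<pi>'"
    and \<mu>: "\<And>z. z \<in> S0 \<Longrightarrow> \<mu> z \<in> S0'" "\<And>k. k \<in> K' \<Longrightarrow> (\<lambda>z. k (\<mu> z)) \<in> polyfuns K"
    and \<phi>: "\<And>z. z \<in> S0 \<Longrightarrow> \<phi> (\<pi> z) = \<pi>' (\<mu> z)"
  shows "fs_morphism X Y \<phi>"
proof -
  have S0: "openin (zariski_top K S) S0" using X by (simp add: presented_def)
  have \<mu>S: "\<mu> ` S0 \<subseteq> S'"
    using \<mu>(1) Y openin_subset[of "zariski_top K' S'" S0'] by (auto simp: presented_def topspace_zariski_top)
  have pre: "{z\<in>S0. \<pi> z \<in> {x \<in> topspace (fs_top X). \<phi> x \<in> V}} = {z\<in>S0. \<mu> z \<in> {x\<in>S0'. \<pi>' x \<in> V}}" for V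
    unfolding presented_topspace[OF X] using \<mu>(1) \<phi>
    by (intro Collect_cong) (metis (lifting) image_eqI mem_Collect_eq)
  show ?thesis
    unfolding fs_morphism_def continuous_map_def
  proof (intro conjI allI impI)
    show "\<phi> \<in> topspace (fs_top X) \<rightarrow> topspace (fs_top Y)"
      unfolding presented_topspace[OF X] presented_topspace[OF Y] using \<mu>(1) \<phi> by auto
    fix V assume "openin (fs_top Y) V"
    then have "openin (zariski_top K' S') {x\<in>S0'. \<pi>' x \<in> V}" using Y by (simp add: presented_def)
    from zariski_preimage_open[OF S0 this \<mu>S \<mu>(2)]
    have "openin (zariski_top K S) {z\<in>S0. \<mu> z \<in> {x\<in>S0'. \<pi>' x \<in> V}}" .
    then show "openin (fs_top X) {x \<in> topspace (fs_top X). \<phi> x \<in> V}"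
      using X presented_topspace[OF X] unfolding pre[symmetric] presented_def by blast
  next
    fix V h assume "openin (fs_top Y) V \<and> h \<in> fs_regular Y V"
    then have "(\<lambda>x. h (\<pi>' x)) \<in> fs_regular (quasi_affine K' S') {x\<in>S0'. \<pi>' x \<in> V}"
      using Y by (simp add: presented_def)
    from regular_pullback[OF S0 \<mu>S \<mu>(2) this]
    have "(\<lambda>z. h (\<pi>' (\<mu> z))) \<in> fs_regular (quasi_affine K S) {z\<in>S0. \<mu> z \<in> {x\<in>S0'. \<pi>' x \<in> V}}" .
    then have "(\<lambda>z. (h \<circ> \<phi>) (\<pi> z)) \<in> fs_regular (quasi_affine K S) {z\<in>S0. \<mu> z \<in> {x\<in>S0'. \<pi>' x \<in> V}}"
      by (rule regular_quasi_affine_cong) (use \<phi> in auto)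
    then show "h \<circ> \<phi> \<in> fs_regular X {x \<in> topspace (fs_top X). \<phi> x \<in> V}"
      using X unfolding pre[symmetric] presented_def by blast
  qed
qed

lemma descend:
  assumes "\<And>z z'. \<lbrakk>z \<in> S; z' \<in> S; \<pi> z = \<pi> z'\<rbrakk> \<Longrightarrow> g z = g z'"
  shows "\<exists>\<phi>. \<forall>z\<in>S. \<phi> (\<pi> z) = g z"
proof (intro exI ballI)
  fix z assume "z \<in> S"
  then have "(SOME z'. z' \<in> S \<and> \<pi> z' = \<pi> z) \<in> S \<and> \<pi> (SOME z'. z' \<in> S \<and> \<pi> z' = \<pi> z) = \<pi> z"
    by (intro someI[where P = "\<lambda>z'. z' \<in> S \<and> \<pi> z' = \<pi> z" and x = z]) simp
  with \<open>z \<in> S\<close> show "(\<lambda>O'. g (SOME z. z \<in> S \<and> \<pi> z = O')) (\<pi> z) = g z" using assms by blast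
qed

text \<open>The maps \<mu> and \<sigma> respect the fibres and are mutually inverse up to fibres.
  Continuity and regularity of the induced maps, in both directions, come from polynomiality
  upstairs.\<close>

lemma presented_isomorphism:
  assumes X: "presented X K S S0 \<pi>" and Y: "presented Y K' S' S0' \<pi>'"
    and \<mu>: "\<And>z. z \<in> S0 \<Longrightarrow> \<mu> z \<in> S0'" "\<And>k. k \<in> K' \<Longrightarrow> (\<lambda>z. k (\<mu> z)) \<in> polyfuns K"
    and \<sigma>: "\<And>x. x \<in> S0' \<Longrightarrow> \<sigma> x \<in> S0" "\<And>k. k \<in> K \<Longrightarrow> (\<lambda>x. k (\<sigma> x)) \<in> polyfuns K'"
    and \<mu>_inv: "\<And>z z'. \<lbrakk>z \<in> S0; z' \<in> S0; \<pi> z = \<pi> z'\<rbrakk> \<Longrightarrow> \<pi>' (\<mu> z) = \<pi>' (\<mu> z')"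
    and \<sigma>_inv: "\<And>x x'. \<lbrakk>x \<in> S0'; x' \<in> S0'; \<pi>' x = \<pi>' x'\<rbrakk> \<Longrightarrow> \<pi> (\<sigma> x) = \<pi> (\<sigma> x')"
    and \<mu>\<sigma>: "\<And>x. x \<in> S0' \<Longrightarrow> \<pi>' (\<mu> (\<sigma> x)) = \<pi>' x" and \<sigma>\<mu>: "\<And>z. z \<in> S0 \<Longrightarrow> \<pi> (\<sigma> (\<mu> z)) = \<pi> z"
  shows "\<exists>\<phi>. fs_isomorphism X Y \<phi>"
proof -
  obtain \<phi> where \<phi>: "\<And>z. z \<in> S0 \<Longrightarrow> \<phi> (\<pi> z) = \<pi>' (\<mu> z)"
    using descend[of S0 \<pi> "\<lambda>z. \<pi>' (\<mu> z)", OF \<mu>_inv] by blast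
  obtain \<psi> where \<psi>: "\<And>x. x \<in> S0' \<Longrightarrow> \<psi> (\<pi>' x) = \<pi> (\<sigma> x)"
    using descend[of S0' \<pi>' "\<lambda>x. \<pi> (\<sigma> x)", OF \<sigma>_inv] by blast
  have "fs_morphism X Y \<phi>"
    by (rule presented_morphism[OF X Y, of \<mu>]) (use \<mu> \<phi> in auto)
  moreover have "fs_morphism Y X \<psi>"
    by (rule presented_morphism[OF Y X, of \<sigma>]) (use \<sigma> \<psi> in auto)
  moreover have "\<forall>x\<in>topspace (fs_top X). \<psi> (\<phi> x) = x" "\<forall>y\<in>topspace (fs_top Y). \<phi> (\<psi> y) = y"
    unfolding presented_topspace[OF X] presented_topspace[OF Y] by (auto simp: \<phi> \<psi> \<mu> \<sigma> \<mu>\<sigma> \<sigma>\<mu>)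
  ultimately show ?thesis unfolding fs_isomorphism_def by blast
qed

lemma presented_weighted_proj_space:
  "presented (weighted_proj_space q) {\<lambda>x. x $ i | i. True} {x. x \<noteq> 0} {x. x \<noteq> 0} (weighted_class q)"
  unfolding weighted_proj_space_def by (rule presented_quotient)

lemma fs_morphism_compose:
  assumes "fs_morphism X Y \<phi>" "fs_morphism Y Z \<psi>"
  shows "fs_morphism X Z (\<psi> \<circ> \<phi>)"
  unfolding fs_morphism_def
proof (intro conjI allI impI)
  show "continuous_map (fs_top X) (fs_top Z) (\<psi> \<circ> \<phi>)"
    using assms unfolding fs_morphism_def by (blast intro: continuous_map_compose)
  fix V h assume V: "openin (fs_top Z) V \<and> h \<in> fs_regular Z V"
  let ?U = "{y \<in> topspace (fs_top Y). \<psi> y \<in> V}"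
  have "openin (fs_top Y) ?U" "h \<circ> \<psi> \<in> fs_regular Y ?U"
    using assms(2) V unfolding fs_morphism_def continuous_map_def by auto
  then have "(h \<circ> \<psi>) \<circ> \<phi> \<in> fs_regular X {x \<in> topspace (fs_top X). \<phi> x \<in> ?U}"
    using assms(1) unfolding fs_morphism_def by blast
  moreover have "{x \<in> topspace (fs_top X). \<phi> x \<in> ?U} = {x \<in> topspace (fs_top X). (\<psi> \<circ> \<phi>) x \<in> V}"
    using assms(1) unfolding fs_morphism_def continuous_map_def by auto
  ultimately show "h \<circ> (\<psi> \<circ> \<phi>) \<in> fs_regular X {x \<in> topspace (fs_top X). (\<psi> \<circ> \<phi>) x \<in> V}"
    by (simp add: comp_assoc)
qed

lemma fs_isomorphism_compose_inverse:
  assumes "fs_isomorphism X Z \<phi>" "fs_isomorphism Y Z \<phi>'"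
  shows "\<exists>\<theta>. fs_isomorphism X Y \<theta>"
proof -
  obtain \<psi> where \<phi>: "fs_morphism X Z \<phi>" "fs_morphism Z X \<psi>"
    "\<forall>x \<in> topspace (fs_top X). \<psi> (\<phi> x) = x" "\<forall>z \<in> topspace (fs_top Z). \<phi> (\<psi> z) = z"
    using assms(1) unfolding fs_isomorphism_def by blast
  obtain \<psi>' where \<phi>': "fs_morphism Y Z \<phi>'" "fs_morphism Z Y \<psi>'"
    "\<forall>y \<in> topspace (fs_top Y). \<psi>' (\<phi>' y) = y" "\<forall>z \<in> topspace (fs_top Z). \<phi>' (\<psi>' z) = z"
    using assms(2) unfolding fs_isomorphism_def by blast
  have "\<phi> x \<in> topspace (fs_top Z)" if "x \<in> topspace (fs_top X)" for x
    using \<phi>(1) that unfolding fs_morphism_def continuous_map_def by auto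
  moreover have "\<phi>' y \<in> topspace (fs_top Z)" if "y \<in> topspace (fs_top Y)" for y
    using \<phi>'(1) that unfolding fs_morphism_def continuous_map_def by auto
  ultimately have "fs_isomorphism X Y (\<psi>' \<circ> \<phi>)"
    unfolding fs_isomorphism_def
    using fs_morphism_compose[OF \<phi>(1) \<phi>'(2)] fs_morphism_compose[OF \<phi>'(1) \<phi>(2)] \<phi>(3,4) \<phi>'(3,4)
    by (intro conjI exI[of _ "\<psi> \<circ> \<phi>'"]) auto
  then show ?thesis by blast
qed

section \<open>Forms on the plane and their polarizations\<close>

lemma polyfuns_sum: "(\<And>i. i \<in> I \<Longrightarrow> (\<lambda>x. p i x) \<in> polyfuns K) \<Longrightarrow> (\<lambda>x. \<Sum>i\<in>I. p i x) \<in> polyfuns K"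
  by (induction I rule: infinite_finite_induct) (auto intro: polyfuns.const polyfuns.add)

lemma polyfuns_power: "p \<in> polyfuns K \<Longrightarrow> (\<lambda>x. p x ^ n) \<in> polyfuns K"
  by (induction n) (auto intro: polyfuns.const polyfuns.mult)

lemma polyfuns_cdiv: "p \<in> polyfuns K \<Longrightarrow> (\<lambda>x. p x / c) \<in> polyfuns K"
  using polyfuns.mult[OF polyfuns.const[of "1/c"], of p K] by simp

lemma polyfuns_minus: "p \<in> polyfuns K \<Longrightarrow> (\<lambda>x. - p x) \<in> polyfuns K"
  using polyfuns.mult[OF polyfuns.const[of "-1"], of p K] by simp

lemma polyfuns_diff: "p \<in> polyfuns K \<Longrightarrow> q \<in> polyfuns K \<Longrightarrow> (\<lambda>x. p x - q x) \<in> polyfuns K"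
  using polyfuns.add[OF _ polyfuns_minus, of p K q] by simp

lemmas polyfuns_intros =
  polyfuns.const polyfuns.add polyfuns.mult polyfuns_sum polyfuns_power polyfuns_cdiv polyfuns_minus polyfuns_diff

definition clin :: "(complex^'n \<Rightarrow> complex) \<Rightarrow> bool" where
  "clin l \<longleftrightarrow> (\<forall>x y. l (x + y) = l x + l y) \<and> (\<forall>c x. l (c *s x) = c * l x)"

definition trilin :: "(complex^'n \<Rightarrow> complex^'n \<Rightarrow> complex^'n \<Rightarrow> complex) \<Rightarrow> bool" where
  "trilin B \<longleftrightarrow> (\<forall>y z. clin (\<lambda>x. B x y z)) \<and> (\<forall>x z. clin (\<lambda>y. B x y z)) \<and> (\<forall>x y. clin (B x y))"

lemma clin_add: "clin l \<Longrightarrow> l (x + y) = l x + l y"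
  and clin_scale: "clin l \<Longrightarrow> l (c *s x) = c * l x"
  by (auto simp: clin_def)

lemma clin_zero: "clin l \<Longrightarrow> l 0 = 0"
  using clin_scale[of l 0 0] by simp

lemma clin_diff: "clin l \<Longrightarrow> l (x - y) = l x - l y"
  using clin_add[of l "x - y" y] by simp

lemma clin_sum: "clin l \<Longrightarrow> l (\<Sum>i\<in>I. x i) = (\<Sum>i\<in>I. l (x i))"
  by (induction I rule: infinite_finite_induct) (auto simp: clin_add clin_zero)

lemma clin_basis: "clin l \<Longrightarrow> l x = (\<Sum>i\<in>UNIV. x $ i * l (axis i 1))"
  by (subst basis_expansion[symmetric]) (simp add: clin_sum clin_scale)

lemma clin_comp: "clin l \<Longrightarrow> clin (\<lambda>x. l (G *v x))"
  by (simp add: clin_def matrix_vector_right_distrib vector_scalar_commute)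

text \<open>\<open>polyfuns\<close> carries no notion of degree, so the parts of degree at most
  three are extracted by induction, already in multilinear form. Everything of higher degree is
  collected in \<open>R\<close>, where continuity in \<open>t\<close> is enough to separate it from
  the rest.\<close>

lemma polyfuns_truncation:
  fixes p :: "complex^'n \<Rightarrow> complex"
  assumes "p \<in> polyfuns {\<lambda>v. v $ i | i. True}"
  shows "\<exists>c l Q B R. clin l \<and> (\<forall>y. clin (\<lambda>x. Q x y)) \<and> (\<forall>x. clin (Q x)) \<and> trilin B \<and>
    (\<forall>v. continuous_on UNIV (R v)) \<and>
    (\<forall>t v. p (t *s v) = c + t * l v + t^2 * Q v v + t^3 * B v v v + t^4 * R v t)"
  using assms
proof induction
  case (const c)
  show ?case
    by (intro exI[of _ c] exI[of _ "\<lambda>_. 0"] exI[of _ "\<lambda>_ _. 0"] exI[of _ "\<lambda>_ _ _. 0"])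
      (simp add: clin_def trilin_def)
next
  case (coord k)
  then obtain i where "k = (\<lambda>v. v $ i)" by blast
  then show ?case
    by (intro exI[of _ 0] exI[of _ "\<lambda>v. v $ i"] exI[of _ "\<lambda>_ _. 0"] exI[of _ "\<lambda>_ _ _. 0"])
      (simp add: clin_def trilin_def)
next
  case (add p q)
  obtain c l Q B R where 1: "clin l" "\<forall>y. clin (\<lambda>x. Q x y)" "\<forall>x. clin (Q x)" "trilin B"
    "\<forall>v. continuous_on UNIV (R v)"
    "\<forall>t v. p (t *s v) = c + t * l v + t^2 * Q v v + t^3 * B v v v + t^4 * R v t"
    using add.IH(1) by (elim exE conjE)
  obtain c' l' Q' B' R' where 2: "clin l'" "\<forall>y. clin (\<lambda>x. Q' x y)" "\<forall>x. clin (Q' x)" "trilin B'"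
    "\<forall>v. continuous_on UNIV (R' v)"
    "\<forall>t v. q (t *s v) = c' + t * l' v + t^2 * Q' v v + t^3 * B' v v v + t^4 * R' v t"
    using add.IH(2) by (elim exE conjE)
  show ?case
    apply (rule exI[of _ "c + c'"], rule exI[of _ "\<lambda>v. l v + l' v"], rule exI[of _ "\<lambda>x y. Q x y + Q' x y"],
        rule exI[of _ "\<lambda>x y z. B x y z + B' x y z"], rule exI[of _ "\<lambda>v t. R v t + R' v t"])
    using 1 2 by (auto simp: clin_def trilin_def algebra_simps intro: continuous_on_add)
next
  case (mult p q)
  obtain c l Q B R where 1: "clin l" "\<forall>y. clin (\<lambda>x. Q x y)" "\<forall>x. clin (Q x)" "trilin B"
    "\<forall>v. continuous_on UNIV (R v)"
    "\<forall>t v. p (t *s v) = c + t * l v + t^2 * Q v v + t^3 * B v v v + t^4 * R v t"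
    using mult.IH(1) by (elim exE conjE)
  obtain c' l' Q' B' R' where 2: "clin l'" "\<forall>y. clin (\<lambda>x. Q' x y)" "\<forall>x. clin (Q' x)" "trilin B'"
    "\<forall>v. continuous_on UNIV (R' v)"
    "\<forall>t v. q (t *s v) = c' + t * l' v + t^2 * Q' v v + t^3 * B' v v v + t^4 * R' v t"
    using mult.IH(2) by (elim exE conjE)
  \<comment> \<open>All terms of order at least four in the product of the two expansions, divided
    by \<open>t^4\<close>.\<close>
  define R'' where "R'' v t = l v * B' v v v + Q v v * Q' v v + B v v v * l' v
     + t * (Q v v * B' v v v + B v v v * Q' v v) + t^2 * (B v v v * B' v v v)
     + R v t * (c' + t * l' v + t^2 * Q' v v + t^3 * B' v v v)
     + R' v t * (c + t * l v + t^2 * Q v v + t^3 * B v v v) + t^4 * R v t * R' v t" for v t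
  have "continuous_on UNIV (R'' v)" for v
    unfolding R''_def using 1(5) 2(5) by (intro continuous_intros) auto
  moreover have "clin (\<lambda>v. c * l' v + c' * l v)"
    using 1 2 by (simp add: clin_def algebra_simps)
  moreover have "\<forall>y. clin (\<lambda>x. c * Q' x y + c' * Q x y + l x * l' y)"
    "\<forall>x. clin (\<lambda>y. c * Q' x y + c' * Q x y + l x * l' y)"
    using 1 2 by (simp_all add: clin_def algebra_simps)
  moreover have "trilin (\<lambda>x y z. c * B' x y z + c' * B x y z + l x * Q' y z + Q x y * l' z)"
    using 1 2 by (simp add: clin_def trilin_def algebra_simps)
  moreover have "p (t *s v) * q (t *s v) = c * c' + t * (c * l' v + c' * l v)
      + t^2 * (c * Q' v v + c' * Q v v + l v * l' v)
      + t^3 * (c * B' v v v + c' * B v v v + l v * Q' v v + Q v v * l' v) + t^4 * R'' v t" for t v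
    unfolding 1(6)[rule_format] 2(6)[rule_format] R''_def by algebra
  ultimately show ?case
    by (intro exI[of _ "c * c'"] exI[of _ "\<lambda>v. c * l' v + c' * l v"]
        exI[of _ "\<lambda>x y. c * Q' x y + c' * Q x y + l x * l' y"]
        exI[of _ "\<lambda>x y z. c * B' x y z + c' * B x y z + l x * Q' y z + Q x y * l' z"]
        exI[of _ R''] conjI allI) simp_all
qed

text \<open>Cancels a factor \<open>t\<close> including the value at \<open>t = 0\<close>, which is
  recovered as a limit. Repeated use separates the homogeneous parts of a polynomial identity in
  \<open>t\<close>.\<close>

lemma continuous_mult_id_zero:
  fixes h :: "complex \<Rightarrow> complex"
  assumes "continuous_on UNIV h" "\<And>t. t * h t = 0"
  shows "h t = 0"
proof -
  have "h s = 0" if "s \<noteq> 0" for s using assms(2)[of s] that by simp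
  then have "(h \<longlongrightarrow> 0) (at 0)"
    by (intro tendsto_eventually) (auto simp: eventually_at_filter)
  moreover have "(h \<longlongrightarrow> h 0) (at 0)"
    using assms(1) by (simp add: continuous_on_def)
  ultimately have "h 0 = 0" using tendsto_unique[of "at (0::complex)" h] by simp
  then show ?thesis using \<open>\<And>s. s \<noteq> 0 \<Longrightarrow> h s = 0\<close> by (cases "t = 0") auto
qed

lemma plane_form_1_clin:
  assumes "l \<in> plane_forms 1" shows "clin l"
proof -
  have l: "l \<in> polyfuns {\<lambda>v. v $ i | i. True}" "l (t *s v) = t * l v" for t v
    using assms by (auto simp: plane_forms_def)
  obtain c l' Q B R where 1: "clin l'" "\<forall>y. clin (\<lambda>x. Q x y)" "\<forall>x. clin (Q x)" "trilin B"
    "\<forall>v. continuous_on UNIV (R v)"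
    "\<forall>t v. l (t *s v) = c + t * l' v + t^2 * Q v v + t^3 * B v v v + t^4 * R v t"
    using polyfuns_truncation[OF l(1)] by (elim exE conjE)
  have c: "c = 0" using 1(6)[rule_format, of 0 0] l(2)[of 0 0] by simp
  have "l' v - l v + t * Q v v + t^2 * B v v v + t^3 * R v t = 0" for v t
    by (rule continuous_mult_id_zero[of "\<lambda>t. l' v - l v + t * Q v v + t^2 * B v v v + t^3 * R v t"])
      (use 1(5) 1(6)[rule_format, of _ v] c l(2) in
        \<open>auto intro!: continuous_intros simp: algebra_simps power2_eq_square power3_eq_cube power4_eq_xxxx\<close>)
  from this[of _ 0] have "l = l'" by (auto simp: fun_eq_iff)
  then show ?thesis using 1(1) by simp
qed

text \<open>The expansion of \<open>f (t *s v)\<close> is compared with \<open>t^3 * f v\<close>.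
  Peeling off one power of \<open>t\<close> at a time kills the constant, linear and quadratic parts
  and then identifies the cubic part with \<open>f\<close>.\<close>

lemma plane_form_3_trilin:
  assumes "f \<in> plane_forms 3" obtains B where "trilin B" "\<And>v. f v = B v v v"
proof -
  have f: "f \<in> polyfuns {\<lambda>v. v $ i | i. True}" "f (t *s v) = t^3 * f v" for t v
    using assms by (auto simp: plane_forms_def)
  obtain c l Q B R where 1: "clin l" "\<forall>y. clin (\<lambda>x. Q x y)" "\<forall>x. clin (Q x)" "trilin B"
    "\<forall>v. continuous_on UNIV (R v)"
    "\<forall>t v. f (t *s v) = c + t * l v + t^2 * Q v v + t^3 * B v v v + t^4 * R v t"
    using polyfuns_truncation[OF f(1)] by (elim exE conjE)
  have R: "continuous_on UNIV (R v)" for v using 1(5) by simp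
  have c: "c = 0" using 1(6)[rule_format, of 0 0] f(2)[of 0 0] by simp
  have eq0: "t * (l v + t * Q v v + t^2 * (B v v v - f v) + t^3 * R v t) = 0" for v t
    using 1(6)[rule_format, of t v] c f(2)[of t v] by algebra
  have eq1: "l v + t * Q v v + t^2 * (B v v v - f v) + t^3 * R v t = 0" for v t
    by (rule continuous_mult_id_zero[of "\<lambda>t. l v + t * Q v v + t^2 * (B v v v - f v) + t^3 * R v t"])
      (intro continuous_intros R, rule eq0)
  have l0: "l v = 0" for v using eq1[of v 0] by simp
  have eq2: "t * (Q v v + t * (B v v v - f v) + t^2 * R v t) = 0" for v t
    using eq1[of v t] l0[of v] by algebra
  have eq3: "Q v v + t * (B v v v - f v) + t^2 * R v t = 0" for v t
    by (rule continuous_mult_id_zero[of "\<lambda>t. Q v v + t * (B v v v - f v) + t^2 * R v t"])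
      (intro continuous_intros R, rule eq2)
  have Q0: "Q v v = 0" for v using eq3[of v 0] by simp
  have eq4: "t * (B v v v - f v + t * R v t) = 0" for v t
    using eq3[of v t] Q0[of v] by algebra
  have eq5: "B v v v - f v + t * R v t = 0" for v t
    by (rule continuous_mult_id_zero[of "\<lambda>t. B v v v - f v + t * R v t"])
      (intro continuous_intros R, rule eq4)
  have "f v = B v v v" for v using eq5[of v 0] by simp
  with 1(4) show ?thesis by (rule that)
qed

definition polar_coeff :: "(complex^3 \<Rightarrow> complex) \<Rightarrow> 3 \<Rightarrow> 3 \<Rightarrow> 3 \<Rightarrow> complex" where
  "polar_coeff f i j k =
    (f (axis i 1 + axis j 1 + axis k 1) - f (axis i 1 + axis j 1) - f (axis i 1 + axis k 1) - f (axis j 1 + axis k 1)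
      + f (axis i 1) + f (axis j 1) + f (axis k 1)) / 6"

text \<open>Written through the values of \<open>f\<close> at fixed vectors, so that it is visibly polynomial in \<open>f\<close>, too.\<close>

definition pol :: "(complex^3 \<Rightarrow> complex) \<Rightarrow> complex^3 \<Rightarrow> complex^3 \<Rightarrow> complex^3 \<Rightarrow> complex" where
  "pol f x y z = (\<Sum>i\<in>UNIV. \<Sum>j\<in>UNIV. \<Sum>k\<in>UNIV. x $ i * y $ j * z $ k * polar_coeff f i j k)"

lemma trilin_pol: "trilin (pol f)"
  unfolding trilin_def clin_def pol_def
  by (simp add: algebra_simps sum.distrib sum_distrib_left)

lemma trilinD:
  assumes "trilin B"
  shows "B (x + x') y z = B x y z + B x' y z" "B (c *s x) y z = c * B x y z"
    "B x (y + y') z = B x y z + B x y' z" "B x (c *s y) z = c * B x y z"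
    "B x y (z + z') = B x y z + B x y z'" "B x y (c *s z) = c * B x y z"
  using assms by (auto simp: trilin_def clin_def)

lemmas pol_simps = trilinD[OF trilin_pol]

lemma polar_coeff_commute:
  "polar_coeff f i j k = polar_coeff f j i k" "polar_coeff f i j k = polar_coeff f i k j"
  by (simp_all add: polar_coeff_def add_ac)

lemma pol_commute: "pol f x y z = pol f y x z" "pol f x y z = pol f x z y"
proof -
  have "pol f x y z = (\<Sum>j\<in>UNIV. \<Sum>i\<in>UNIV. \<Sum>k\<in>UNIV. x $ i * y $ j * z $ k * polar_coeff f i j k)"
    unfolding pol_def by (rule sum.swap)
  also have "\<dots> = pol f y x z"
    unfolding pol_def
    by (intro sum.cong refl) (subst polar_coeff_commute(1), simp only: mult_ac)
  finally show "pol f x y z = pol f y x z" .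
  have "pol f x y z = (\<Sum>i\<in>UNIV. \<Sum>k\<in>UNIV. \<Sum>j\<in>UNIV. x $ i * y $ j * z $ k * polar_coeff f i j k)"
    unfolding pol_def by (intro sum.cong sum.swap refl)
  also have "\<dots> = pol f x z y"
    unfolding pol_def
    by (intro sum.cong refl) (subst polar_coeff_commute(2), simp only: mult_ac)
  finally show "pol f x y z = pol f x z y" .
qed

lemma trilin_basis:
  assumes "trilin B"
  shows "B x y z = (\<Sum>i\<in>UNIV. \<Sum>j\<in>UNIV. \<Sum>k\<in>UNIV. x $ i * y $ j * z $ k * B (axis i 1) (axis j 1) (axis k 1))"
proof -
  have B: "clin (\<lambda>x. B x y z)" "clin (\<lambda>y. B x y z)" "clin (B x y)" for x y z
    using assms by (auto simp: trilin_def)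
  have "B x y z = (\<Sum>i\<in>UNIV. x $ i * B (axis i 1) y z)"
    by (rule clin_basis[OF B(1)])
  also have "\<dots> = (\<Sum>i\<in>UNIV. x $ i * (\<Sum>j\<in>UNIV. y $ j * B (axis i 1) (axis j 1) z))"
    by (intro sum.cong refl arg_cong2[where f = "(*)"] clin_basis[OF B(2)])
  also have "\<dots> = (\<Sum>i\<in>UNIV. x $ i * (\<Sum>j\<in>UNIV. y $ j * (\<Sum>k\<in>UNIV. z $ k * B (axis i 1) (axis j 1) (axis k 1))))"
    by (intro sum.cong refl arg_cong2[where f = "(*)"] clin_basis[OF B(3)])
  finally show ?thesis by (simp add: sum_distrib_left mult_ac)
qed

text \<open>The trilinear \<open>B\<close> behind \<open>f\<close> need not be symmetric, but its
  symmetrization \<open>S\<close> satisfies the polarization identity. \<open>S\<close> and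
  \<open>pol f\<close> are both trilinear and agree on basis vectors by the choice of
  \<open>polar_coeff\<close>.\<close>

lemma pol_polarization:
  assumes "f \<in> plane_forms 3"
  shows "pol f x y z = (f (x + y + z) - f (x + y) - f (x + z) - f (y + z) + f x + f y + f z) / 6"
proof -
  obtain B where B: "trilin B" "\<And>v. f v = B v v v" using plane_form_3_trilin[OF assms] by blast
  define S where "S x y z = (B x y z + B x z y + B y x z + B y z x + B z x y + B z y x) / 6" for x y z
  have S: "trilin S"
    using B(1) unfolding S_def trilin_def clin_def by (simp add: field_simps)
  have pz: "(f (x + y + z) - f (x + y) - f (x + z) - f (y + z) + f x + f y + f z) / 6 = S x y z" for x y z
    unfolding B(2) S_def by (simp add: trilinD[OF B(1)])
  show ?thesis
    unfolding pz trilin_basis[OF S, of x y z] pol_def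
    by (simp add: polar_coeff_def pz)
qed

lemma plane_form_scale: "f \<in> plane_forms d \<Longrightarrow> f (c *s v) = c ^ d * f v"
  by (simp add: plane_forms_def)

lemma pol_diag:
  assumes "f \<in> plane_forms 3" shows "f v = pol f v v v"
proof -
  have "v + v = 2 *s v" "v + v + v = 3 *s v" by (simp_all add: vec_eq_iff)
  then show ?thesis
    unfolding pol_polarization[OF assms] by (simp add: plane_form_scale[OF assms])
qed

lemma pol_cmult: "pol (\<lambda>v. c * f v) x y z = c * pol f x y z"
proof -
  have "polar_coeff (\<lambda>v. c * f v) i j k = c * polar_coeff f i j k" for i j k
    by (simp add: polar_coeff_def algebra_simps)
  then show ?thesis by (simp add: pol_def sum_distrib_left mult_ac)
qed

lemma plane_forms_cmult: "f \<in> plane_forms d \<Longrightarrow> (\<lambda>v. c * f v) \<in> plane_forms d"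
  by (auto simp: plane_forms_def intro: polyfuns_intros)

lemma plane_forms_comp: "f \<in> plane_forms d \<Longrightarrow> (\<lambda>v. f (G *v v)) \<in> plane_forms d"
proof -
  assume f: "f \<in> plane_forms d"
  then have "f \<in> polyfuns {\<lambda>v. v $ i | i. True}" by (simp add: plane_forms_def)
  then have "(\<lambda>v. f (G *v v)) \<in> polyfuns {\<lambda>v. v $ i | i. True}"
  proof (rule polyfuns_compose)
    fix k :: "complex^3 \<Rightarrow> complex" assume "k \<in> {\<lambda>v. v $ i | i. True}"
    then obtain i where "k = (\<lambda>v. v $ i)" by blast
    moreover have "(\<lambda>v. (\<Sum>j\<in>UNIV. G $ i $ j * v $ j)) \<in> polyfuns {\<lambda>v. v $ i | i. True}"
      by (intro polyfuns_intros polyfuns.coord) blast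
    ultimately show "(\<lambda>v. k (G *v v)) \<in> polyfuns {\<lambda>v. v $ i | i. True}"
      by (simp add: matrix_vector_mult_def)
  qed
  with f show ?thesis by (simp add: plane_forms_def vector_scalar_commute)
qed

lemma pol_comp:
  "f \<in> plane_forms 3 \<Longrightarrow> pol (\<lambda>v. f (G *v v)) x y z = pol f (G *v x) (G *v y) (G *v z)"
  by (simp add: pol_polarization plane_forms_comp matrix_vector_right_distrib)

lemma clin_plane_form: "clin l \<Longrightarrow> l \<in> plane_forms 1"
proof -
  assume l: "clin l"
  have "(\<lambda>v. \<Sum>i\<in>UNIV. v $ i * l (axis i 1)) \<in> polyfuns {\<lambda>v. v $ i | i. True}"
    by (intro polyfuns_intros polyfuns.coord) blast
  then have "l \<in> polyfuns {\<lambda>v. v $ i | i. True}"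
    by (subst ext[of l, OF clin_basis[OF l]])
  then show ?thesis using l by (simp add: plane_forms_def clin_scale)
qed

lemma plane_form_1_iff: "l \<in> plane_forms 1 \<longleftrightarrow> clin l"
  using plane_form_1_clin clin_plane_form by blast

lemma clin_pol: "clin (pol f x y)" "clin (\<lambda>y. pol f x y z)" "clin (\<lambda>x. pol f x y z)"
  using trilin_pol[of f] by (auto simp: trilin_def)

lemma pol_minus: "pol f (x - x') y z = pol f x y z - pol f x' y z"
    "pol f x (y - y') z = pol f x y z - pol f x y' z" "pol f x y (z - z') = pol f x y z - pol f x y z'"
  using clin_diff[OF clin_pol(1), of f] clin_diff[OF clin_pol(2)[of f]] clin_diff[OF clin_pol(3)[of f]] by auto

lemma cubic_expand:
  assumes "f \<in> plane_forms 3"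
  shows "f (x *s u + y *s v + z *s w) =
    x^3 * f u + y^3 * f v + z^3 * f w
    + 3 * x^2 * y * pol f u u v + 3 * x * y^2 * pol f u v v
    + 3 * x^2 * z * pol f u u w + 6 * x * y * z * pol f u v w + 3 * y^2 * z * pol f v v w
    + 3 * x * z^2 * pol f u w w + 3 * y * z^2 * pol f v w w"
proof -
  have c: "pol f b a a = pol f a a b" "pol f a b a = pol f a a b" for a b
    using pol_commute by metis+
  have d: "pol f u w v = pol f u v w" "pol f v u w = pol f u v w" "pol f v w u = pol f u v w"
    "pol f w u v = pol f u v w" "pol f w v u = pol f u v w"
    using pol_commute by metis+
  let ?X = "x *s u + y *s v + z *s w"
  have "f ?X = pol f ?X ?X ?X" "f u = pol f u u u" "f v = pol f v v v" "f w = pol f w w w"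
    by (rule pol_diag[OF assms])+
  note e = this
  have "pol f ?X ?X ?X = x * (x * (x * pol f u u u + y * pol f u u v + z * pol f u u w)
      + y * (x * pol f u v u + y * pol f u v v + z * pol f u v w) + z * (x * pol f u w u + y * pol f u w v + z * pol f u w w))
    + y * (x * (x * pol f v u u + y * pol f v u v + z * pol f v u w)
      + y * (x * pol f v v u + y * pol f v v v + z * pol f v v w) + z * (x * pol f v w u + y * pol f v w v + z * pol f v w w))
    + z * (x * (x * pol f w u u + y * pol f w u v + z * pol f w u w)
      + y * (x * pol f w v u + y * pol f w v v + z * pol f w v w) + z * (x * pol f w w u + y * pol f w w v + z * pol f w w w))"
    by (simp only: pol_simps) algebra
  then show ?thesis
    unfolding e d c(1)[of v u] c(1)[of w u] c(1)[of w v] c(1)[of u v] c(1)[of u w] c(1)[of v w]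
      c(2)[of v u] c(2)[of w u] c(2)[of w v] c(2)[of u v] c(2)[of u w] c(2)[of v w]
    by algebra
qed

text \<open>The cross product of the coefficient vectors of two linear forms. It spans the common
  kernel of independent forms and is zero for proportional ones, so it is the intersection point of
  two lines in a form that is polynomial in both.\<close>

definition cr :: "(complex^3 \<Rightarrow> complex) \<Rightarrow> (complex^3 \<Rightarrow> complex) \<Rightarrow> complex^3" where
  "cr p q = vector [p (axis 2 1) * q (axis 3 1) - p (axis 3 1) * q (axis 2 1),
     p (axis 3 1) * q (axis 1 1) - p (axis 1 1) * q (axis 3 1),
     p (axis 1 1) * q (axis 2 1) - p (axis 2 1) * q (axis 1 1)]"

definition det3 :: "complex^3 \<Rightarrow> complex^3 \<Rightarrow> complex^3 \<Rightarrow> complex" where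
  "det3 u v w = det (vector [u, v, w] :: complex^3^3)"

definition cols :: "complex^3 \<Rightarrow> complex^3 \<Rightarrow> complex^3 \<Rightarrow> complex^3^3" where
  "cols u v w = transpose (vector [u, v, w])"

lemma det_cols: "det (cols u v w) = det3 u v w"
  by (simp add: cols_def det3_def)

lemma cols_mult: "cols u v w *v y = y $ 1 *s u + y $ 2 *s v + y $ 3 *s w"
  by (simp add: cols_def vec_eq_iff forall_3 matrix_vector_mult_def sum_3 transpose_def vector_3 mult_ac)

lemma det3_expand: "det3 u v w =
    u $ 1 * (v $ 2 * w $ 3 - v $ 3 * w $ 2) - u $ 2 * (v $ 1 * w $ 3 - v $ 3 * w $ 1)
    + u $ 3 * (v $ 1 * w $ 2 - v $ 2 * w $ 1)"
  by (simp add: det3_def det_3 vector_3 algebra_simps)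

lemma clin_det3: "clin (det3 u v)"
  by (simp add: clin_def det3_expand algebra_simps)

lemma det3_cr:
  assumes "clin p" "clin q" shows "det3 u v (cr p q) = p u * q v - p v * q u"
  by (simp add: clin_basis[OF assms(1), of u] clin_basis[OF assms(1), of v]
      clin_basis[OF assms(2), of u] clin_basis[OF assms(2), of v] det3_expand sum_3 cr_def vector_3 algebra_simps)

lemma cr_self:
  assumes "clin p" "clin q" shows "p (cr p q) = 0" "q (cr p q) = 0"
  by (subst clin_basis[OF assms(1), of "cr p q"], simp add: sum_3 cr_def vector_3 algebra_simps)
    (subst clin_basis[OF assms(2), of "cr p q"], simp add: sum_3 cr_def vector_3 algebra_simps)

lemma matrix_vector_axis: "(G *v axis j (1::complex)) $ i = G $ i $ j"
  by (simp add: matrix_vector_mult_def axis_def if_distrib cong: if_cong)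

text \<open>The cofactor identity for matrices of size three. For \<open>det G = 1\<close> it makes
  every construction by \<open>cr\<close> equivariant.\<close>

lemma cr_comp:
  assumes "clin p" "clin q"
  shows "G *v cr (\<lambda>x. p (G *v x)) (\<lambda>x. q (G *v x)) = det G *s cr p q"
proof -
  have p: "p (G *v axis j 1) = G $ 1 $ j * p (axis 1 1) + G $ 2 $ j * p (axis 2 1) + G $ 3 $ j * p (axis 3 1)" for j
    by (subst clin_basis[OF assms(1)]) (simp add: matrix_vector_axis sum_3)
  have q: "q (G *v axis j 1) = G $ 1 $ j * q (axis 1 1) + G $ 2 $ j * q (axis 2 1) + G $ 3 $ j * q (axis 3 1)" for j
    by (subst clin_basis[OF assms(2)]) (simp add: matrix_vector_axis sum_3)
  show ?thesis
    unfolding vec_eq_iff forall_3 cr_def p q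
    by (simp add: matrix_vector_mult_def sum_3 vector_3 det_3) (intro conjI; algebra)
qed

lemma cr_scale: "cr (\<lambda>x. c * p x) (\<lambda>x. d * q x) = (c * d) *s cr p q"
  by (simp add: vec_eq_iff forall_3 cr_def vector_3 algebra_simps)

lemma matrix_inv_mult:
  assumes "det (G :: complex^3^3) \<noteq> 0"
  shows "G *v (matrix_inv G *v x) = x" "matrix_inv G *v (G *v x) = x"
proof -
  have "invertible G" using assms by (simp add: invertible_det_nz)
  then have "G ** matrix_inv G = mat 1 \<and> matrix_inv G ** G = mat 1"
    unfolding matrix_inv_def invertible_def by (rule someI_ex)
  then show "G *v (matrix_inv G *v x) = x" "matrix_inv G *v (G *v x) = x"
    by (simp_all add: matrix_vector_mul_assoc)
qed

lemma frame_expand: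
  fixes x :: "complex^3"
  assumes "det3 u v w \<noteq> 0" obtains y :: "complex^3" where "x = y $ 1 *s u + y $ 2 *s v + y $ 3 *s w"
  using matrix_inv_mult(1)[of "cols u v w" x] assms that by (metis cols_mult det_cols)

lemma clin_eqI:
  assumes "clin p" "clin q" "det3 u v w \<noteq> 0" "p u = q u" "p v = q v" "p w = q w"
  shows "p = q"
proof
  fix x
  obtain y :: "complex^3" where "x = y $ 1 *s u + y $ 2 *s v + y $ 3 *s w"
    by (rule frame_expand[OF assms(3)])
  then show "p x = q x" using assms by (simp add: clin_add clin_scale)
qed

section \<open>A slice for cubics with two points\<close>

lemma exists_nth_root:
  assumes "w \<noteq> (0::complex)" "n > 0" obtains z where "z ^ n = w" "z \<noteq> 0"
proof
  have "exp (Ln w / of_nat n) ^ n = exp (of_nat n * (Ln w / of_nat n))"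
    by (simp only: exp_of_nat_mult)
  then show "exp (Ln w / of_nat n) ^ n = w" using assms by simp
qed simp

lemma axis3: "axis 1 1 = (vector [1, 0, 0] :: complex^3)" "axis 2 1 = (vector [0, 1, 0] :: complex^3)"
  "axis 3 1 = (vector [0, 0, 1] :: complex^3)"
  by (simp_all add: vec_eq_iff forall_3 vector_3 axis_def)

lemma proj_pt_eq_iff: "proj_pt u = proj_pt v \<longleftrightarrow> (\<exists>c. c \<noteq> 0 \<and> u = c *s v)"
proof
  assume "proj_pt u = proj_pt v"
  moreover have "u \<in> proj_pt u" by (auto simp: proj_pt_def intro: exI[of _ 1])
  ultimately show "\<exists>c. c \<noteq> 0 \<and> u = c *s v" by (auto simp: proj_pt_def)
next
  assume "\<exists>c. c \<noteq> 0 \<and> u = c *s v"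
  then obtain c where c: "c \<noteq> 0" "u = c *s v" by blast
  then have "d *s v = (d / c) *s u" "d *s u = (d * c) *s v" for d by (simp_all add: vector_smult_assoc)
  then show "proj_pt u = proj_pt v"
    unfolding proj_pt_def set_eq_iff mem_Collect_eq using c(1) by (metis divide_eq_0_iff mult_eq_0_iff)
qed

lemma proj_form_eq_iff: "proj_form f = proj_form h \<longleftrightarrow> (\<exists>c. c \<noteq> 0 \<and> f = (\<lambda>v. c * h v))"
proof
  assume "proj_form f = proj_form h"
  moreover have "f \<in> proj_form f" by (auto simp: proj_form_def intro: exI[of _ 1])
  ultimately show "\<exists>c. c \<noteq> 0 \<and> f = (\<lambda>v. c * h v)" by (auto simp: proj_form_def)
next
  assume "\<exists>c. c \<noteq> 0 \<and> f = (\<lambda>v. c * h v)"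
  then obtain c where c: "c \<noteq> 0" "f = (\<lambda>v. c * h v)" by blast
  have "x \<in> proj_form f \<longleftrightarrow> x \<in> proj_form h" for x
  proof
    assume "x \<in> proj_form f"
    then obtain d where "d \<noteq> 0" "x = (\<lambda>v. d * f v)" by (auto simp: proj_form_def)
    then show "x \<in> proj_form h"
      unfolding proj_form_def using c by (intro CollectI exI[of _ "d * c"]) auto
  next
    assume "x \<in> proj_form h"
    then obtain d where "d \<noteq> 0" "x = (\<lambda>v. d * h v)" by (auto simp: proj_form_def)
    then show "x \<in> proj_form f"
      unfolding proj_form_def using c by (intro CollectI exI[of _ "d / c"]) auto
  qed
  then show "proj_form f = proj_form h" by blast
qed

section \<open>The group action on forms, points and orbits\<close>

lemma act_form_inverse:
  assumes "det g \<noteq> 0" shows "act_form g f (g *v v) = f v"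
  by (simp add: act_form_def matrix_inv_mult[OF assms])

lemma act_form_eqI:
  assumes "det g \<noteq> 0" "\<And>v. f' (g *v v) = f v" shows "act_form g f = f'"
proof
  fix v show "act_form g f v = f' v"
    using assms(2)[of "matrix_inv g *v v"] by (simp add: act_form_def matrix_inv_mult[OF assms(1)])
qed

lemma act_form_mult: "det g \<noteq> 0 \<Longrightarrow> det h \<noteq> 0 \<Longrightarrow> act_form g (act_form h f) = act_form (g ** h) f"
  by (rule act_form_eqI[symmetric])
    (simp_all add: det_mul act_form_inverse flip: matrix_vector_mul_assoc)

lemma act_form_1: "act_form (mat 1) f = f"
  by (rule act_form_eqI) simp_all

lemma SL3_mult: "g \<in> SL3 \<Longrightarrow> h \<in> SL3 \<Longrightarrow> g ** h \<in> SL3"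
  by (simp add: SL3_def det_mul)

lemma SL3_nz: "g \<in> SL3 \<Longrightarrow> det g \<noteq> 0"
  by (simp add: SL3_def)

lemma SL3_inverse:
  assumes "g \<in> SL3" obtains h where "h \<in> SL3" "h ** g = mat 1"
proof -
  have "invertible g" using assms by (simp add: invertible_det_nz SL3_def)
  then obtain h where h: "h ** g = mat 1" by (auto simp: invertible_def)
  then have "det h * det g = 1" by (metis det_I det_mul)
  then show ?thesis using that h assms by (simp add: SL3_def)
qed

text \<open>Associativity is assumed on \<open>SL3\<close> only, because \<open>act_form\<close> is
  defined through \<open>matrix_inv\<close>, which is an inverse only for invertible
  matrices.\<close>

lemma orbit_eqI:
  assumes "\<And>g h x. g \<in> SL3 \<Longrightarrow> h \<in> SL3 \<Longrightarrow> act g (act h x) = act (g ** h) x" "\<And>x. act (mat 1) x = x"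
    and g: "g \<in> SL3"
  shows "{act h (act g x) | h. h \<in> SL3} = {act h x | h. h \<in> SL3}"
proof -
  obtain g' where g': "g' \<in> SL3" "g' ** g = mat 1" using SL3_inverse[OF g] .
  have 1: "act h x = act (h ** g') (act g x)" if "h \<in> SL3" for h
  proof -
    have "act (h ** g') (act g x) = act h (act g' (act g x))" using assms(1) that g' by simp
    also have "act g' (act g x) = x" using assms(1,2) g g' by simp
    finally show ?thesis by simp
  qed
  show ?thesis
  proof (intro set_eqI iffI)
    fix y assume "y \<in> {act h (act g x) | h. h \<in> SL3}"
    then obtain h where "h \<in> SL3" "y = act h (act g x)" by blast
    then show "y \<in> {act h x | h. h \<in> SL3}" using assms(1) g SL3_mult[OF _ g] by auto
  next
    fix y assume "y \<in> {act h x | h. h \<in> SL3}"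
    then obtain h where "h \<in> SL3" "y = act h x" by blast
    then show "y \<in> {act h (act g x) | h. h \<in> SL3}" using 1 SL3_mult[OF _ g'(1)] by auto
  qed
qed

lemma image_proj_pt: "(*v) g ` proj_pt v = proj_pt (g *v v)"
  by (auto simp: proj_pt_def image_iff vector_scalar_commute) (metis vector_scalar_commute)

lemma image_proj_form: "act_form g ` proj_form f = proj_form (act_form g f)"
  by (auto simp: proj_form_def act_form_def image_iff)

lemma C23_act_mult: "g \<in> SL3 \<Longrightarrow> h \<in> SL3 \<Longrightarrow> C23_act g (C23_act h x) = C23_act (g ** h) x"
  by (cases x) (simp add: C23_act_def image_image act_form_mult SL3_nz matrix_vector_mul_assoc)

lemma C23_act_1: "C23_act (mat 1) x = x"
  by (cases x) (simp add: C23_act_def act_form_1)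

lemma C23_orbit_act: "g \<in> SL3 \<Longrightarrow> C23_orbit (C23_act g x) = C23_orbit x"
  unfolding C23_orbit_def by (rule orbit_eqI) (auto simp: C23_act_mult C23_act_1)

lemma C23_orbit_refl: "x \<in> C23_orbit x"
  unfolding C23_orbit_def by (rule CollectI, rule exI[of _ "mat 1"]) (simp add: C23_act_1 SL3_def)

lemma C23_act_proj: "C23_act g (C23_proj (f, v1, v2)) = C23_proj (act_form g f, g *v v1, g *v v2)"
  by (simp add: C23_act_def C23_proj_def image_proj_pt image_proj_form)

lemma lab_act_mult: "g \<in> SL3 \<Longrightarrow> h \<in> SL3 \<Longrightarrow> lab_act g (lab_act h x) = lab_act (g ** h) x"
  by (cases x) (simp add: lab_act_def image_image act_form_mult SL3_nz matrix_vector_mul_assoc)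

lemma lab_act_1: "lab_act (mat 1) x = x"
  by (cases x) (simp add: lab_act_def act_form_1)

lemma lab_orbit_act: "g \<in> SL3 \<Longrightarrow> lab_orbit (lab_act g x) = lab_orbit x"
  unfolding lab_orbit_def by (rule orbit_eqI) (auto simp: lab_act_mult lab_act_1)

lemma lab_orbit_refl: "x \<in> lab_orbit x"
  unfolding lab_orbit_def by (rule CollectI, rule exI[of _ "mat 1"]) (simp add: lab_act_1 SL3_def)

lemma lab_act_proj: "lab_act g (lab_proj (f, l, v1, v2, v3)) =
    lab_proj (act_form g f, act_form g l, g *v v1, g *v v2, g *v v3)"
  by (simp add: lab_act_def lab_proj_def image_proj_pt image_proj_form)

text \<open>For \<open>v1\<close> on the cubic, \<open>pol f v1 v1\<close> cuts out the tangent line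
  there. For distinct points this number therefore vanishes when the line through them is tangent at
  \<open>v1\<close> or \<open>v1\<close> is singular; \<open>invB\<close> has the same meaning at
  \<open>v2\<close>.\<close>

definition invA :: "(complex^3 \<Rightarrow> complex) \<Rightarrow> complex^3 \<Rightarrow> complex^3 \<Rightarrow> complex" where
  "invA f v1 v2 = pol f v1 v1 v2"

definition invB :: "(complex^3 \<Rightarrow> complex) \<Rightarrow> complex^3 \<Rightarrow> complex^3 \<Rightarrow> complex" where
  "invB f v1 v2 = pol f v1 v2 v2"

definition centre :: "(complex^3 \<Rightarrow> complex) \<Rightarrow> complex^3 \<Rightarrow> complex^3 \<Rightarrow> complex^3" where
  "centre f v1 v2 = cr (pol f v1 v1) (pol f v2 v2)"

text \<open>The coefficients of \<open>f\<close> in the frame of \<open>slice_frame\<close>,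
  multiplied by \<open>9 * invA * invB\<close>. This removes all denominators, so the entries are
  polynomial in \<open>f\<close>, \<open>v1\<close>, \<open>v2\<close>.\<close>

definition moduli :: "(complex^3 \<Rightarrow> complex) \<Rightarrow> complex^3 \<Rightarrow> complex^3 \<Rightarrow> complex^4" where
  "moduli f v1 v2 = (let w = centre f v1 v2 in
     vector [6 * pol f v1 v2 w, 9 * invB f v1 v2 * pol f v1 w w, 9 * invA f v1 v2 * pol f v2 w w,
       9 * invA f v1 v2 * invB f v1 v2 * pol f w w w])"

definition good :: "(complex^3 \<Rightarrow> complex) \<Rightarrow> complex^3 \<Rightarrow> complex^3 \<Rightarrow> bool" where
  "good f v1 v2 \<longleftrightarrow> invA f v1 v2 \<noteq> 0 \<and> invB f v1 v2 \<noteq> 0 \<and> moduli f v1 v2 \<noteq> 0"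

definition slice :: "complex^4 \<Rightarrow> complex^3 \<Rightarrow> complex" where
  "slice x = (\<lambda>v. v $ 1 * v $ 2 * (v $ 1 + v $ 2) + x $ 1 * v $ 1 * v $ 2 * v $ 3
     + (x $ 2 * v $ 1 + x $ 3 * v $ 2) * v $ 3 ^ 2 + x $ 4 * v $ 3 ^ 3)"

definition wt :: "nat^4" where "wt = vector [1, 2, 2, 3]"

definition wact :: "complex \<Rightarrow> complex^4 \<Rightarrow> complex^4" where
  "wact t x = vector [t * x $ 1, t^2 * x $ 2, t^2 * x $ 3, t^3 * x $ 4]"

lemma vec4_eq_iff: "(x = y) \<longleftrightarrow> x $ 1 = y $ 1 \<and> x $ 2 = y $ 2 \<and> x $ 3 = y $ 3 \<and> x $ 4 = (y :: 'a^4) $ 4"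
  by (simp add: vec_eq_iff forall_4)

lemma weighted_class_wt: "weighted_class wt x = {wact t x | t. t \<noteq> 0}"
proof -
  have "(\<chi> i. t ^ (wt $ i) * x $ i) = wact t x" for t
    by (simp add: vec4_eq_iff wact_def wt_def vector_4)
  then show ?thesis by (simp add: weighted_class_def)
qed

lemma wact_wact: "wact s (wact t x) = wact (s * t) x"
  by (simp add: vec4_eq_iff wact_def vector_4 power_mult_distrib)

lemma wact_1: "wact 1 x = x"
  by (simp add: vec4_eq_iff wact_def vector_4)

lemma wact_eq_0_iff: "t \<noteq> 0 \<Longrightarrow> wact t x = 0 \<longleftrightarrow> x = 0"
  by (simp add: vec4_eq_iff wact_def vector_4)

lemma weighted_class_eq_iff: "weighted_class wt x = weighted_class wt y \<longleftrightarrow> (\<exists>t. t \<noteq> 0 \<and> x = wact t y)"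
proof
  assume "weighted_class wt x = weighted_class wt y"
  moreover have "x \<in> weighted_class wt x"
    unfolding weighted_class_wt by (rule CollectI, rule exI[of _ 1]) (simp add: wact_1)
  ultimately show "\<exists>t. t \<noteq> 0 \<and> x = wact t y" by (auto simp: weighted_class_wt)
next
  assume "\<exists>t. t \<noteq> 0 \<and> x = wact t y"
  then obtain t where t: "t \<noteq> 0" "x = wact t y" by blast
  then have "wact s y = wact (s / t) x" "wact s x = wact (s * t) y" for s by (simp_all add: wact_wact)
  then show "weighted_class wt x = weighted_class wt y"
    unfolding weighted_class_wt set_eq_iff mem_Collect_eq using t(1) by (metis divide_eq_0_iff mult_eq_0_iff)
qed

lemma slice_plane_form: "slice x \<in> plane_forms 3"
proof -
  have c: "(\<lambda>v. v $ i) \<in> polyfuns {\<lambda>v::complex^3. v $ i | i. True}" for i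
    by (rule polyfuns.coord) blast
  have "slice x \<in> polyfuns {\<lambda>v::complex^3. v $ i | i. True}"
    unfolding slice_def by (intro polyfuns_intros c)
  then show ?thesis
    unfolding plane_forms_def slice_def by (simp add: algebra_simps power2_eq_square power3_eq_cube)
qed

lemma pol_slice:
  "pol (slice x) u v w =
    (u $ 1 * v $ 1 * w $ 2 + u $ 1 * v $ 2 * w $ 1 + u $ 2 * v $ 1 * w $ 1
      + u $ 1 * v $ 2 * w $ 2 + u $ 2 * v $ 1 * w $ 2 + u $ 2 * v $ 2 * w $ 1) / 3
    + x $ 1 * (u $ 1 * v $ 2 * w $ 3 + u $ 1 * v $ 3 * w $ 2 + u $ 2 * v $ 1 * w $ 3
      + u $ 2 * v $ 3 * w $ 1 + u $ 3 * v $ 1 * w $ 2 + u $ 3 * v $ 2 * w $ 1) / 6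
    + x $ 2 * (u $ 1 * v $ 3 * w $ 3 + u $ 3 * v $ 1 * w $ 3 + u $ 3 * v $ 3 * w $ 1) / 3
    + x $ 3 * (u $ 2 * v $ 3 * w $ 3 + u $ 3 * v $ 2 * w $ 3 + u $ 3 * v $ 3 * w $ 2) / 3
    + x $ 4 * u $ 3 * v $ 3 * w $ 3"
  unfolding pol_polarization[OF slice_plane_form] unfolding slice_def
  by (simp add: divide_simps) algebra

lemma centre_slice: "centre (slice x) (axis 1 1) (axis 2 1) = vector [0, 0, - 1 / 9]"
  unfolding centre_def cr_def axis3 by (simp add: pol_slice vector_3)

lemma inv_slice: "invA (slice x) (axis 1 1) (axis 2 1) = 1 / 3" "invB (slice x) (axis 1 1) (axis 2 1) = 1 / 3"
  by (simp_all add: invA_def invB_def pol_slice axis3 vector_3)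

text \<open>The frame attached to a slice point is the standard one except that its third vector is
  scaled by \<open>- 1 / 9\<close>. Hence \<open>slice\<close> is a section of \<open>moduli\<close>
  only up to the weighted action.\<close>

lemma moduli_slice: "moduli (slice x) (axis 1 1) (axis 2 1) = wact (- 1 / 9) x"
  unfolding moduli_def centre_slice inv_slice Let_def
  by (simp add: vec4_eq_iff wact_def vector_4 vector_3 pol_slice axis3 power2_eq_square power3_eq_cube)

lemma good_slice: "x \<noteq> 0 \<Longrightarrow> good (slice x) (axis 1 1) (axis 2 1)"
  by (simp add: good_def inv_slice moduli_slice wact_eq_0_iff)

text \<open>With \<open>F = pol f\<close>, \<open>det3_cr\<close> gives
  \<open>F(v1,v1,v1) F(v2,v2,v2) - F(v1,v1,v2) F(v2,v2,v1)\<close>, and the first product vanishes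
  for \<open>v1\<close> on the cubic. So nonvanishing of \<open>invA\<close> and \<open>invB\<close>
  is what makes the two points and \<open>centre\<close> a frame.\<close>

lemma det3_centre:
  assumes "f \<in> plane_forms 3" "f v1 = 0"
  shows "det3 v1 v2 (centre f v1 v2) = - (invA f v1 v2 * invB f v1 v2)"
  using pol_diag[OF assms(1), of v1] assms(2)
  unfolding centre_def det3_cr[OF clin_pol(1) clin_pol(1)] invA_def invB_def
  by (simp add: pol_commute)

lemma pol_centre: "pol f v1 v1 (centre f v1 v2) = 0" "pol f v2 v2 (centre f v1 v2) = 0"
  unfolding centre_def by (rule cr_self[OF clin_pol(1) clin_pol(1)])+

definition slice_frame :: "(complex^3 \<Rightarrow> complex) \<Rightarrow> complex^3 \<Rightarrow> complex^3 \<Rightarrow> complex^3^3" where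
  "slice_frame f v1 v2 =
     cols ((1 / (3 * invA f v1 v2)) *s v1) ((1 / (3 * invB f v1 v2)) *s v2) (centre f v1 v2)"

text \<open>In this frame \<open>x^3\<close> and \<open>y^3\<close> drop out because the points lie
  on the cubic, and \<open>x^2 z\<close> and \<open>y^2 z\<close> because \<open>centre\<close> lies
  on both tangent lines. The divisors \<open>3 a\<close> and \<open>3 b\<close> give
  \<open>x^2 y\<close> and \<open>x y^2\<close> the common coefficient
  \<open>1 / (9 a b)\<close>.\<close>

lemma slice_frame:
  assumes f: "f \<in> plane_forms 3" "f v1 = 0" "f v2 = 0" and nz: "invA f v1 v2 \<noteq> 0" "invB f v1 v2 \<noteq> 0"
  shows "f (slice_frame f v1 v2 *v y) = 1 / (9 * invA f v1 v2 * invB f v1 v2) * slice (moduli f v1 v2) y"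
    and "det (slice_frame f v1 v2) \<noteq> 0"
proof -
  define a b w where "a = invA f v1 v2" and "b = invB f v1 v2" and "w = centre f v1 v2"
  have "slice_frame f v1 v2 *v y = (y $ 1 / (3 * a)) *s v1 + (y $ 2 / (3 * b)) *s v2 + y $ 3 *s w"
    by (simp add: slice_frame_def cols_mult vector_smult_assoc a_def b_def w_def)
  then have e: "f (slice_frame f v1 v2 *v y) =
      3 * (y $ 1 / (3 * a))^2 * (y $ 2 / (3 * b)) * a + 3 * (y $ 1 / (3 * a)) * (y $ 2 / (3 * b))^2 * b
      + 6 * (y $ 1 / (3 * a)) * (y $ 2 / (3 * b)) * y $ 3 * pol f v1 v2 w
      + 3 * (y $ 1 / (3 * a)) * (y $ 3)^2 * pol f v1 w w + 3 * (y $ 2 / (3 * b)) * (y $ 3)^2 * pol f v2 w w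
      + (y $ 3)^3 * pol f w w w"
    using pol_centre(1)[of f v1 v2] pol_centre(2)[of f v2 v1] f(2,3) pol_diag[OF f(1), of w]
    by (simp add: cubic_expand[OF f(1)] a_def b_def w_def invA_def invB_def)
  have ab: "a \<noteq> 0" "b \<noteq> 0" using nz by (auto simp: a_def b_def)
  show "f (slice_frame f v1 v2 *v y) = 1 / (9 * invA f v1 v2 * invB f v1 v2) * slice (moduli f v1 v2) y"
    unfolding e slice_def moduli_def a_def[symmetric] b_def[symmetric] w_def[symmetric] Let_def vector_4
    using ab by (simp add: field_simps power2_eq_square power3_eq_cube)
  have "det (slice_frame f v1 v2) = (1 / (3 * a)) * (1 / (3 * b)) * det3 v1 v2 w"
    by (simp add: slice_frame_def det_cols det3_expand a_def b_def w_def algebra_simps)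
  then show "det (slice_frame f v1 v2) \<noteq> 0"
    using nz det3_centre[OF f(1,2)] by (simp add: a_def b_def w_def)
qed

text \<open>Rescaling by a cube root of \<open>1 / det G\<close> moves the frame into
  \<open>SL3\<close>. The price is the scalar \<kappa>, which is invisible projectively.\<close>

lemma normalise_frame:
  assumes "det G \<noteq> 0" obtains g \<kappa> where "g \<in> SL3" "\<kappa> \<noteq> 0" "\<And>y. g *v (G *v y) = \<kappa> *s y"
proof -
  obtain k where k: "k ^ 3 = 1 / det G" "k \<noteq> 0"
    using exists_nth_root[of "1 / det G" 3] assms by auto
  define H where "H = (\<chi> i j. k * G $ i $ j)"
  have Hy: "H *v y = k *s (G *v y)" for y
    by (simp add: H_def vec_eq_iff matrix_vector_mult_def sum_distrib_left mult_ac)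
  have "det H = k ^ 3 * det G"
    unfolding H_def det_3 by (simp add: algebra_simps power3_eq_cube)
  then have "det H = 1" using k assms by simp
  then obtain g where g: "g \<in> SL3" "g ** H = mat 1" using SL3_inverse[of H] by (auto simp: SL3_def)
  have "g *v (H *v y) = y" for y using g(2) by (simp add: matrix_vector_mul_assoc)
  then have "k *s (g *v (G *v y)) = y" for y by (simp add: Hy vector_scalar_commute)
  then have "(1 / k) *s (k *s (g *v (G *v y))) = (1 / k) *s y" for y by simp
  then have "g *v (G *v y) = (1 / k) *s y" for y using k(2) by (simp add: vector_smult_assoc)
  then show ?thesis using k(2) by (intro that[OF g(1), of "1 / k"]) auto
qed

lemma act_to_frame:
  assumes g: "g \<in> SL3" "\<kappa> \<noteq> 0" "\<And>y. g *v (G *v y) = \<kappa> *s y"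
    and p: "p \<in> plane_forms d" "q \<in> plane_forms d" "c \<noteq> 0" "\<And>y. p (G *v y) = c * q y"
  shows "proj_form (act_form g p) = proj_form q"
proof -
  have "act_form g p = (\<lambda>v. (c / \<kappa> ^ d) * q v)"
  proof
    fix v
    have "v = g *v (G *v ((1 / \<kappa>) *s v))" using g by (simp add: vector_smult_assoc)
    then have "act_form g p v = p (G *v ((1 / \<kappa>) *s v))"
      by (metis act_form_inverse SL3_nz g(1))
    then show "act_form g p v = (c / \<kappa> ^ d) * q v"
      using p(4) p(2) by (simp add: plane_form_scale power_divide)
  qed
  then show ?thesis
    unfolding proj_form_eq_iff using p(3) g(2) by (intro exI[of _ "c / \<kappa> ^ d"]) simp
qed

lemma act_point_to_frame:
  assumes g: "\<kappa> \<noteq> 0" "\<And>y. g *v (G *v y) = \<kappa> *s y" and "c \<noteq> 0" "G *v y = c *s v"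
  shows "proj_pt (g *v v) = proj_pt y"
proof -
  have "v = (1 / c) *s (G *v y)" using assms by (simp add: vector_smult_assoc)
  then have "g *v v = (\<kappa> / c) *s y" using g by (simp add: vector_scalar_commute vector_smult_assoc)
  then show ?thesis
    unfolding proj_pt_eq_iff using assms by (intro exI[of _ "\<kappa> / c"]) simp
qed

lemma pol_act:
  assumes "g \<in> SL3" "f \<in> plane_forms 3"
  shows "pol (act_form g f) (g *v x) (g *v y) (g *v z) = pol f x y z"
  using pol_comp[OF assms(2), of "matrix_inv g"]
  by (simp add: act_form_def matrix_inv_mult SL3_nz[OF assms(1)])

lemma cr_pol_act:
  assumes "g \<in> SL3" "f \<in> plane_forms 3"
  shows "cr (pol (act_form g f) (g *v x) (g *v y)) (pol (act_form g f) (g *v x') (g *v y'))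
    = g *v cr (pol f x y) (pol f x' y')"
  using cr_comp[OF clin_pol(1) clin_pol(1), of g "act_form g f" "g *v x" "g *v y" "act_form g f" "g *v x'" "g *v y'"] assms
  by (simp add: pol_act SL3_def)

lemma
  assumes "g \<in> SL3" "f \<in> plane_forms 3"
  shows moduli_act: "moduli (act_form g f) (g *v v1) (g *v v2) = moduli f v1 v2"
    and invA_act: "invA (act_form g f) (g *v v1) (g *v v2) = invA f v1 v2"
    and invB_act: "invB (act_form g f) (g *v v1) (g *v v2) = invB f v1 v2"
    and centre_act: "centre (act_form g f) (g *v v1) (g *v v2) = g *v centre f v1 v2"
proof -
  show 1: "invA (act_form g f) (g *v v1) (g *v v2) = invA f v1 v2" "invB (act_form g f) (g *v v1) (g *v v2) = invB f v1 v2"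
    "centre (act_form g f) (g *v v1) (g *v v2) = g *v centre f v1 v2"
    by (simp_all add: invA_def invB_def centre_def cr_pol_act[OF assms] pol_act[OF assms])
  show "moduli (act_form g f) (g *v v1) (g *v v2) = moduli f v1 v2"
    unfolding moduli_def 1 Let_def by (simp add: pol_act[OF assms])
qed

lemma centre_scale:
  "centre (\<lambda>v. c * f v) (b1 *s v1) (b2 *s v2) = (c ^ 2 * b1 ^ 2 * b2 ^ 2) *s centre f v1 v2"
proof -
  have "pol (\<lambda>v. c * f v) (b *s v) (b *s v) = (\<lambda>x. (c * b ^ 2) * pol f v v x)" for b v
    by (simp add: fun_eq_iff pol_cmult pol_simps power2_eq_square)
  then show ?thesis
    unfolding centre_def by (simp add: cr_scale power2_eq_square mult_ac)
qed

lemma inv_scale: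
  "invA (\<lambda>v. c * f v) (b1 *s v1) (b2 *s v2) = c * b1 ^ 2 * b2 * invA f v1 v2"
  "invB (\<lambda>v. c * f v) (b1 *s v1) (b2 *s v2) = c * b1 * b2 ^ 2 * invB f v1 v2"
  by (simp_all add: invA_def invB_def pol_cmult pol_simps power2_eq_square)

text \<open>An entry of weight \<open>i\<close> has multidegree \<open>(3 i, 3 i, 3 i)\<close>.
  Rescaling the homogeneous data is thus absorbed by the weighted action, and \<open>moduli\<close>
  descends to weighted classes.\<close>

lemma moduli_scale:
  "moduli (\<lambda>v. c * f v) (b1 *s v1) (b2 *s v2) = wact (c ^ 3 * b1 ^ 3 * b2 ^ 3) (moduli f v1 v2)"
  unfolding moduli_def centre_scale inv_scale Let_def
  by (simp add: vec4_eq_iff wact_def vector_4 pol_cmult pol_simps power2_eq_square power3_eq_cube)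

section \<open>Polynomial dependence of the constructions on the data\<close>

lemma polyfuns_polar_coeff:
  "(\<And>u. (\<lambda>p. F p u) \<in> polyfuns K) \<Longrightarrow> (\<lambda>p. polar_coeff (F p) i j k) \<in> polyfuns K"
  unfolding polar_coeff_def by (intro polyfuns_intros)

lemma polyfuns_pol:
  assumes "\<And>u. (\<lambda>p. F p u) \<in> polyfuns K" "\<And>i. (\<lambda>p. x p $ i) \<in> polyfuns K"
    "\<And>i. (\<lambda>p. y p $ i) \<in> polyfuns K" "\<And>i. (\<lambda>p. z p $ i) \<in> polyfuns K"
  shows "(\<lambda>p. pol (F p) (x p) (y p) (z p)) \<in> polyfuns K"
  unfolding pol_def by (intro polyfuns_intros polyfuns_polar_coeff assms)

lemma polyfuns_cr:
  assumes "\<And>j. (\<lambda>p. P p (axis j 1)) \<in> polyfuns K" "\<And>j. (\<lambda>p. Q p (axis j 1)) \<in> polyfuns K"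
  shows "(\<lambda>p. cr (P p) (Q p) $ i) \<in> polyfuns K"
proof -
  have "\<forall>i. (\<lambda>p. cr (P p) (Q p) $ i) \<in> polyfuns K"
    unfolding forall_3 cr_def vector_3 by (intro conjI polyfuns_intros assms)
  then show ?thesis ..
qed

lemma polyfuns_centre:
  assumes "\<And>u. (\<lambda>p. F p u) \<in> polyfuns K" "\<And>i. (\<lambda>p. x p $ i) \<in> polyfuns K"
    "\<And>i. (\<lambda>p. y p $ i) \<in> polyfuns K"
  shows "(\<lambda>p. centre (F p) (x p) (y p) $ i) \<in> polyfuns K"
  unfolding centre_def by (intro polyfuns_cr polyfuns_pol assms polyfuns_intros)

lemma
  assumes "\<And>u. (\<lambda>p. F p u) \<in> polyfuns K" "\<And>i. (\<lambda>p. x p $ i) \<in> polyfuns K"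
    "\<And>i. (\<lambda>p. y p $ i) \<in> polyfuns K"
  shows polyfuns_invA: "(\<lambda>p. invA (F p) (x p) (y p)) \<in> polyfuns K"
    and polyfuns_invB: "(\<lambda>p. invB (F p) (x p) (y p)) \<in> polyfuns K"
    and polyfuns_moduli: "(\<lambda>p. moduli (F p) (x p) (y p) $ j) \<in> polyfuns K"
proof -
  show 1: "(\<lambda>p. invA (F p) (x p) (y p)) \<in> polyfuns K" "(\<lambda>p. invB (F p) (x p) (y p)) \<in> polyfuns K"
    unfolding invA_def invB_def by (intro polyfuns_pol assms)+
  have "\<forall>j. (\<lambda>p. moduli (F p) (x p) (y p) $ j) \<in> polyfuns K"
    unfolding forall_4 moduli_def Let_def vector_4
    by (intro conjI polyfuns_intros polyfuns_pol polyfuns_centre 1 assms)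
  then show "(\<lambda>p. moduli (F p) (x p) (y p) $ j) \<in> polyfuns K" ..
qed

lemma polyfuns_slice: "(\<lambda>x. slice x u) \<in> polyfuns {\<lambda>x. x $ i | i. True}"
proof -
  have c: "(\<lambda>x. x $ i) \<in> polyfuns {\<lambda>x::complex^4. x $ i | i. True}" for i
    by (rule polyfuns.coord) blast
  show ?thesis unfolding slice_def by (intro polyfuns_intros c)
qed

section \<open>Orbits of good points\<close>

lemma C23_coords_polyfuns:
  "(\<lambda>z. fst z u) \<in> polyfuns C23_coords"
  "(\<lambda>z. fst (snd z) $ i) \<in> polyfuns C23_coords"
  "(\<lambda>z. snd (snd z) $ i) \<in> polyfuns C23_coords"
  by (rule polyfuns.coord; force simp: C23_coords_def fun_eq_iff)+

lemma C23_coords_cases: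
  assumes "k \<in> C23_coords"
  obtains u where "k = (\<lambda>z. fst z u)" | i where "k = (\<lambda>z. fst (snd z) $ i)" | i where "k = (\<lambda>z. snd (snd z) $ i)"
  using assms unfolding C23_coords_def case_prod_unfold by blast

lemma mem_C23_cone: "(f, v1, v2) \<in> C23_cone \<longleftrightarrow> f \<in> plane_forms 3 \<and> f \<noteq> (\<lambda>_. 0) \<and> v1 \<noteq> 0 \<and> v2 \<noteq> 0 \<and>
     f v1 = 0 \<and> f v2 = 0"
  by (simp add: C23_cone_def)

lemma act_form_plane_forms: "f \<in> plane_forms d \<Longrightarrow> act_form g f \<in> plane_forms d"
  unfolding act_form_def by (rule plane_forms_comp)

lemma SL3_mult_vec_nz: "g \<in> SL3 \<Longrightarrow> g *v v = 0 \<longleftrightarrow> v = 0"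
  by (metis SL3_nz matrix_inv_mult(2) matrix_vector_mult_0_right)

lemma C23_act_vec_cone: "g \<in> SL3 \<Longrightarrow> (f, v1, v2) \<in> C23_cone \<Longrightarrow> (act_form g f, g *v v1, g *v v2) \<in> C23_cone"
  unfolding mem_C23_cone
  by (auto simp: act_form_plane_forms SL3_mult_vec_nz act_form_inverse SL3_nz)
    (metis SL3_nz act_form_inverse)

lemma C23_proj_eq_iff: "C23_proj (f, v1, v2) = C23_proj (f', v1', v2') \<longleftrightarrow>
    (\<exists>c b1 b2. c \<noteq> 0 \<and> b1 \<noteq> 0 \<and> b2 \<noteq> 0 \<and> f = (\<lambda>v. c * f' v) \<and> v1 = b1 *s v1' \<and> v2 = b2 *s v2')"
  by (auto simp: C23_proj_def proj_pt_eq_iff proj_form_eq_iff)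

lemma slice_nonzero: "slice x \<noteq> (\<lambda>_. 0)"
proof
  assume "slice x = (\<lambda>_. 0)"
  then have "slice x (vector [1, 1, 0]) = 0" by simp
  then show False by (simp add: slice_def vector_3)
qed

lemma slice_C23_cone: "(slice x, axis 1 1, axis 2 1) \<in> C23_cone"
  unfolding mem_C23_cone using slice_nonzero
  by (simp add: slice_plane_form) (simp add: slice_def axis3 vector_3)

lemma C23_orbit_slice:
  assumes z: "(f, v1, v2) \<in> C23_cone" and nz: "invA f v1 v2 \<noteq> 0" "invB f v1 v2 \<noteq> 0"
  obtains g where "g \<in> SL3" "C23_act g (C23_proj (f, v1, v2)) = C23_proj (slice (moduli f v1 v2), axis 1 1, axis 2 1)"
proof -
  have f: "f \<in> plane_forms 3" "f v1 = 0" "f v2 = 0" using z by (auto simp: mem_C23_cone)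
  let ?G = "slice_frame f v1 v2"
  obtain g \<kappa> where g: "g \<in> SL3" "\<kappa> \<noteq> 0" "\<And>y. g *v (?G *v y) = \<kappa> *s y"
    using normalise_frame[OF slice_frame(2)[OF f nz]] by blast
  have "proj_form (act_form g f) = proj_form (slice (moduli f v1 v2))"
    by (rule act_to_frame[OF g f(1) slice_plane_form _ slice_frame(1)[OF f nz]]) (use nz in simp)
  moreover have "proj_pt (g *v v1) = proj_pt (axis 1 1)"
    by (rule act_point_to_frame[OF g(2,3), of "1 / (3 * invA f v1 v2)"])
      (use nz in \<open>simp_all add: slice_frame_def cols_mult axis3 vector_3\<close>)
  moreover have "proj_pt (g *v v2) = proj_pt (axis 2 1)"
    by (rule act_point_to_frame[OF g(2,3), of "1 / (3 * invB f v1 v2)"])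
      (use nz in \<open>simp_all add: slice_frame_def cols_mult axis3 vector_3\<close>)
  ultimately show ?thesis
    by (intro that[OF g(1)], unfold C23_act_proj) (simp add: C23_proj_def)
qed

lemma slice_wact: "t \<noteq> 0 \<Longrightarrow> slice (wact t x) (cols (axis 1 1) (axis 2 1) ((1 / t) *s axis 3 1) *v y) = slice x y"
  by (simp add: slice_def cols_mult axis3 vector_3 wact_def vector_4 field_simps power2_eq_square power3_eq_cube)

lemma det_diag_frame: "det (cols (axis 1 1) (axis 2 1) (c *s axis 3 1)) = c"
  by (simp add: det_cols det3_expand axis3 vector_3)

lemma C23_orbit_slice_wact:
  assumes "t \<noteq> 0"
  shows "C23_orbit (C23_proj (slice (wact t x), axis 1 1, axis 2 1)) = C23_orbit (C23_proj (slice x, axis 1 1, axis 2 1))"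
proof -
  let ?G = "cols (axis 1 1) (axis 2 1) ((1 / t) *s axis 3 1)"
  have "det ?G \<noteq> 0" using assms by (simp add: det_diag_frame)
  then obtain g \<kappa> where g: "g \<in> SL3" "\<kappa> \<noteq> 0" "\<And>y. g *v (?G *v y) = \<kappa> *s y"
    using normalise_frame by blast
  have "proj_form (act_form g (slice (wact t x))) = proj_form (slice x)"
    by (rule act_to_frame[OF g slice_plane_form slice_plane_form, of 1]) (simp_all add: slice_wact[OF assms])
  moreover have "proj_pt (g *v axis 1 1) = proj_pt (axis 1 1)" "proj_pt (g *v axis 2 1) = proj_pt (axis 2 1)"
    by (rule act_point_to_frame[OF g(2,3), of 1]; simp add: cols_mult axis3 vector_3)+
  ultimately have "C23_act g (C23_proj (slice (wact t x), axis 1 1, axis 2 1)) = C23_proj (slice x, axis 1 1, axis 2 1)"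
    unfolding C23_act_proj by (simp add: C23_proj_def)
  then show ?thesis using C23_orbit_act[OF g(1)] by metis
qed

lemma C23_orbit_invariants:
  assumes f: "f \<in> plane_forms 3" and eq: "C23_orbit (C23_proj (f', v1', v2')) = C23_orbit (C23_proj (f, v1, v2))"
  shows "\<exists>t. t \<noteq> 0 \<and> moduli f' v1' v2' = wact t (moduli f v1 v2)"
    and "invA f' v1' v2' = 0 \<longleftrightarrow> invA f v1 v2 = 0" "invB f' v1' v2' = 0 \<longleftrightarrow> invB f v1 v2 = 0"
proof -
  have "C23_proj (f', v1', v2') \<in> C23_orbit (C23_proj (f, v1, v2))" using eq C23_orbit_refl by blast
  then obtain g where g: "g \<in> SL3" "C23_proj (f', v1', v2') = C23_proj (act_form g f, g *v v1, g *v v2)"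
    by (auto simp: C23_orbit_def C23_act_proj)
  then obtain c b1 b2 where c: "c \<noteq> 0" "b1 \<noteq> 0" "b2 \<noteq> 0"
    "f' = (\<lambda>v. c * act_form g f v)" "v1' = b1 *s (g *v v1)" "v2' = b2 *s (g *v v2)"
    by (auto simp: C23_proj_eq_iff)
  show "\<exists>t. t \<noteq> 0 \<and> moduli f' v1' v2' = wact t (moduli f v1 v2)"
    unfolding c(4-6) moduli_scale moduli_act[OF g(1) f]
    by (rule exI[of _ "c ^ 3 * b1 ^ 3 * b2 ^ 3"]) (use c in simp)
  show "invA f' v1' v2' = 0 \<longleftrightarrow> invA f v1 v2 = 0" "invB f' v1' v2' = 0 \<longleftrightarrow> invB f v1 v2 = 0"
    unfolding c(4-6) inv_scale invA_act[OF g(1) f] invB_act[OF g(1) f] using c(1-3) by simp_all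
qed

definition good_cone :: "C23_vec set" where
  "good_cone = {(f, v1, v2) \<in> C23_cone. good f v1 v2}"

lemma good_orbit:
  assumes "(f, v1, v2) \<in> C23_cone" "(f', v1', v2') \<in> C23_cone" "good f v1 v2"
    and "C23_orbit (C23_proj (f', v1', v2')) = C23_orbit (C23_proj (f, v1, v2))"
  shows "good f' v1' v2'"
proof -
  have f: "f \<in> plane_forms 3" using assms(1) by (simp add: mem_C23_cone)
  show ?thesis
    using assms(3) C23_orbit_invariants[OF f assms(4)] by (auto simp: good_def wact_eq_0_iff)
qed

lemma proj_mem_good_iff: "z \<in> C23_cone \<Longrightarrow> C23_proj z \<in> C23_proj ` good_cone \<longleftrightarrow> z \<in> good_cone"
proof
  assume z: "z \<in> C23_cone" and "C23_proj z \<in> C23_proj ` good_cone"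
  then obtain z' where z': "z' \<in> good_cone" "C23_proj z = C23_proj z'" by blast
  obtain f v1 v2 f' v1' v2' where e: "z = (f, v1, v2)" "z' = (f', v1', v2')" by (metis prod_cases3)
  show "z \<in> good_cone"
    using good_orbit[of f' v1' v2' f v1 v2] z z' by (simp add: e good_cone_def)
qed blast

lemma good_orbit_eq_iff:
  assumes z: "(f, v1, v2) \<in> C23_cone" "(f', v1', v2') \<in> C23_cone" "good f v1 v2" "good f' v1' v2'"
  shows "C23_orbit (C23_proj (f', v1', v2')) = C23_orbit (C23_proj (f, v1, v2)) \<longleftrightarrow>
    weighted_class wt (moduli f' v1' v2') = weighted_class wt (moduli f v1 v2)"
proof
  have f: "f \<in> plane_forms 3" using z by (simp add: mem_C23_cone)
  assume "C23_orbit (C23_proj (f', v1', v2')) = C23_orbit (C23_proj (f, v1, v2))"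
  then show "weighted_class wt (moduli f' v1' v2') = weighted_class wt (moduli f v1 v2)"
    using C23_orbit_invariants(1)[OF f] weighted_class_eq_iff by blast
next
  assume "weighted_class wt (moduli f' v1' v2') = weighted_class wt (moduli f v1 v2)"
  then obtain t where t: "t \<noteq> 0" "moduli f' v1' v2' = wact t (moduli f v1 v2)"
    by (auto simp: weighted_class_eq_iff)
  have *: "C23_orbit (C23_proj (f, v1, v2)) = C23_orbit (C23_proj (slice (moduli f v1 v2), axis 1 1, axis 2 1))"
    if z: "(f, v1, v2) \<in> C23_cone" and g: "good f v1 v2" for f v1 v2
  proof -
    have nz: "invA f v1 v2 \<noteq> 0" "invB f v1 v2 \<noteq> 0" using g by (auto simp: good_def)
    show ?thesis by (rule C23_orbit_slice[OF z nz]) (metis C23_orbit_act)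
  qed
  show "C23_orbit (C23_proj (f', v1', v2')) = C23_orbit (C23_proj (f, v1, v2))"
    unfolding *[OF z(1,3)] *[OF z(2,4)] t(2) by (rule C23_orbit_slice_wact[OF t(1)])
qed

text \<open>By contraposition: a nonzero point at which every polynomial vanishing on the orbit of
  \<open>x0\<close> vanishes lies on that orbit. Coordinates and binomials comparing monomials of
  equal weight suffice as tests; the cases follow which entries of \<open>x0\<close> are
  nonzero.\<close>

lemma weighted_class_coclosed:
  assumes "x0 \<noteq> (0 :: complex^4)"
  shows "openin (zariski_top {\<lambda>x. x $ i | i. True} {x. x \<noteq> 0}) ({x. x \<noteq> 0} - weighted_class wt x0)"
  unfolding openin_zariski_top
proof (intro conjI ballI)
  let ?K = "{\<lambda>x::complex^4. x $ i | i. True}"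
  fix x assume x: "x \<in> {x. x \<noteq> 0} - weighted_class wt x0"
  have c: "(\<lambda>x. x $ i) \<in> polyfuns ?K" for i by (rule polyfuns.coord) blast
  have suff: "\<exists>p\<in>polyfuns ?K. p x \<noteq> 0 \<and> {y \<in> {x. x \<noteq> 0}. p y \<noteq> 0} \<subseteq> {x. x \<noteq> 0} - weighted_class wt x0"
    if "p \<in> polyfuns ?K" "p x \<noteq> 0" "\<And>t. t \<noteq> 0 \<Longrightarrow> p (wact t x0) = 0" for p
    by (rule bexI[of _ p]) (use that in \<open>auto simp: weighted_class_wt\<close>)
  have x': "x \<noteq> 0" "\<And>t. t \<noteq> 0 \<Longrightarrow> x \<noteq> wact t x0" using x by (auto simp: weighted_class_wt)
  define b1 b2 b3 b4 where b: "b1 = x0 $ 1" "b2 = x0 $ 2" "b3 = x0 $ 3" "b4 = x0 $ 4"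
  show "\<exists>p\<in>polyfuns ?K. p x \<noteq> 0 \<and> {y \<in> {x. x \<noteq> 0}. p y \<noteq> 0} \<subseteq> {x. x \<noteq> 0} - weighted_class wt x0"
  proof (rule ccontr)
    assume neg: "\<not> ?thesis"
    have van: "p x = 0" if "p \<in> polyfuns ?K" "\<And>t. t \<noteq> 0 \<Longrightarrow> p (wact t x0) = 0" for p
      using suff[OF that(1) _ that(2)] neg by blast
    have e23: "x $ 2 * b3 - b2 * x $ 3 = 0"
      by (rule van[of "\<lambda>x. x $ 2 * b3 - b2 * x $ 3"])
        (intro polyfuns_intros c, simp add: wact_def vector_4 b algebra_simps)
    show False
    proof (cases "b1 = 0")
      case False
      have e2: "x $ 2 * b1^2 - b2 * x $ 1^2 = 0"
        by (rule van[of "\<lambda>x. x $ 2 * b1^2 - b2 * x $ 1^2"])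
          (intro polyfuns_intros c, simp add: wact_def vector_4 b algebra_simps)
      have e3: "x $ 3 * b1^2 - b3 * x $ 1^2 = 0"
        by (rule van[of "\<lambda>x. x $ 3 * b1^2 - b3 * x $ 1^2"])
          (intro polyfuns_intros c, simp add: wact_def vector_4 b algebra_simps)
      have e4: "x $ 4 * b1^3 - b4 * x $ 1^3 = 0"
        by (rule van[of "\<lambda>x. x $ 4 * b1^3 - b4 * x $ 1^3"])
          (intro polyfuns_intros c, simp add: wact_def vector_4 b algebra_simps)
      have "x $ 1 \<noteq> 0" using e2 e3 e4 x'(1) False by (auto simp: vec4_eq_iff)
      moreover have "x = wact (x $ 1 / b1) x0"
        using e2 e3 e4 False by (simp add: vec4_eq_iff wact_def vector_4 b[symmetric] field_simps)
      ultimately show False using x'(2)[of "x $ 1 / b1"] False by simp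
    next
      case b1: True
      have e1: "x $ 1 = 0"
        by (rule van[of "\<lambda>x. x $ 1"]) (rule c, use b1 b in \<open>simp add: wact_def vector_4\<close>)
      show False
      proof (cases "b4 = 0")
        case True
        have e4: "x $ 4 = 0"
          by (rule van[of "\<lambda>x. x $ 4"]) (rule c, use True b in \<open>simp add: wact_def vector_4\<close>)
        have "\<exists>s. x $ 2 = s * b2 \<and> x $ 3 = s * b3 \<and> s \<noteq> 0"
        proof (cases "b2 = 0")
          case True
          then have "b3 \<noteq> 0" using assms b b1 \<open>b4 = 0\<close> by (auto simp: vec4_eq_iff)
          moreover have "x $ 3 \<noteq> 0" using e1 e4 e23 x'(1) True \<open>b3 \<noteq> 0\<close> by (auto simp: vec4_eq_iff)
          ultimately show ?thesis using e23 True by (intro exI[of _ "x $ 3 / b3"]) auto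
        next
          case False
          then have "x $ 3 = x $ 2 / b2 * b3" using e23 by (simp add: field_simps)
          moreover have "x $ 2 \<noteq> 0" using e1 e4 e23 x'(1) False by (auto simp: vec4_eq_iff)
          ultimately show ?thesis using False by (intro exI[of _ "x $ 2 / b2"]) auto
        qed
        then obtain s where s: "x $ 2 = s * b2" "x $ 3 = s * b3" "s \<noteq> 0" by blast
        \<comment> \<open>Only the two entries of weight 2 survive, so their common ratio
          \<open>s\<close> is realized by a square root.\<close>
        obtain t where "t ^ 2 = s" "t \<noteq> 0" using exists_nth_root[OF s(3), of 2] by auto
        then show False
          using x'(2)[of t] s e1 e4 b1 True b by (simp add: vec4_eq_iff wact_def vector_4)
      next
        case b4: False
        have e2: "x $ 2^3 * b4^2 - b2^3 * x $ 4^2 = 0"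
          by (rule van[of "\<lambda>x. x $ 2^3 * b4^2 - b2^3 * x $ 4^2"])
            (intro polyfuns_intros c, simp add: wact_def vector_4 b power_mult_distrib flip: power_mult)
        have e3: "x $ 3^3 * b4^2 - b3^3 * x $ 4^2 = 0"
          by (rule van[of "\<lambda>x. x $ 3^3 * b4^2 - b3^3 * x $ 4^2"])
            (intro polyfuns_intros c, simp add: wact_def vector_4 b power_mult_distrib flip: power_mult)
        have x4: "x $ 4 \<noteq> 0" using e1 e2 e3 x'(1) b4 by (auto simp: vec4_eq_iff)
        \<comment> \<open>The last entry fixes \<open>t\<close> only up to a cube root of unity. The
          entries of weight 2 then match up to such roots, and \<open>e23\<close> forces the two
          roots to agree if both entries are nonzero.\<close>
        obtain t where t: "t ^ 3 = x $ 4 / b4" "t \<noteq> 0"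
          using exists_nth_root[of "x $ 4 / b4" 3] x4 b4 by auto
        have r: "\<exists>\<zeta>. \<zeta>^3 = 1 \<and> y = \<zeta> * t^2 * e" if "y^3 * b4^2 - e^3 * x $ 4^2 = 0" for y e
        proof (cases "e = 0")
          case True
          then show ?thesis using that b4 by (intro exI[of _ 1]) auto
        next
          case False
          have "x $ 4 = t^3 * b4" using t b4 by simp
          then have "b4^2 * (y^3 - e^3 * (t^2)^3) = 0" using that by algebra
          then have "y^3 = e^3 * (t^2)^3" using b4 by simp
          then show ?thesis using False t
            by (intro exI[of _ "y / (t^2 * e)"]) (simp add: power_divide power_mult_distrib)
        qed
        obtain \<zeta> where z: "\<zeta>^3 = 1" "x $ 2 = \<zeta> * t^2 * b2" using r[OF e2] by blast
        obtain \<zeta>' where z': "\<zeta>'^3 = 1" "x $ 3 = \<zeta>' * t^2 * b3" using r[OF e3] by blast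
        have "\<exists>\<eta>. \<eta>^3 = 1 \<and> x $ 2 = \<eta> * t^2 * b2 \<and> x $ 3 = \<eta> * t^2 * b3"
        proof (cases "b2 = 0")
          case True
          then show ?thesis using z z' by (intro exI[of _ \<zeta>']) auto
        next
          case False
          have "t^2 * b2 * b3 * (\<zeta> - \<zeta>') = 0" using e23 z z' by algebra
          then have "b3 = 0 \<or> \<zeta> = \<zeta>'" using False t by auto
          then show ?thesis using z z' by (intro exI[of _ \<zeta>]) auto
        qed
        then obtain \<eta> where \<eta>: "\<eta>^3 = 1" "x $ 2 = \<eta> * t^2 * b2" "x $ 3 = \<eta> * t^2 * b3" by blast
        \<comment> \<open>The factor \<open>\<eta>^2\<close> absorbs the root of unity, since
          \<open>(\<eta>^2)^2 = \<eta>\<close> and \<open>(\<eta>^2)^3 = 1\<close>.\<close>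
        have "x = wact (\<eta>^2 * t) x0"
          unfolding vec4_eq_iff wact_def vector_4 b[symmetric]
        proof (intro conjI)
          show "x $ 1 = \<eta>^2 * t * b1" using e1 b1 by simp
          show "x $ 2 = (\<eta>^2 * t)^2 * b2" "x $ 3 = (\<eta>^2 * t)^2 * b3" using \<eta> by algebra+
          have "x $ 4 = t^3 * b4" using t b4 by simp
          then show "x $ 4 = (\<eta>^2 * t)^3 * b4" using \<eta>(1) by algebra
        qed
        moreover have "\<eta>^2 * t \<noteq> 0" using \<eta>(1) t(2) by auto
        ultimately show False using x'(2) by blast
      qed
    qed
  qed
qed auto

text \<open>A stabilizing \<open>g\<close> scales \<open>v1\<close> and \<open>v2\<close>, hence by
  equivariance also \<open>w\<close>. Invariance of \<open>invA\<close> and \<open>invB\<close>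
  forces the eigenvalues \<open>s, s, 1 / s^2\<close>, so \<open>g\<close> is determined by
  \<open>s\<close>. A nonzero entry of \<open>moduli\<close> of weight \<open>i\<close> then yields
  \<open>s^(3 i) = 1\<close>.\<close>

lemma good_stabilizer_finite:
  assumes z: "(f, v1, v2) \<in> C23_cone" and good: "good f v1 v2"
  shows "finite {g \<in> SL3. C23_act g (C23_proj (f, v1, v2)) = C23_proj (f, v1, v2)}"
proof -
  have f: "f \<in> plane_forms 3" "f v1 = 0" using z by (auto simp: mem_C23_cone)
  define w C where "w = centre f v1 v2" and "C = cols v1 v2 w"
  have nz: "invA f v1 v2 \<noteq> 0" "invB f v1 v2 \<noteq> 0" "moduli f v1 v2 \<noteq> 0" using good by (auto simp: good_def)
  have "det C \<noteq> 0"
    using det3_centre[OF f] nz by (simp add: C_def w_def det_cols)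
  define m where "m s = cols (s *s v1) (s *s v2) ((1 / s^2) *s w) ** matrix_inv C" for s
  have "\<exists>s. s ^ 18 = 1 \<and> g = m s"
    if g: "g \<in> SL3" "C23_act g (C23_proj (f, v1, v2)) = C23_proj (f, v1, v2)" for g
  proof -
    obtain c s s' where c: "c \<noteq> 0" "s \<noteq> 0" "s' \<noteq> 0" "act_form g f = (\<lambda>v. c * f v)" "g *v v1 = s *s v1" "g *v v2 = s' *s v2"
      using g(2) unfolding C23_act_proj C23_proj_eq_iff by blast
    have 1: "c * s^2 * s' = 1" "c * s * s'^2 = 1"
      using invA_act[OF g(1) f(1), of v1 v2] invB_act[OF g(1) f(1), of v1 v2] nz unfolding c(4-6) inv_scale by simp_all
    then have "c * s * s' * s = c * s * s' * s'" by (simp add: power2_eq_square mult_ac)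
    then have s': "s' = s" using c by simp
    then have cs: "c = 1 / s^3" using 1(1) c(2) by (simp add: field_simps power2_eq_square power3_eq_cube)
    have "c^2 * s^2 * s^2 = 1 / s^2" "c^3 * s^3 * s^3 = 1 / s^3"
      using c(2) by (simp_all add: cs field_simps power2_eq_square power3_eq_cube)
    then have gw: "g *v w = (1 / s^2) *s w" and "moduli f v1 v2 = wact (1 / s^3) (moduli f v1 v2)"
      using centre_act[OF g(1) f(1), of v1 v2] moduli_act[OF g(1) f(1), of v1 v2]
      unfolding c(4-6) centre_scale moduli_scale w_def[symmetric] s' by simp_all
    moreover have "u = 1" if "m = m / u" "m \<noteq> 0" for m u :: complex
      using that by (cases "u = 0") (auto simp: field_simps)
    ultimately have "s^3 = 1 \<or> s^6 = 1 \<or> s^9 = 1"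
      using nz(3) by (simp add: vec4_eq_iff wact_def vector_4 power_divide flip: power_mult) metis
    \<comment> \<open>18 is the least common multiple of the possible orders 3, 6 and 9.\<close>
    then have "s^18 = 1"
    proof (elim disjE)
      assume "s^3 = 1" then have "(s^3)^6 = 1" by simp then show ?thesis by (simp flip: power_mult)
    next
      assume "s^6 = 1" then have "(s^6)^3 = 1" by simp then show ?thesis by (simp flip: power_mult)
    next
      assume "s^9 = 1" then have "(s^9)^2 = 1" by simp then show ?thesis by (simp flip: power_mult)
    qed
    moreover have "g = m s"
    proof -
      have "g *v (C *v y) = cols (s *s v1) (s *s v2) ((1 / s^2) *s w) *v y" for y
        unfolding C_def cols_mult
        by (simp add: matrix_vector_right_distrib vector_scalar_commute c(5,6) gw s' vector_smult_assoc mult_ac)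
      from this[of "matrix_inv C *v y" for y] have "g *v y = m s *v y" for y
        by (simp add: matrix_inv_mult \<open>det C \<noteq> 0\<close> m_def flip: matrix_vector_mul_assoc)
      then show ?thesis by (simp add: matrix_eq)
    qed
    ultimately show ?thesis by blast
  qed
  then have "{g \<in> SL3. C23_act g (C23_proj (f, v1, v2)) = C23_proj (f, v1, v2)} \<subseteq> m ` {s. s ^ 18 = 1}" by auto
  moreover have "finite {s::complex. s ^ 18 = 1}" by (rule finite_roots_unity) simp
  ultimately show ?thesis using finite_surj by blast
qed

section \<open>Invariant sections\<close>

lemma C23_mem_orbit_iff: "x \<in> C23_orbit y \<longleftrightarrow> C23_orbit x = C23_orbit y"
proof
  assume "x \<in> C23_orbit y"
  then obtain g where "g \<in> SL3" "x = C23_act g y" by (auto simp: C23_orbit_def)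
  then show "C23_orbit x = C23_orbit y" by (simp add: C23_orbit_act)
qed (use C23_orbit_refl in blast)

definition semi_invariant :: "(C23_vec \<Rightarrow> complex) \<Rightarrow> nat \<Rightarrow> nat \<Rightarrow> nat \<Rightarrow> bool" where
  "semi_invariant X p q r \<longleftrightarrow> X \<in> polyfuns C23_coords \<and>
     (\<forall>f v1 v2 c b1 b2. X ((\<lambda>v. c * f v), b1 *s v1, b2 *s v2) = c ^ p * b1 ^ q * b2 ^ r * X (f, v1, v2)) \<and>
     (\<forall>g f v1 v2. g \<in> SL3 \<and> f \<in> plane_forms 3 \<longrightarrow> X (act_form g f, g *v v1, g *v v2) = X (f, v1, v2))"

lemma semi_invariant_mult:
  assumes "semi_invariant X p q r" "semi_invariant Y p' q' r'"
  shows "semi_invariant (\<lambda>z. X z * Y z) (p + p') (q + q') (r + r')"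
  using assms unfolding semi_invariant_def by (simp add: polyfuns.mult power_add)

lemma semi_invariant_power:
  assumes "semi_invariant X p q r"
  shows "semi_invariant (\<lambda>z. X z ^ k) (k * p) (k * q) (k * r)"
  using assms unfolding semi_invariant_def
  by (simp add: polyfuns_power power_mult_distrib power_mult[symmetric] mult.commute[of k])

lemma semi_invariant_section:
  assumes "semi_invariant X (n * d) (n * a1) (n * a2)"
  shows "X \<in> C23_invariant_sections (d, a1, a2) n"
proof -
  have "X \<in> C23_sections (d, a1, a2) n"
    using assms unfolding semi_invariant_def C23_sections_def by (auto intro: polyfuns_regular)
  moreover have "X (C23_act_vec g z) = X z" if "g \<in> SL3" "z \<in> C23_cone" for g z
    using assms that by (cases z) (simp add: semi_invariant_def C23_act_vec_def mem_C23_cone)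
  ultimately show ?thesis by (simp add: C23_invariant_sections_def)
qed

text \<open>Orbits of good points are closed because weighted classes are closed in \<open>\<complex>\<^sup>4 - {0}\<close>.\<close>

lemma good_stable:
  assumes X: "semi_invariant X (n * d) (n * a1) (n * a2)" and n: "n \<ge> 1"
    and good: "\<And>z. z \<in> C23_cone \<Longrightarrow> X z \<noteq> 0 \<Longrightarrow> z \<in> good_cone"
    and z: "z \<in> C23_cone" "X z \<noteq> 0"
  shows "C23_proj z \<in> C23_stable (d, a1, a2)"
proof -
  define N where "N = C23_nonvanishing X"
  have X_proj: "X z \<noteq> 0 \<longleftrightarrow> X z' \<noteq> 0" if "C23_proj z = C23_proj z'" for z z'
  proof -
    obtain f v1 v2 f' v1' v2' where e: "z = (f, v1, v2)" "z' = (f', v1', v2')" by (metis prod_cases3)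
    with that obtain c b1 b2 where "c \<noteq> 0" "b1 \<noteq> 0" "b2 \<noteq> 0" "f = (\<lambda>v. c * f' v)" "v1 = b1 *s v1'" "v2 = b2 *s v2'"
      using C23_proj_eq_iff by blast
    then show ?thesis using X by (simp add: e semi_invariant_def)
  qed
  have N_iff: "C23_proj z \<in> N \<longleftrightarrow> X z \<noteq> 0" if "z \<in> C23_cone" for z
    using that X_proj unfolding N_def C23_nonvanishing_def by blast
  have N_sub: "N \<subseteq> C23_proj ` C23_cone" by (auto simp: N_def C23_nonvanishing_def)
  have topC: "fs_top C23 = quotient_top C23_proj (zariski_top C23_coords C23_cone)"
    by (simp add: C23_def)
  have "closedin (subtopology (fs_top C23) N) (C23_orbit y)" if "y \<in> N" for y
  proof -
    obtain f v1 v2 where y: "y = C23_proj (f, v1, v2)" "(f, v1, v2) \<in> C23_cone" "X (f, v1, v2) \<noteq> 0"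
      using \<open>y \<in> N\<close> by (auto simp: N_def C23_nonvanishing_def)
    have gy: "good f v1 v2" using good[OF y(2,3)] by (simp add: good_cone_def)
    have f: "f \<in> plane_forms 3" using y(2) by (simp add: mem_C23_cone)
    define \<mu> :: "C23_vec \<Rightarrow> complex^4" where "\<mu> z = moduli (fst z) (fst (snd z)) (snd (snd z))" for z
    define V where "V = {x. x \<noteq> 0} - weighted_class wt (moduli f v1 v2)"
    have orb: "C23_orbit y \<subseteq> N"
    proof
      fix x assume "x \<in> C23_orbit y"
      then obtain g where g: "g \<in> SL3" "x = C23_proj (act_form g f, g *v v1, g *v v2)"
        by (auto simp: C23_orbit_def y(1) C23_act_proj)
      show "x \<in> N"
        unfolding g(2) N_iff[OF C23_act_vec_cone[OF g(1) y(2)]] using X y(3) f g(1) by (simp add: semi_invariant_def)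
    qed
    have inV: "C23_proj z \<in> N - C23_orbit y \<longleftrightarrow> X z \<noteq> 0 \<and> \<mu> z \<in> V" if z: "z \<in> C23_cone" for z
    proof (cases "X z = 0")
      case True
      then show ?thesis using N_iff[OF z] by simp
    next
      case False
      obtain f' v1' v2' where e: "z = (f', v1', v2')" by (metis prod_cases3)
      have gz: "good f' v1' v2'" using good[OF z False] by (simp add: good_cone_def e)
      have "C23_proj z \<in> C23_orbit y \<longleftrightarrow> C23_orbit (C23_proj z) = C23_orbit y"
        by (rule C23_mem_orbit_iff)
      also have "\<dots> \<longleftrightarrow> weighted_class wt (\<mu> z) = weighted_class wt (moduli f v1 v2)"
        using good_orbit_eq_iff[OF y(2) _ gy gz] z by (simp add: e y(1) \<mu>_def)
      also have "\<dots> \<longleftrightarrow> \<mu> z \<in> weighted_class wt (moduli f v1 v2)"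
        unfolding weighted_class_eq_iff by (auto simp: weighted_class_wt)
      finally show ?thesis
        using N_iff[OF z] False gz by (auto simp: V_def good_def \<mu>_def e)
    qed
    have X0: "openin (zariski_top C23_coords C23_cone) {z \<in> C23_cone. X z \<noteq> 0}"
      using X by (intro openin_zariski_basic) (simp add: semi_invariant_def)
    have "openin (zariski_top C23_coords C23_cone) {z \<in> {z \<in> C23_cone. X z \<noteq> 0}. \<mu> z \<in> V}"
    proof (rule zariski_preimage_open[OF X0])
      show "openin (zariski_top {\<lambda>x. x $ i | i. True} {x. x \<noteq> 0}) V"
        unfolding V_def using gy by (intro weighted_class_coclosed) (simp add: good_def)
      show "\<mu> ` {z \<in> C23_cone. X z \<noteq> 0} \<subseteq> {x. x \<noteq> 0}"
        using good by (force simp: \<mu>_def good_cone_def good_def)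
      show "(\<lambda>z. k (\<mu> z)) \<in> polyfuns C23_coords" if "k \<in> {\<lambda>x. x $ i | i. True}" for k
        using that unfolding \<mu>_def by (auto intro!: polyfuns_moduli C23_coords_polyfuns)
    qed
    also have "{z \<in> {z \<in> C23_cone. X z \<noteq> 0}. \<mu> z \<in> V} = {z \<in> C23_cone. C23_proj z \<in> N - C23_orbit y}"
      using inV by blast
    finally have "openin (fs_top C23) (N - C23_orbit y)"
      unfolding topC openin_quotient_top topspace_zariski_top using N_sub by blast
    then have "openin (subtopology (fs_top C23) N) (N - C23_orbit y)"
      unfolding openin_subtopology by blast
    moreover have "topspace (subtopology (fs_top C23) N) = N"
      using N_sub by (auto simp: topC topspace_quotient_top topspace_zariski_top)
    ultimately show ?thesis using orb by (simp add: closedin_def)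
  qed
  moreover have "finite {g \<in> SL3. C23_act g (C23_proj z) = C23_proj z}"
    using good_stabilizer_finite good[OF z] z by (cases z) (auto simp: good_cone_def)
  moreover have "C23_proj z \<in> N" using N_iff z by blast
  moreover have "C23_proj z \<in> topspace (fs_top C23)"
    using z by (simp add: topC topspace_quotient_top topspace_zariski_top)
  ultimately show ?thesis
    using n semi_invariant_section[OF X] unfolding C23_stable_def N_def by blast
qed

text \<open>
  Where \<open>m\<^sub>1 = 0\<close>, the two vectors below are multiples of \<open>centre f v1 v2\<close>, but of different degrees: \<open>centre f v1 v2\<close>
  alone does not give enough sections near the walls \<open>w\<^sub>i = 1\<close>.
\<close>

definition centre1 :: "(complex^3 \<Rightarrow> complex) \<Rightarrow> complex^3 \<Rightarrow> complex^3 \<Rightarrow> complex^3" where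
  "centre1 f v1 v2 = cr (pol f v1 v1) (pol f v1 v2)"

definition centre2 :: "(complex^3 \<Rightarrow> complex) \<Rightarrow> complex^3 \<Rightarrow> complex^3 \<Rightarrow> complex^3" where
  "centre2 f v1 v2 = cr (pol f v1 v2) (pol f v2 v2)"

lemma pol_scaled: "pol (\<lambda>v. c * f v) (b *s v) (b' *s v') = (\<lambda>x. (c * b * b') * pol f v v' x)"
  by (simp add: fun_eq_iff pol_cmult pol_simps)

lemma centre12_scale:
  "centre1 (\<lambda>v. c * f v) (b1 *s v1) (b2 *s v2) = (c ^ 2 * b1 ^ 3 * b2) *s centre1 f v1 v2"
  "centre2 (\<lambda>v. c * f v) (b1 *s v1) (b2 *s v2) = (c ^ 2 * b1 * b2 ^ 3) *s centre2 f v1 v2"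
  by (simp_all add: centre1_def centre2_def pol_scaled cr_scale power2_eq_square power3_eq_cube mult_ac)

lemma centre12_act:
  assumes "g \<in> SL3" "f \<in> plane_forms 3"
  shows "centre1 (act_form g f) (g *v v1) (g *v v2) = g *v centre1 f v1 v2"
    "centre2 (act_form g f) (g *v v1) (g *v v2) = g *v centre2 f v1 v2"
  by (simp_all add: centre1_def centre2_def cr_pol_act[OF assms])

lemma polyfuns_centre12:
  assumes "\<And>u. (\<lambda>p. F p u) \<in> polyfuns K" "\<And>i. (\<lambda>p. x p $ i) \<in> polyfuns K"
    "\<And>i. (\<lambda>p. y p $ i) \<in> polyfuns K"
  shows "(\<lambda>p. centre1 (F p) (x p) (y p) $ i) \<in> polyfuns K"
    "(\<lambda>p. centre2 (F p) (x p) (y p) $ i) \<in> polyfuns K"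
  unfolding centre1_def centre2_def by (intro polyfuns_cr polyfuns_pol assms polyfuns_intros)+

text \<open>On the frame \<open>v1, v2, w\<close> the forms \<open>pol f v1 v1\<close>,
  \<open>pol f v1 v2\<close>, \<open>pol f v2 v2\<close> take the values \<open>(0, a, 0)\<close>,
  \<open>(a, b, 0)\<close>, \<open>(b, 0, 0)\<close>. The middle one is therefore a combination of
  the other two, and taking \<open>cr\<close> with either of them leaves one term.\<close>

lemma centre12_eq:
  assumes f: "f \<in> plane_forms 3" "f v1 = 0" "f v2 = 0"
    and nz: "invA f v1 v2 \<noteq> 0" "invB f v1 v2 \<noteq> 0" and \<alpha>: "pol f v1 v2 (centre f v1 v2) = 0"
  shows "centre1 f v1 v2 = (invA f v1 v2 / invB f v1 v2) *s centre f v1 v2"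
    "centre2 f v1 v2 = (invB f v1 v2 / invA f v1 v2) *s centre f v1 v2"
proof -
  define a b w where "a = invA f v1 v2" and "b = invB f v1 v2" and "w = centre f v1 v2"
  have e: "pol f v1 v1 v1 = 0" "pol f v2 v2 v2 = 0" using f pol_diag[OF f(1)] by metis+
  have "pol f v1 v2 = (\<lambda>x. (a / b) * pol f v2 v2 x + (b / a) * pol f v1 v1 x)"
  proof (rule clin_eqI[OF clin_pol(1)])
    show "clin (\<lambda>x. (a / b) * pol f v2 v2 x + (b / a) * pol f v1 v1 x)"
      by (simp add: clin_def pol_simps algebra_simps add_divide_distrib)
    show "det3 v1 v2 w \<noteq> 0" unfolding w_def det3_centre[OF f(1,2)] using nz by simp
    show "pol f v1 v2 v1 = a / b * pol f v2 v2 v1 + b / a * pol f v1 v1 v1"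
      using e nz by (simp add: a_def b_def invA_def invB_def pol_commute)
    show "pol f v1 v2 v2 = a / b * pol f v2 v2 v2 + b / a * pol f v1 v1 v2"
      using e nz by (simp add: a_def b_def invA_def invB_def)
    show "pol f v1 v2 w = a / b * pol f v2 v2 w + b / a * pol f v1 v1 w"
      using \<alpha> pol_centre(1)[of f v1 v2] pol_centre(2)[of f v2 v1] by (simp add: w_def)
  qed
  then show "centre1 f v1 v2 = (invA f v1 v2 / invB f v1 v2) *s centre f v1 v2"
    "centre2 f v1 v2 = (invB f v1 v2 / invA f v1 v2) *s centre f v1 v2"
    unfolding centre1_def centre2_def centre_def a_def b_def
    by (simp_all add: cr_def vec_eq_iff forall_3 vector_3 algebra_simps diff_divide_distrib)
qed

abbreviation lift3 :: "((complex^3 \<Rightarrow> complex) \<Rightarrow> complex^3 \<Rightarrow> complex^3 \<Rightarrow> 'b) \<Rightarrow> C23_vec \<Rightarrow> 'b" where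
  "lift3 P \<equiv> \<lambda>z. P (fst z) (fst (snd z)) (snd (snd z))"

lemma semi_invariants:
  "semi_invariant (lift3 invA) 1 2 1" "semi_invariant (lift3 invB) 1 1 2"
  "semi_invariant (lift3 (\<lambda>f v1 v2. pol f v1 v2 (centre f v1 v2))) 3 3 3"
  "semi_invariant (lift3 (\<lambda>f v1 v2. let w = centre1 f v1 v2 in pol f v1 w w)) 5 7 2"
  "semi_invariant (lift3 (\<lambda>f v1 v2. let w = centre2 f v1 v2 in pol f v1 w w)) 5 3 6"
  "semi_invariant (lift3 (\<lambda>f v1 v2. let w = centre1 f v1 v2 in pol f v2 w w)) 5 6 3"
  "semi_invariant (lift3 (\<lambda>f v1 v2. let w = centre2 f v1 v2 in pol f v2 w w)) 5 2 7"
  "semi_invariant (lift3 (\<lambda>f v1 v2. let w = centre1 f v1 v2 in pol f w w w)) 7 9 3"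
  "semi_invariant (lift3 (\<lambda>f v1 v2. let w = centre2 f v1 v2 in pol f w w w)) 7 3 9"
  unfolding semi_invariant_def Let_def
  by (simp_all add: polyfuns_invA polyfuns_invB polyfuns_pol polyfuns_centre polyfuns_centre12 C23_coords_polyfuns
      inv_scale centre_scale centre12_scale pol_cmult pol_simps invA_act invB_act centre_act centre12_act pol_act)
    (simp_all add: eval_nat_numeral)

text \<open>The positive exponents \<open>i\<close>, \<open>j\<close>, \<open>k\<close> confine the
  nonvanishing locus of the product to good points, as \<open>good_stable\<close> requires. The role
  of \<open>Y\<close> is to balance the degrees, so its exponent \<open>l\<close> may be
  zero.\<close>

lemma good_stable_two:
  assumes X: "semi_invariant X p q r" and Y: "semi_invariant Y p' q' r'"
    and good: "\<And>f v1 v2. \<lbrakk>(f, v1, v2) \<in> C23_cone; invA f v1 v2 \<noteq> 0; invB f v1 v2 \<noteq> 0; X (f, v1, v2) \<noteq> 0\<rbrakk> \<Longrightarrow> good f v1 v2"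
    and n: "n \<ge> 1" "i \<ge> 1" "j \<ge> 1" "k \<ge> 1"
    and deg: "n * d = i + j + k * p + l * p'" "n * a1 = 2 * i + j + k * q + l * q'" "n * a2 = i + 2 * j + k * r + l * r'"
    and z: "(f, v1, v2) \<in> C23_cone" "good f v1 v2" "X (f, v1, v2) \<noteq> 0" "Y (f, v1, v2) \<noteq> 0"
  shows "C23_proj (f, v1, v2) \<in> C23_stable (d, a1, a2)"
proof -
  let ?S = "\<lambda>z. lift3 invA z ^ i * lift3 invB z ^ j * X z ^ k * Y z ^ l"
  have "semi_invariant ?S (i * 1 + j * 1 + k * p + l * p') (i * 2 + j * 1 + k * q + l * q') (i * 1 + j * 2 + k * r + l * r')"
    by (intro semi_invariant_mult semi_invariant_power semi_invariants X Y)
  then have "semi_invariant ?S (n * d) (n * a1) (n * a2)" unfolding deg mult_1_right mult.commute[of 2] .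
  then show ?thesis
  proof (rule good_stable[OF _ n(1)])
    fix z assume "z \<in> C23_cone" "?S z \<noteq> 0"
    then show "z \<in> good_cone" using good n by (cases z) (auto simp: good_cone_def)
  qed (use z in \<open>auto simp: good_def\<close>)
qed

text \<open>Subtracting the equations gives \<open>i = n (a1 - d)\<close>,
  \<open>j = n (a2 - d)\<close> and then \<open>6 k = n (3 d - a1 - a2)\<close>: the three walls of
  the chamber are exactly the positivity of the exponents, and \<open>n = 6\<close> makes
  \<open>k\<close> an integer. The term \<open>k * 3\<close> occurs twice because one invariant
  plays both \<open>X\<close> and \<open>Y\<close>.\<close>

lemma degrees_alpha:
  fixes d a1 a2 :: nat assumes "a1 > d" "a2 > d" "a1 + a2 < 3 * d"
  shows "\<exists>n i j k. n \<ge> 1 \<and> i \<ge> 1 \<and> j \<ge> 1 \<and> k \<ge> 1 \<and>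
    n * d = i + j + k * 3 + k * 3 \<and> n * a1 = 2 * i + j + k * 3 + k * 3 \<and> n * a2 = i + 2 * j + k * 3 + k * 3"
  by (rule exI[of _ 6], rule exI[of _ "6 * (a1 - d)"], rule exI[of _ "6 * (a2 - d)"], rule exI[of _ "3 * d - a1 - a2"])
    (use assms in auto)

text \<open>
  The excess \<open>e = 3d - a1 - a2\<close> determines how many copies of the two invariants are needed; both they and the
  factors \<open>invA\<close>, \<open>invB\<close> are taken in the proportion \<open>I : J\<close>, which keeps all exponents positive.
\<close>

lemma degrees_cube:
  fixes d a1 a2 :: nat assumes a: "a1 > d" "a2 > d" "a1 + a2 < 3 * d"
  shows "\<exists>n i j k l. n \<ge> 1 \<and> i \<ge> 1 \<and> j \<ge> 1 \<and> k \<ge> 1 \<and>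
    n * d = i + j + k * 7 + l * 7 \<and> n * a1 = 2 * i + j + k * 9 + l * 3 \<and> n * a2 = i + 2 * j + k * 3 + l * 9"
proof -
  define e where "e = 3 * d - a1 - a2"
  \<comment> \<open>These are \<open>9 (a1 - d) + 4 e\<close> and \<open>9 (a2 - d) + 4 e\<close>,
    visibly positive in the chamber, so the subtraction does not truncate. With
    \<open>m + 6 e = I + J\<close> every degree equation becomes divisible by
    \<open>I + J\<close>.\<close>
  define I J where "I = 5 * a1 + 3 * d - 4 * a2" and "J = 5 * a2 + 3 * d - 4 * a1"
  have "I + J > 6 * e" "I \<ge> 1" "J \<ge> 1" "e \<ge> 1" using a by (auto simp: e_def I_def J_def)
  define m where "m = I + J - 6 * e"
  have i: "int e = 3 * int d - int a1 - int a2" "int I = 5 * int a1 + 3 * int d - 4 * int a2"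
    "int J = 5 * int a2 + 3 * int d - 4 * int a1" "int m = int I + int J - 6 * int e"
    using a \<open>I + J > 6 * e\<close> by (auto simp: e_def I_def J_def m_def)
  have "m \<ge> 1" using \<open>I + J > 6 * e\<close> by (simp add: m_def)
  have "int (9 * (I + J) * d) = int (I * m + J * m + e * I * 7 + e * J * 7)"
    "int (9 * (I + J) * a1) = int (2 * (I * m) + J * m + e * I * 9 + e * J * 3)"
    "int (9 * (I + J) * a2) = int (I * m + 2 * (J * m) + e * I * 3 + e * J * 9)"
    unfolding of_nat_mult of_nat_add i(4) unfolding i(1-3) by (simp_all add: algebra_simps)
  then have "9 * (I + J) * d = I * m + J * m + e * I * 7 + e * J * 7"
    "9 * (I + J) * a1 = 2 * (I * m) + J * m + e * I * 9 + e * J * 3"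
    "9 * (I + J) * a2 = I * m + 2 * (J * m) + e * I * 3 + e * J * 9"
    by (simp_all only: of_nat_eq_iff)
  moreover have "9 * (I + J) \<ge> 1" "I * m \<ge> 1" "J * m \<ge> 1" "e * I \<ge> 1"
    using \<open>I \<ge> 1\<close> \<open>J \<ge> 1\<close> \<open>e \<ge> 1\<close> \<open>m \<ge> 1\<close> by (simp_all add: Suc_leI)
  ultimately show ?thesis by blast
qed

lemma degrees_linear:
  fixes d a1 a2 :: nat assumes a: "a1 > d" "a2 > d" "a1 + a2 < 3 * d"
  shows "\<exists>n i j k l. n \<ge> 1 \<and> i \<ge> 1 \<and> j \<ge> 1 \<and> k \<ge> 1 \<and>
    n * d = i + j + k * 5 + l * 5 \<and> n * a1 = 2 * i + j + k * 7 + l * 3 \<and> n * a2 = i + 2 * j + k * 2 + l * 6"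
proof -
  define e where "e = 3 * d - a1 - a2"
  \<comment> \<open>The pattern of \<open>degrees_cube\<close> with other invariants: here
    \<open>I = 6 (a1 - d) + 2 e\<close> and \<open>J = 6 (a2 - d) + 3 e\<close>, and the relation
    that makes the equations divisible by \<open>I + J\<close> is \<open>m + 4 e = I + J\<close>.
    The asymmetry of \<open>I\<close> and \<open>J\<close> reflects the degrees
    \<open>(5, 7, 2)\<close> and \<open>(5, 3, 6)\<close>.\<close>
  define I J where "I = 4 * a1 - 2 * a2" and "J = 3 * (a2 + d - a1)"
  have "I + J > 4 * e" "I \<ge> 1" "J \<ge> 1" "e \<ge> 1" using a by (auto simp: e_def I_def J_def)
  define m where "m = I + J - 4 * e"
  have i: "int e = 3 * int d - int a1 - int a2" "int I = 4 * int a1 - 2 * int a2"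
    "int J = 3 * (int a2 + int d - int a1)" "int m = int I + int J - 4 * int e"
    using a \<open>I + J > 4 * e\<close> by (auto simp: e_def I_def J_def m_def)
  have "m \<ge> 1" using \<open>I + J > 4 * e\<close> by (simp add: m_def)
  have "int (6 * (I + J) * d) = int (I * m + J * m + e * I * 5 + e * J * 5)"
    "int (6 * (I + J) * a1) = int (2 * (I * m) + J * m + e * I * 7 + e * J * 3)"
    "int (6 * (I + J) * a2) = int (I * m + 2 * (J * m) + e * I * 2 + e * J * 6)"
    unfolding of_nat_mult of_nat_add i(4) unfolding i(1-3) by (simp_all add: algebra_simps)
  then have "6 * (I + J) * d = I * m + J * m + e * I * 5 + e * J * 5"
    "6 * (I + J) * a1 = 2 * (I * m) + J * m + e * I * 7 + e * J * 3"
    "6 * (I + J) * a2 = I * m + 2 * (J * m) + e * I * 2 + e * J * 6"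
    by (simp_all only: of_nat_eq_iff)
  moreover have "6 * (I + J) \<ge> 1" "I * m \<ge> 1" "J * m \<ge> 1" "e * I \<ge> 1"
    using \<open>I \<ge> 1\<close> \<open>J \<ge> 1\<close> \<open>e \<ge> 1\<close> \<open>m \<ge> 1\<close> by (simp_all add: Suc_leI)
  ultimately show ?thesis by blast
qed

text \<open>Some entry of \<open>moduli\<close> is nonzero and yields the section. The first entry
  serves by itself. When it vanishes, another nonzero entry is rewritten with \<open>centre1\<close>
  and \<open>centre2\<close>, which gives two invariants that are nonzero together but differ in
  degree.\<close>

lemma good_imp_stable:
  assumes a: "a1 > d" "a2 > d" "a1 + a2 < 3 * d" and z: "(f, v1, v2) \<in> C23_cone" and good: "good f v1 v2"
  shows "C23_proj (f, v1, v2) \<in> C23_stable (d, a1, a2)"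
proof -
  have nz: "invA f v1 v2 \<noteq> 0" "invB f v1 v2 \<noteq> 0" using good by (auto simp: good_def)
  have f: "f \<in> plane_forms 3" "f v1 = 0" "f v2 = 0" using z by (auto simp: mem_C23_cone)
  \<comment> \<open>Used to see that a chosen invariant detects good points: at a point that is not
    good, with \<open>invA\<close> and \<open>invB\<close> nonzero, all these values vanish, and by
    \<open>eqs\<close> so do their variants with \<open>centre1\<close> and
    \<open>centre2\<close>.\<close>
  have zero: "pol f v1 v2 (centre f v1 v2) = 0" "pol f v1 (centre f v1 v2) (centre f v1 v2) = 0"
     "pol f v2 (centre f v1 v2) (centre f v1 v2) = 0"
     "pol f (centre f v1 v2) (centre f v1 v2) (centre f v1 v2) = 0"
    if "invA f v1 v2 \<noteq> 0" "invB f v1 v2 \<noteq> 0" "\<not> good f v1 v2" for f v1 v2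
    using that by (auto simp: good_def moduli_def Let_def vec4_eq_iff vector_4)
  note eqs = centre12_eq[OF _ _ _ _ _ zero(1)]
  show ?thesis
  proof (cases "pol f v1 v2 (centre f v1 v2) = 0")
    case False
    obtain n i j k where d: "n \<ge> 1" "i \<ge> 1" "j \<ge> 1" "k \<ge> 1"
      "n * d = i + j + k * 3 + k * 3" "n * a1 = 2 * i + j + k * 3 + k * 3" "n * a2 = i + 2 * j + k * 3 + k * 3"
      using degrees_alpha[OF a] by blast
    show ?thesis
      by (rule good_stable_two[OF semi_invariants(3) semi_invariants(3) _ d z good]) (use zero False in auto)
  next
    case True
    note e = centre12_eq[OF f nz True]
    consider "pol f v1 (centre f v1 v2) (centre f v1 v2) \<noteq> 0" | "pol f v2 (centre f v1 v2) (centre f v1 v2) \<noteq> 0"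
      | "pol f (centre f v1 v2) (centre f v1 v2) (centre f v1 v2) \<noteq> 0"
      using good True by (auto simp: good_def moduli_def Let_def vec4_eq_iff vector_4)
    then show ?thesis
    proof cases
      case 1
      obtain n i j k l where d: "n \<ge> 1" "i \<ge> 1" "j \<ge> 1" "k \<ge> 1"
        "n * d = i + j + k * 5 + l * 5" "n * a1 = 2 * i + j + k * 7 + l * 3" "n * a2 = i + 2 * j + k * 2 + l * 6"
        using degrees_linear[OF a] by blast
      show ?thesis
        by (rule good_stable_two[OF semi_invariants(4,5) _ d z good])
          (use 1 nz zero in \<open>auto simp: e eqs pol_simps mem_C23_cone\<close>)
    next
      case 2
      \<comment> \<open>The previous case with the two points exchanged, so \<open>a1\<close> and
        \<open>a2\<close> as well as \<open>i\<close> and \<open>j\<close> swap roles.\<close>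
      obtain n i j k l where d: "n \<ge> 1" "i \<ge> 1" "j \<ge> 1" "k \<ge> 1"
        "n * d = i + j + k * 5 + l * 5" "n * a2 = 2 * i + j + k * 7 + l * 3" "n * a1 = i + 2 * j + k * 2 + l * 6"
        using degrees_linear[of d a2 a1] a by (auto simp: add.commute)
      then have d': "n * d = j + i + k * 5 + l * 5" "n * a1 = 2 * j + i + k * 2 + l * 6" "n * a2 = j + 2 * i + k * 7 + l * 3"
        by auto
      show ?thesis
        by (rule good_stable_two[OF semi_invariants(7,6) _ d(1,3,2,4) d' z good])
          (use 2 nz zero in \<open>auto simp: e eqs pol_simps mem_C23_cone\<close>)
    next
      case 3
      obtain n i j k l where d: "n \<ge> 1" "i \<ge> 1" "j \<ge> 1" "k \<ge> 1"
        "n * d = i + j + k * 7 + l * 7" "n * a1 = 2 * i + j + k * 9 + l * 3" "n * a2 = i + 2 * j + k * 3 + l * 9"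
        using degrees_cube[OF a] by blast
      show ?thesis
        by (rule good_stable_two[OF semi_invariants(8,9) _ d z good])
          (use 3 nz zero in \<open>auto simp: e eqs pol_simps mem_C23_cone\<close>)
    qed
  qed
qed

section \<open>Unstable points and the quotient of pointed cubics\<close>

text \<open>A regular function is a quotient of polynomials only locally. Near the point at
  parameter 0 one quotient works, and the curve stays in its domain for small \<open>t\<close>
  because a polynomial cutting out that domain is continuous along it.\<close>

lemma regular_along_curve:
  fixes \<gamma> :: "complex \<Rightarrow> 'a"
  assumes h: "h \<in> fs_regular (quasi_affine K S) S" and \<gamma>: "\<And>t. \<gamma> t \<in> S"
    and cont: "\<And>k. k \<in> K \<Longrightarrow> isCont (\<lambda>t. k (\<gamma> t)) 0"
  shows "isCont (\<lambda>t. h (\<gamma> t)) 0"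
proof -
  have pc: "isCont (\<lambda>t. p (\<gamma> t)) 0" if "p \<in> polyfuns K" for p
    using that by induction (auto intro: continuous_intros cont)
  obtain V p q where V: "openin (zariski_top K S) V" "\<gamma> 0 \<in> V"
    "p \<in> polyfuns K" "q \<in> polyfuns K" "\<forall>y \<in> V. q y \<noteq> 0 \<and> h y = p y / q y"
    using bspec[OF h[unfolded regular_quasi_affine] \<gamma>[of 0]] by (elim exE conjE)
  obtain r where r: "r \<in> polyfuns K" "r (\<gamma> 0) \<noteq> 0" "{y \<in> S. r y \<noteq> 0} \<subseteq> V"
    using bspec[OF conjunct2[OF V(1)[unfolded openin_zariski_top]] V(2)] by (elim bexE conjE)
  have "\<forall>\<^sub>F t in nhds 0. r (\<gamma> t) \<noteq> 0"
    using tendsto_at_iff_tendsto_nhds[THEN iffD1, OF pc[OF r(1), unfolded isCont_def]] r(2)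
    by (rule tendsto_imp_eventually_ne)
  then have "\<forall>\<^sub>F t in nhds 0. h (\<gamma> t) = p (\<gamma> t) / q (\<gamma> t)"
    by eventually_elim (use r(3) \<gamma> V(5) in blast)
  moreover have "isCont (\<lambda>t. p (\<gamma> t) / q (\<gamma> t)) 0"
    using pc[OF V(3)] pc[OF V(4)] V(2,5) by (intro continuous_intros) auto
  ultimately show ?thesis by (simp add: isCont_cong)
qed

lemma section_scale:
  assumes "s \<in> C23_invariant_sections (d, a1, a2) n" "(f, v1, v2) \<in> C23_cone" "c \<noteq> 0" "b1 \<noteq> 0" "b2 \<noteq> 0"
  shows "s ((\<lambda>v. c * f v), b1 *s v1, b2 *s v2) = c ^ (n * d) * b1 ^ (n * a1) * b2 ^ (n * a2) * s (f, v1, v2)"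
proof -
  have "\<forall>(f, v1, v2) \<in> C23_cone. \<forall>c b1 b2. c \<noteq> 0 \<and> b1 \<noteq> 0 \<and> b2 \<noteq> 0 \<longrightarrow>
      s ((\<lambda>v. c * f v), b1 *s v1, b2 *s v2) = c ^ (n * d) * b1 ^ (n * a1) * b2 ^ (n * a2) * s (f, v1, v2)"
    using assms(1) by (simp add: C23_invariant_sections_def C23_sections_def)
  from bspec[OF this assms(2)] show ?thesis using assms(3-5) by blast
qed

lemma plane_forms_add:
  "f \<in> plane_forms d \<Longrightarrow> h \<in> plane_forms d \<Longrightarrow> (\<lambda>v. f v + h v) \<in> plane_forms d"
  by (auto simp: plane_forms_def algebra_simps intro: polyfuns.add)

lemma plane_forms_sum:
  "(\<And>i. i \<in> I \<Longrightarrow> f i \<in> plane_forms d) \<Longrightarrow> (\<lambda>v. \<Sum>i\<in>I. f i v) \<in> plane_forms d"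
proof (induction I rule: infinite_finite_induct)
  case (insert i I) then show ?case by (simp add: plane_forms_add)
qed (auto simp: plane_forms_def intro: polyfuns.const)

text \<open>
  The easy half of the numerical criterion: the one-parameter subgroup \<open>g\<close> moves the point, up to scaling,
  along a curve that extends to \<open>t = 0\<close>, so that an invariant section of the given weight vanishes.
\<close>

lemma one_parameter_unstable:
  fixes g :: "complex \<Rightarrow> complex^3^3" and p :: "nat \<Rightarrow> complex^3 \<Rightarrow> complex"
  assumes s: "s \<in> C23_invariant_sections (d, a1, a2) n" "n \<ge> 1" and z: "(f, v1, v2) \<in> C23_cone"
    and g: "\<And>t. t \<noteq> 0 \<Longrightarrow> g t \<in> SL3" "\<And>t. t \<noteq> 0 \<Longrightarrow> g t *v v1 = t ^ m1 *s v1" "\<And>t. t \<noteq> 0 \<Longrightarrow> g t *v v2 = t ^ m2 *s v2"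
    and p: "\<And>j. p j \<in> plane_forms 3" "\<And>t u. t \<noteq> 0 \<Longrightarrow> t ^ k * act_form (g t) f u = (\<Sum>j\<le>N. t ^ j * p j u)"
    and weight: "k * d < m1 * a1 + m2 * a2"
  shows "s (f, v1, v2) = 0"
proof -
  have f: "f \<in> plane_forms 3" "f \<noteq> (\<lambda>_. 0)" "v1 \<noteq> 0" "v2 \<noteq> 0" "f v1 = 0" "f v2 = 0"
    using z by (auto simp: mem_C23_cone)
  have act_nz: "act_form (g t) f \<noteq> (\<lambda>_. 0)" if "t \<noteq> 0" for t
    using f(2) act_form_inverse[OF SL3_nz[OF g(1)[OF that]], of f] by (metis ext)
  have "\<exists>j\<le>N. p j \<noteq> (\<lambda>_. 0)"
  proof (rule ccontr)
    assume "\<not> ?thesis"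
    then have "act_form (g 1) f u = 0" for u using p(2)[of 1 u] by simp
    then show False using act_nz[of 1] by auto
  qed
  \<comment> \<open>The lowest coefficient that survives. Dividing by \<open>t ^ j0\<close> gives a
    family \<open>F\<close> whose value at \<open>t = 0\<close> is still a nonzero form, as
    membership in the cone demands.\<close>
  define j0 where "j0 = (LEAST j. p j \<noteq> (\<lambda>_. 0))"
  have j0: "p j0 \<noteq> (\<lambda>_. 0)" "j0 \<le> N" "\<And>j. j < j0 \<Longrightarrow> p j = (\<lambda>_. 0)"
  proof -
    obtain j where j: "j \<le> N" "p j \<noteq> (\<lambda>_. 0)" using \<open>\<exists>j\<le>N. p j \<noteq> (\<lambda>_. 0)\<close> by blast
    show "p j0 \<noteq> (\<lambda>_. 0)" unfolding j0_def by (rule LeastI[of "\<lambda>j. p j \<noteq> (\<lambda>_. 0)", OF j(2)])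
    show "j0 \<le> N" unfolding j0_def using Least_le[of "\<lambda>j. p j \<noteq> (\<lambda>_. 0)", OF j(2)] j(1) by simp
    show "p j = (\<lambda>_. 0)" if "j < j0" for j using not_less_Least that unfolding j0_def by blast
  qed
  define F where "F t u = (\<Sum>j=j0..N. t ^ (j - j0) * p j u)" for t u
  have tF: "t ^ j0 * F t u = t ^ k * act_form (g t) f u" if "t \<noteq> 0" for t u
  proof -
    have "t ^ j0 * F t u = (\<Sum>j=j0..N. t ^ j * p j u)"
      unfolding F_def sum_distrib_left by (intro sum.cong) (auto simp flip: power_add mult.assoc)
    also have "\<dots> = (\<Sum>j\<le>N. t ^ j * p j u)"
      by (rule sum.mono_neutral_left) (use j0(3) in auto)
    finally show ?thesis using p(2)[OF that] by simp
  qed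
  have Fc: "continuous_on UNIV (\<lambda>t. F t u)" for u
    unfolding F_def by (intro continuous_intros)
  have F_form: "F t \<in> plane_forms 3" for t
    unfolding F_def by (intro plane_forms_sum plane_forms_cmult p(1))
  have F_zero: "F t v = 0" if v: "f v = 0" "\<And>t. t \<noteq> 0 \<Longrightarrow> g t *v v = t ^ m *s v" for t v m
  proof (rule continuous_mult_id_zero[OF Fc])
    fix t :: complex
    have "act_form (g t) f v = 0" if "t \<noteq> 0"
    proof -
      have "v = g t *v ((1 / t ^ m) *s v)"
        using that v(2)[OF that] by (simp add: vector_scalar_commute vector_smult_assoc)
      then have "act_form (g t) f v = f ((1 / t ^ m) *s v)"
        by (metis act_form_inverse SL3_nz g(1) that)
      then show ?thesis using plane_form_scale[OF f(1)] v(1) by simp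
    qed
    then show "t * F t v = 0" using tF[of t v] by (cases "t = 0") auto
  qed
  have F0: "F 0 = p j0"
  proof
    fix u
    have "F 0 u = (\<Sum>j=j0..N. if j = j0 then p j u else 0)"
      unfolding F_def by (intro sum.cong) (auto simp: power_0_left)
    then show "F 0 u = p j0 u" using j0(2) by simp
  qed
  have F_nz: "F t \<noteq> (\<lambda>_. 0)" for t
  proof (cases "t = 0")
    case False
    then obtain u where "act_form (g t) f u \<noteq> 0" using act_nz by (metis ext)
    then have "F t u \<noteq> 0" using tF[OF False, of u] False by auto
    then show ?thesis by auto
  qed (use j0(1) F0 in simp)
  have cone: "(F t, v1, v2) \<in> C23_cone" for t
    unfolding mem_C23_cone using F_form F_nz f(3-6) F_zero g(2,3) by blast
  \<comment> \<open>The total exponent of \<open>t\<close> collected by homogeneity. The weight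
    inequality makes it positive, so the constant \<open>s (f, v1, v2)\<close> equals
    \<open>t ^ E\<close> times a function continuous at 0 and must vanish.\<close>
  define E where "E = j0 * (n * d) + m1 * (n * a1) + m2 * (n * a2) - k * (n * d)"
  have "k * (n * d) < m1 * (n * a1) + m2 * (n * a2)"
  proof -
    have "n * (k * d) < n * (m1 * a1 + m2 * a2)" using weight s(2) by simp
    then show ?thesis by (simp add: algebra_simps)
  qed
  then have E: "j0 * (n * d) + m1 * (n * a1) + m2 * (n * a2) = k * (n * d) + E" "E > 0"
    unfolding E_def by auto
  define h where "h t = s (F t, v1, v2)" for t
  have sz: "s (f, v1, v2) = t ^ E * h t" if t: "t \<noteq> 0" for t
  proof -
    have inv: "s (C23_act_vec (g t) (f, v1, v2)) = s (f, v1, v2)"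
      using s(1) g(1)[OF t] z by (simp add: C23_invariant_sections_def)
    have act: "C23_act_vec (g t) (f, v1, v2) = ((\<lambda>v. (t ^ j0 / t ^ k) * F t v), t ^ m1 *s v1, t ^ m2 *s v2)"
      using tF[OF t] t by (simp add: C23_act_vec_def g fun_eq_iff field_simps)
    have hom: "s ((\<lambda>v. (t ^ j0 / t ^ k) * F t v), t ^ m1 *s v1, t ^ m2 *s v2) =
        (t ^ j0 / t ^ k) ^ (n * d) * (t ^ m1) ^ (n * a1) * (t ^ m2) ^ (n * a2) * s (F t, v1, v2)"
      by (rule section_scale[OF s(1) cone]) (use t in simp_all)
    have "t ^ (k * (n * d)) * s (f, v1, v2) = t ^ (j0 * (n * d) + m1 * (n * a1) + m2 * (n * a2)) * h t"
      using inv[unfolded act hom] t unfolding h_def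
      by (simp add: power_divide power_add power_mult[symmetric] field_simps)
    then show ?thesis unfolding E(1) power_add using t by simp
  qed
  have "isCont h 0"
    unfolding h_def
  proof (rule regular_along_curve[of s C23_coords C23_cone "\<lambda>t. (F t, v1, v2)"])
    show "s \<in> fs_regular (quasi_affine C23_coords C23_cone) C23_cone"
      using s(1) by (simp add: C23_invariant_sections_def C23_sections_def)
    fix k' assume "k' \<in> C23_coords"
    then show "isCont (\<lambda>t. k' (F t, v1, v2)) 0"
      using Fc by (elim C23_coords_cases) (auto simp: continuous_on_eq_continuous_at)
  qed (rule cone)
  then have "((\<lambda>t. t ^ E * h t) \<longlongrightarrow> 0 ^ E * h 0) (at 0)"
    by (intro tendsto_intros) (simp_all add: isCont_def)
  moreover have "((\<lambda>t. t ^ E * h t) \<longlongrightarrow> s (f, v1, v2)) (at 0)"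
    by (rule tendsto_eventually) (auto simp: eventually_at_filter sz)
  ultimately show ?thesis using E(2) tendsto_unique[of "at (0::complex)"] by fastforce
qed

section \<open>Explicit destabilizing subgroups\<close>

definition diag :: "complex \<Rightarrow> complex \<Rightarrow> complex \<Rightarrow> complex^3^3" where
  "diag a b c = cols (a *s axis 1 1) (b *s axis 2 1) (c *s axis 3 1)"

lemma diag_SL3: "a * b * c = 1 \<Longrightarrow> diag a b c \<in> SL3"
  by (simp add: SL3_def diag_def det_cols det3_expand axis3 vector_3 mult.assoc[symmetric])

lemma diag_axis: "diag a b c *v axis 1 1 = a *s axis 1 1" "diag a b c *v axis 2 1 = b *s axis 2 1"
  by (simp_all add: diag_def cols_mult axis3 vector_3)

lemma act_form_diag:
  assumes "a * b * c = 1"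
  shows "act_form (diag a b c) f u = f ((u $ 1 / a) *s axis 1 1 + (u $ 2 / b) *s axis 2 1 + (u $ 3 / c) *s axis 3 1)"
proof -
  have "a \<noteq> 0" "b \<noteq> 0" "c \<noteq> 0" using assms by auto
  then have "u = diag a b c *v ((u $ 1 / a) *s axis 1 1 + (u $ 2 / b) *s axis 2 1 + (u $ 3 / c) *s axis 3 1)"
    by (simp add: diag_def cols_mult axis3 vector_3 vec_eq_iff forall_3)
  then show ?thesis by (metis act_form_inverse SL3_nz diag_SL3[OF assms])
qed

lemma coord_form:
  assumes "\<And>v c. p (c *s v) = c ^ 3 * p v" "p \<in> polyfuns {\<lambda>v::complex^3. v $ i | i. True}"
  shows "p \<in> plane_forms 3"
  using assms by (simp add: plane_forms_def)

lemma coord_polyfuns: "(\<lambda>v::complex^'n. v $ i) \<in> polyfuns {\<lambda>v. v $ i | i. True}"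
  by (rule polyfuns.coord) blast

text \<open>Under \<open>diag t 1 (1 / t)\<close> the monomial \<open>x^p y^q z^r\<close> receives
  the factor \<open>t^(r - p)\<close>. With \<open>x^3\<close> and, by the vanishing of
  \<open>invA\<close>, also \<open>x^2 y\<close> absent, no exponent is below -1. The first point
  has weight 1 and the second weight 0, so the criterion reads \<open>d < a1\<close>.\<close>

lemma unstable_A:
  assumes s: "s \<in> C23_invariant_sections (d, a1, a2) n" "n \<ge> 1" and z: "(f, axis 1 1, axis 2 1) \<in> C23_cone"
    and a: "a1 > d" and A: "invA f (axis 1 1) (axis 2 1) = 0"
  shows "s (f, axis 1 1, axis 2 1) = 0"
proof -
  define c where "c i j k = pol f (axis i 1) (axis j 1) (axis k 1)" for i j k :: 3
  have f: "f \<in> plane_forms 3" "f (axis 1 1) = 0" "f (axis 2 1) = 0" using z by (auto simp: mem_C23_cone)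
  define p :: "nat \<Rightarrow> complex^3 \<Rightarrow> complex" where "p j u =
    of_bool (j = 0) * (3 * c 1 1 3 * u $ 1 ^ 2 * u $ 3 + 3 * c 1 2 2 * u $ 1 * u $ 2 ^ 2)
    + of_bool (j = 1) * (6 * c 1 2 3 * u $ 1 * u $ 2 * u $ 3)
    + of_bool (j = 2) * (3 * c 1 3 3 * u $ 1 * u $ 3 ^ 2 + 3 * c 2 2 3 * u $ 2 ^ 2 * u $ 3)
    + of_bool (j = 3) * (3 * c 2 3 3 * u $ 2 * u $ 3 ^ 2) + of_bool (j = 4) * (f (axis 3 1) * u $ 3 ^ 3)" for j u
  show ?thesis
  proof (rule one_parameter_unstable[where g = "\<lambda>t. diag t 1 (1 / t)" and k = 1 and ?m1.0 = 1 and ?m2.0 = 0 and p = p and N = 4, OF s z])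
    show "p j \<in> plane_forms 3" for j
      by (rule coord_form, simp add: p_def algebra_simps power2_eq_square power3_eq_cube)
        (unfold p_def, intro polyfuns_intros coord_polyfuns)
    fix t :: complex and u assume t: "t \<noteq> 0"
    then have e: "t * 1 * (1 / t) = 1" by simp
    show "t ^ 1 * act_form (diag t 1 (1 / t)) f u = (\<Sum>j\<le>4. t ^ j * p j u)"
      using t A f(2,3) unfolding act_form_diag[OF e] cubic_expand[OF f(1)]
      by (simp add: invA_def c_def[symmetric] p_def field_simps eval_nat_numeral)
  qed (use a in \<open>auto simp: diag_SL3 diag_axis\<close>)
qed

lemma unstable_B:
  assumes s: "s \<in> C23_invariant_sections (d, a1, a2) n" "n \<ge> 1" and z: "(f, axis 1 1, axis 2 1) \<in> C23_cone"
    and a: "a2 > d" and B: "invB f (axis 1 1) (axis 2 1) = 0"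
  shows "s (f, axis 1 1, axis 2 1) = 0"
proof -
  define c where "c i j k = pol f (axis i 1) (axis j 1) (axis k 1)" for i j k :: 3
  have f: "f \<in> plane_forms 3" "f (axis 1 1) = 0" "f (axis 2 1) = 0" using z by (auto simp: mem_C23_cone)
  define p :: "nat \<Rightarrow> complex^3 \<Rightarrow> complex" where "p j u =
    of_bool (j = 0) * (3 * c 2 2 3 * u $ 2 ^ 2 * u $ 3 + 3 * c 1 1 2 * u $ 1 ^ 2 * u $ 2)
    + of_bool (j = 1) * (6 * c 1 2 3 * u $ 1 * u $ 2 * u $ 3)
    + of_bool (j = 2) * (3 * c 2 3 3 * u $ 2 * u $ 3 ^ 2 + 3 * c 1 1 3 * u $ 1 ^ 2 * u $ 3)
    + of_bool (j = 3) * (3 * c 1 3 3 * u $ 1 * u $ 3 ^ 2) + of_bool (j = 4) * (f (axis 3 1) * u $ 3 ^ 3)" for j u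
  show ?thesis
  proof (rule one_parameter_unstable[where g = "\<lambda>t. diag 1 t (1 / t)" and k = 1 and ?m1.0 = 0 and ?m2.0 = 1 and p = p and N = 4, OF s z])
    show "p j \<in> plane_forms 3" for j
      by (rule coord_form, simp add: p_def algebra_simps power2_eq_square power3_eq_cube)
        (unfold p_def, intro polyfuns_intros coord_polyfuns)
    fix t :: complex and u assume t: "t \<noteq> 0"
    then have e: "1 * t * (1 / t) = 1" by simp
    show "t ^ 1 * act_form (diag 1 t (1 / t)) f u = (\<Sum>j\<le>4. t ^ j * p j u)"
      using t B f(2,3) unfolding act_form_diag[OF e] cubic_expand[OF f(1)]
      by (simp add: invB_def c_def[symmetric] p_def field_simps eval_nat_numeral)
  qed (use a in \<open>auto simp: diag_SL3 diag_axis\<close>)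
qed

text \<open>The subgroup \<open>diag (t^2) (1 / t) (1 / t)\<close> singles out the common point. As
  \<open>x^3\<close> is absent, no exponent is below -3, and both points have weight 2; the
  criterion is \<open>3 d < 2 (a1 + a2)\<close>, which follows from
  \<open>a1, a2 > d\<close>.\<close>

lemma unstable_coincident:
  assumes s: "s \<in> C23_invariant_sections (d, a1, a2) n" "n \<ge> 1" and z: "(f, axis 1 1, b *s axis 1 1) \<in> C23_cone"
    and a: "a1 > d" "a2 > d"
  shows "s (f, axis 1 1, b *s axis 1 1) = 0"
proof -
  define c where "c i j k = pol f (axis i 1) (axis j 1) (axis k 1)" for i j k :: 3
  have f: "f \<in> plane_forms 3" "f (axis 1 1) = 0" using z by (auto simp: mem_C23_cone)
  define p :: "nat \<Rightarrow> complex^3 \<Rightarrow> complex" where "p j u =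
    of_bool (j = 0) * (3 * c 1 1 2 * u $ 1 ^ 2 * u $ 2 + 3 * c 1 1 3 * u $ 1 ^ 2 * u $ 3)
    + of_bool (j = 3) * (3 * c 1 2 2 * u $ 1 * u $ 2 ^ 2 + 6 * c 1 2 3 * u $ 1 * u $ 2 * u $ 3 + 3 * c 1 3 3 * u $ 1 * u $ 3 ^ 2)
    + of_bool (j = 6) * (f (axis 2 1) * u $ 2 ^ 3 + f (axis 3 1) * u $ 3 ^ 3
      + 3 * c 2 2 3 * u $ 2 ^ 2 * u $ 3 + 3 * c 2 3 3 * u $ 2 * u $ 3 ^ 2)" for j u
  show ?thesis
  proof (rule one_parameter_unstable[where g = "\<lambda>t. diag (t^2) (1 / t) (1 / t)" and k = 3 and ?m1.0 = 2 and ?m2.0 = 2 and p = p and N = 6, OF s z])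
    show "p j \<in> plane_forms 3" for j
      by (rule coord_form, simp add: p_def algebra_simps power2_eq_square power3_eq_cube)
        (unfold p_def, intro polyfuns_intros coord_polyfuns)
    fix t :: complex and u assume t: "t \<noteq> 0"
    then have e: "t^2 * (1 / t) * (1 / t) = 1" by (simp add: field_simps power2_eq_square)
    show "t ^ 3 * act_form (diag (t^2) (1 / t) (1 / t)) f u = (\<Sum>j\<le>6. t ^ j * p j u)"
      using t f(2) unfolding act_form_diag[OF e] cubic_expand[OF f(1)]
      by (simp add: c_def[symmetric] p_def field_simps eval_nat_numeral)
  qed (use a in \<open>auto simp: diag_SL3 diag_axis vector_scalar_commute vector_smult_assoc mult_ac power2_eq_square\<close>)
qed

text \<open>\<open>slice 0\<close> consists of three concurrent lines and is preserved, up to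
  scaling, by the torus of all \<open>diag c c (1 / c^2)\<close>. The single element with
  \<open>c = 1 / 2\<close> already multiplies the section by a power of 2 with exponent
  \<open>n (3 d - a1 - a2) > 0\<close>, so the value is zero.\<close>

lemma unstable_concurrent:
  assumes s: "s \<in> C23_invariant_sections (d, a1, a2) n" "n \<ge> 1" and a: "a1 + a2 < 3 * d"
  shows "s (slice 0, axis 1 1, axis 2 1) = 0"
proof -
  let ?g = "diag (1 / 2) (1 / 2) 4"
  have inv: "s (C23_act_vec ?g (slice 0, axis 1 1, axis 2 1)) = s (slice 0, axis 1 1, axis 2 1)"
    using s(1) slice_C23_cone[of 0] diag_SL3[of "1/2" "1/2" 4] by (simp add: C23_invariant_sections_def)
  have act: "C23_act_vec ?g (slice 0, axis 1 1, axis 2 1) = ((\<lambda>v. 8 * slice 0 v), (1/2) *s axis 1 1, (1/2) *s axis 2 1)"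
    by (simp add: C23_act_vec_def diag_axis fun_eq_iff act_form_diag) (simp add: slice_def axis3 vector_3 algebra_simps)
  have "s ((\<lambda>v. 8 * slice 0 v), (1/2) *s axis 1 1, (1/2) *s axis 2 1) =
      8 ^ (n * d) * (1/2) ^ (n * a1) * (1/2) ^ (n * a2) * s (slice 0, axis 1 1, axis 2 1)"
    by (rule section_scale[OF s(1) slice_C23_cone]) simp_all
  then have e: "s (slice 0, axis 1 1, axis 2 1) * 2 ^ (n * a1 + n * a2) = 2 ^ (3 * (n * d)) * s (slice 0, axis 1 1, axis 2 1)"
  proof -
    have "(8::complex) ^ (n * d) = 2 ^ (3 * (n * d))" by (simp add: power_mult)
    then show ?thesis
      using \<open>s ((\<lambda>v. 8 * slice 0 v), _, _) = _\<close> unfolding inv[unfolded act]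
      by (simp add: power_add field_simps power_one_over)
  qed
  have "n * (a1 + a2) < n * (3 * d)" using a s(2) by simp
  then have "n * a1 + n * a2 < 3 * (n * d)" by (simp add: algebra_simps)
  then have "(2::real) ^ (n * a1 + n * a2) < 2 ^ (3 * (n * d))" by simp
  then have "(2::complex) ^ (n * a1 + n * a2) \<noteq> 2 ^ (3 * (n * d))"
    by (metis less_irrefl norm_numeral norm_power)
  then show ?thesis using e by simp
qed

lemma frame_cases:
  assumes "v1 \<noteq> 0"
  obtains w where "det3 v1 v2 w = 1" | u w c where "v2 = c *s v1" "det3 v1 u w = 1"
proof (cases "\<exists>w. det3 v1 v2 w \<noteq> 0")
  case True
  then obtain w where "det3 v1 v2 w \<noteq> 0" by blast
  then have "det3 v1 v2 ((1 / det3 v1 v2 w) *s w) = 1" using clin_scale[OF clin_det3] by simp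
  then show ?thesis using that(1) by blast
next
  case False
  then have "det3 v1 v2 (axis i 1) = 0" for i by blast
  from this[of 1] this[of 2] this[of 3]
  have e: "v1 $ 2 * v2 $ 3 = v1 $ 3 * v2 $ 2" "v1 $ 1 * v2 $ 3 = v1 $ 3 * v2 $ 1" "v1 $ 1 * v2 $ 2 = v1 $ 2 * v2 $ 1"
    by (simp_all add: det3_expand axis3 vector_3)
  consider "v1 $ 1 \<noteq> 0" | "v1 $ 2 \<noteq> 0" | "v1 $ 3 \<noteq> 0" using assms by (auto simp: vec_eq_iff forall_3)
  then show ?thesis
  proof cases
    case 1
    then show ?thesis using e
      by (intro that(2)[of "v2 $ 1 / v1 $ 1" "axis 2 1" "(1 / v1 $ 1) *s axis 3 1"])
        (auto simp: vec_eq_iff forall_3 det3_expand axis3 vector_3 field_simps)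
  next
    case 2
    then show ?thesis using e
      by (intro that(2)[of "v2 $ 2 / v1 $ 2" "axis 3 1" "(1 / v1 $ 2) *s axis 1 1"])
        (auto simp: vec_eq_iff forall_3 det3_expand axis3 vector_3 field_simps)
  next
    case 3
    then show ?thesis using e
      by (intro that(2)[of "v2 $ 3 / v1 $ 3" "axis 1 1" "(1 / v1 $ 3) *s axis 2 1"])
        (auto simp: vec_eq_iff forall_3 det3_expand axis3 vector_3 field_simps)
  qed
qed

text \<open>Equivariance moves the points to coordinate points, where the explicit subgroups apply.
  The argument starts from one nonvanishing invariant section, so together with
  \<open>good_imp_stable\<close> it shows that semistable and stable points agree in the
  chamber.\<close>

lemma nonvanishing_imp_good:
  assumes a: "a1 > d" "a2 > d" "a1 + a2 < 3 * d"
    and s: "s \<in> C23_invariant_sections (d, a1, a2) n" "n \<ge> 1"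
    and z: "(f, v1, v2) \<in> C23_cone" and sz: "s (f, v1, v2) \<noteq> 0"
  shows "good f v1 v2"
proof -
  have f: "f \<in> plane_forms 3" "v1 \<noteq> 0" using z by (auto simp: mem_C23_cone)
  have inv: "s (act_form g f, g *v v1, g *v v2) = s (f, v1, v2)" if "g \<in> SL3" for g
    using s(1) z that by (auto simp: C23_invariant_sections_def C23_act_vec_def)
  obtain w where w: "det3 v1 v2 w = 1"
  proof (rule frame_cases[OF f(2), of v2])
    fix u w c assume c: "v2 = c *s v1" "det3 v1 u w = 1"
    then have G: "cols v1 u w \<in> SL3" by (simp add: SL3_def det_cols)
    obtain g where g: "g \<in> SL3" "g ** cols v1 u w = mat 1" using SL3_inverse[OF G] .
    have "g *v (cols v1 u w *v axis 1 1) = axis 1 1" using g(2) by (simp add: matrix_vector_mul_assoc)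
    then have gv: "g *v v1 = axis 1 1" "g *v v2 = c *s axis 1 1"
      by (simp_all add: cols_mult axis3 vector_3 c(1) vector_scalar_commute)
    then have "s (act_form g f, axis 1 1, c *s axis 1 1) = 0"
      using unstable_coincident[OF s _ a(1,2)] C23_act_vec_cone[OF g(1) z] by simp
    then show thesis using inv[OF g(1)] gv sz by simp
  qed
  then have G: "cols v1 v2 w \<in> SL3" by (simp add: SL3_def det_cols)
  obtain g where g: "g \<in> SL3" "g ** cols v1 v2 w = mat 1" using SL3_inverse[OF G] .
  have "g *v (cols v1 v2 w *v axis i 1) = axis i 1" for i using g(2) by (simp add: matrix_vector_mul_assoc)
  from this[of 1] this[of 2] have gv: "g *v v1 = axis 1 1" "g *v v2 = axis 2 1"
    by (simp_all add: cols_mult axis3 vector_3)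
  have gz: "(act_form g f, axis 1 1, axis 2 1) \<in> C23_cone" "s (act_form g f, axis 1 1, axis 2 1) \<noteq> 0"
    using C23_act_vec_cone[OF g(1) z] inv[OF g(1)] sz gv by simp_all
  have "invA f v1 v2 \<noteq> 0"
    using unstable_A[OF s gz(1) a(1)] gz(2) invA_act[OF g(1) f(1), of v1 v2] gv by auto
  moreover have "invB f v1 v2 \<noteq> 0"
    using unstable_B[OF s gz(1) a(2)] gz(2) invB_act[OF g(1) f(1), of v1 v2] gv by auto
  moreover have "moduli f v1 v2 \<noteq> 0"
  proof
    assume 0: "moduli f v1 v2 = 0"
    obtain h where h: "h \<in> SL3" "C23_act h (C23_proj (f, v1, v2)) = C23_proj (slice 0, axis 1 1, axis 2 1)"
      using C23_orbit_slice[OF z \<open>invA f v1 v2 \<noteq> 0\<close> \<open>invB f v1 v2 \<noteq> 0\<close>] unfolding 0 by blast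
    then obtain c b1 b2 where c: "c \<noteq> 0" "b1 \<noteq> 0" "b2 \<noteq> 0" "act_form h f = (\<lambda>v. c * slice 0 v)"
      "h *v v1 = b1 *s axis 1 1" "h *v v2 = b2 *s axis 2 1"
      unfolding C23_act_proj C23_proj_eq_iff by blast
    have "s (act_form h f, h *v v1, h *v v2) = 0"
      unfolding c(4-6) section_scale[OF s(1) slice_C23_cone c(1-3)] using unstable_concurrent[OF s a(3)] by simp
    then show False using inv[OF h(1)] sz by simp
  qed
  ultimately show ?thesis by (simp add: good_def)
qed

section \<open>The stable locus in the chamber and its quotient\<close>

lemma stable_eq_good:
  assumes a: "a1 > d" "a2 > d" "a1 + a2 < 3 * d"
  shows "C23_stable (d, a1, a2) = C23_proj ` good_cone"
proof
  show "C23_stable (d, a1, a2) \<subseteq> C23_proj ` good_cone"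
  proof
    fix x assume "x \<in> C23_stable (d, a1, a2)"
    then obtain n s where s: "n \<ge> 1" "s \<in> C23_invariant_sections (d, a1, a2) n" "x \<in> C23_nonvanishing s"
      by (auto simp: C23_stable_def)
    then obtain f v1 v2 where z: "(f, v1, v2) \<in> C23_cone" "s (f, v1, v2) \<noteq> 0" "x = C23_proj (f, v1, v2)"
      by (auto simp: C23_nonvanishing_def)
    then have "(f, v1, v2) \<in> good_cone"
      using nonvanishing_imp_good[OF a s(2,1)] by (simp add: good_cone_def)
    then show "x \<in> C23_proj ` good_cone" using z(3) by blast
  qed
  show "C23_proj ` good_cone \<subseteq> C23_stable (d, a1, a2)"
    using good_imp_stable[OF a] by (auto simp: good_cone_def)
qed

lemma good_cone_open: "openin (zariski_top C23_coords C23_cone) good_cone"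
  unfolding openin_zariski_top
proof (intro conjI ballI)
  fix z assume "z \<in> good_cone"
  then have z: "z \<in> C23_cone" "lift3 invA z \<noteq> 0" "lift3 invB z \<noteq> 0" "lift3 moduli z \<noteq> 0"
    by (auto simp: good_cone_def good_def)
  then obtain i where i: "lift3 moduli z $ i \<noteq> 0" by (metis vec_eq_iff zero_index)
  have "(\<lambda>z. lift3 invA z * lift3 invB z * lift3 moduli z $ i) \<in> polyfuns C23_coords"
    by (intro polyfuns_intros polyfuns_invA polyfuns_invB polyfuns_moduli C23_coords_polyfuns)
  then show "\<exists>p\<in>polyfuns C23_coords. p z \<noteq> 0 \<and> {y \<in> C23_cone. p y \<noteq> 0} \<subseteq> good_cone"
    by (rule rev_bexI) (use z i in \<open>auto simp: good_cone_def good_def\<close>)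
qed (auto simp: good_cone_def)

lemma C23_quotient_weighted:
  assumes a: "a1 > d" "a2 > d" "a1 + a2 < 3 * d"
  shows "\<exists>\<phi>. fs_isomorphism (C23_quotient (d, a1, a2)) (weighted_proj_space wt) \<phi>"
proof -
  have pre: "{z \<in> C23_cone. C23_proj z \<in> C23_proj ` good_cone} = good_cone"
    using proj_mem_good_iff by (auto simp: good_cone_def)
  have "C23_proj ` good_cone \<subseteq> C23_proj ` C23_cone" by (auto simp: good_cone_def)
  from presented_double_quotient[OF this, of C23_coords C23_orbit, unfolded pre, OF good_cone_open]
  have X: "presented (C23_quotient (d, a1, a2)) C23_coords C23_cone good_cone (\<lambda>z. C23_orbit (C23_proj z))"
    unfolding C23_quotient_def stable_eq_good[OF a] C23_def .
  show ?thesis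
  proof (rule presented_isomorphism[OF X presented_weighted_proj_space,
        where \<mu> = "lift3 moduli" and \<sigma> = "\<lambda>x. (slice x, axis 1 1, axis 2 1)"])
    show "lift3 moduli z \<in> {x. x \<noteq> 0}" if "z \<in> good_cone" for z
      using that by (auto simp: good_cone_def good_def)
    show "(\<lambda>z. k (lift3 moduli z)) \<in> polyfuns C23_coords" if "k \<in> {\<lambda>x. x $ i | i. True}" for k
      using that by (auto intro!: polyfuns_moduli C23_coords_polyfuns)
    show "(slice x, axis 1 1, axis 2 1) \<in> good_cone" if "x \<in> {x. x \<noteq> 0}" for x
      using that slice_C23_cone good_slice by (auto simp: good_cone_def)
    show "(\<lambda>x. k (slice x, axis 1 1, axis 2 1)) \<in> polyfuns {\<lambda>x. x $ i | i. True}" if "k \<in> C23_coords" for k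
      using that by (elim C23_coords_cases; simp only: fst_conv snd_conv; intro polyfuns_slice polyfuns.const)
    show "weighted_class wt (lift3 moduli z) = weighted_class wt (lift3 moduli z')"
      if "z \<in> good_cone" "z' \<in> good_cone" "C23_orbit (C23_proj z) = C23_orbit (C23_proj z')" for z z'
      using that good_orbit_eq_iff by (cases z; cases z') (auto simp: good_cone_def)
    show "C23_orbit (C23_proj (slice x, axis 1 1, axis 2 1)) = C23_orbit (C23_proj (slice x', axis 1 1, axis 2 1))"
      if "weighted_class wt x = weighted_class wt x'" for x x'
      using that C23_orbit_slice_wact by (auto simp: weighted_class_eq_iff)
    show "weighted_class wt (lift3 moduli (slice x, axis 1 1, axis 2 1)) = weighted_class wt x" for x
      by (simp add: moduli_slice weighted_class_eq_iff) (intro exI[of _ "- 1 / 9"], simp)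
    show "C23_orbit (C23_proj (slice (lift3 moduli z), axis 1 1, axis 2 1)) = C23_orbit (C23_proj z)"
      if z: "z \<in> good_cone" for z
    proof -
      obtain f v1 v2 where e: "z = (f, v1, v2)" by (metis prod_cases3)
      have "(f, v1, v2) \<in> C23_cone" "invA f v1 v2 \<noteq> 0" "invB f v1 v2 \<noteq> 0"
        using z by (auto simp: e good_cone_def good_def)
      then obtain g where "g \<in> SL3"
        "C23_act g (C23_proj (f, v1, v2)) = C23_proj (slice (moduli f v1 v2), axis 1 1, axis 2 1)"
        by (rule C23_orbit_slice)
      then show ?thesis using C23_orbit_act[of g "C23_proj z"] by (simp add: e)
    qed
  qed
qed

section \<open>Singularities of type \<open>A\<^sub>k\<close> on cubics\<close>

lemma dir_deriv_cubic:
  assumes "f \<in> plane_forms 3" shows "dir_deriv f v u = 3 * pol f v v u"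
proof -
  have "(\<lambda>t. f (v + t *s u)) = (\<lambda>t. f v + t * (3 * pol f v v u) + t^2 * (3 * pol f v u u) + t^3 * f u)"
    using cubic_expand[OF assms, of 1 v _ u 0 0] by (simp add: fun_eq_iff algebra_simps)
  moreover have "((\<lambda>t. f v + t * (3 * pol f v v u) + t^2 * (3 * pol f v u u) + t^3 * f u)
      has_field_derivative 3 * pol f v v u) (at 0)"
    by (auto intro!: derivative_eq_intros)
  ultimately show ?thesis unfolding dir_deriv_def by (simp add: DERIV_imp_deriv)
qed

text \<open>Along the direction that the Jacobian of \<phi> maps to \<open>(1, 0)\<close>, the
  normal form is \<open>t^2\<close> to leading order, whereas the restriction of \<open>f\<close> to
  a line through a triple point is a constant times \<open>t^3\<close>.\<close>

lemma triple_point_not_A: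
  assumes f: "f \<in> plane_forms 3" and triple: "\<And>x y. pol f v x y = 0"
  shows "\<not> A_sing k f v"
proof
  assume "A_sing k f v"
  then obtain e1 e2 \<phi> U where k: "k \<ge> 1" and U: "(0, 0) \<in> U" "local_biholo \<phi> U" "\<phi> (0, 0) = (0, 0)"
    and eq: "\<forall>(x, y) \<in> U. f (v + x *s e1 + y *s e2) = (fst (\<phi> (x, y)))^2 + (snd (\<phi> (x, y)))^(k + 1)"
    unfolding A_sing_def by blast
  obtain a b c d where J: "a * d - b * c \<noteq> 0"
    "(\<phi> has_derivative (\<lambda>(h, k). (a * h + b * k, c * h + d * k))) (at (0, 0))"
    using U(1,2) unfolding local_biholo_def by blast
  define D where "D = a * d - b * c"
  \<comment> \<open>Cramer's rule for the vector that the Jacobian sends to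
    \<open>(1, 0)\<close>.\<close>
  define h k' where "h = d / D" and "k' = - c / D"
  have D: "a * h + b * k' = 1" "c * h + d * k' = 0"
  proof -
    have "a * h + b * k' = (a * d - b * c) / D" by (simp add: h_def k'_def diff_divide_distrib)
    then show "a * h + b * k' = 1" using J(1) by (simp add: D_def)
    show "c * h + d * k' = 0" by (simp add: h_def k'_def)
  qed
  define p q where "p t = fst (\<phi> (t * h, t * k'))" and "q t = snd (\<phi> (t * h, t * k'))" for t
  have line: "((\<lambda>t::complex. (t * h, t * k')) has_derivative (\<lambda>t. (t * h, t * k'))) (at 0)"
    by (auto intro!: derivative_eq_intros)
  have "((\<lambda>t. \<phi> (t * h, t * k')) has_derivative
      (\<lambda>t. (\<lambda>(h, k). (a * h + b * k, c * h + d * k)) (t * h, t * k'))) (at 0)"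
    by (rule has_derivative_compose[OF line]) (use J(2) in simp)
  then have "((\<lambda>t. \<phi> (t * h, t * k')) has_derivative (\<lambda>t. (t * (a * h + b * k'), t * (c * h + d * k')))) (at 0)"
    by (simp add: algebra_simps)
  then have line': "((\<lambda>t. \<phi> (t * h, t * k')) has_derivative (\<lambda>t. (t, 0))) (at 0)"
    by (simp add: D)
  have p': "(p has_field_derivative 1) (at 0)" and q': "(q has_field_derivative 0) (at 0)"
  proof -
    have m: "(*) (1::complex) = (\<lambda>x. x)" "(*) (0::complex) = (\<lambda>x. 0)" by auto
    show "(p has_field_derivative 1) (at 0)" "(q has_field_derivative 0) (at 0)"
      using has_derivative_fst[OF line'] has_derivative_snd[OF line']
      unfolding p_def q_def has_field_derivative_def m by simp_all
  qed
  have pq0: "p 0 = 0" "q 0 = 0" by (simp_all add: p_def q_def U(3))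
  have pl: "((\<lambda>t. p t / t) \<longlongrightarrow> 1) (at 0)" and ql: "((\<lambda>t. q t / t) \<longlongrightarrow> 0) (at 0)"
    using p' q' by (simp_all add: has_field_derivative_iff pq0)
  have "isCont q 0" using q' by (rule DERIV_isCont)
  then have qc: "(q \<longlongrightarrow> 0) (at 0)" by (simp add: isCont_def pq0)
  have "open U" using U(2) by (simp add: local_biholo_def)
  have "((\<lambda>t::complex. (t * h, t * k')) \<longlongrightarrow> (0 * h, 0 * k')) (at 0)"
    by (intro tendsto_intros)
  then have ev: "\<forall>\<^sub>F t in at 0. (t * h, t * k') \<in> U"
    using topological_tendstoD[OF _ \<open>open U\<close>] U(1) by fastforce
  define C where "C = f (h *s e1 + k' *s e2)"
  have ft: "f (v + (t * h) *s e1 + (t * k') *s e2) = t^3 * C" for t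
  proof -
    have "v + (t * h) *s e1 + (t * k') *s e2 = 1 *s v + t *s (h *s e1 + k' *s e2) + 0 *s v"
      by (simp add: vec_eq_iff algebra_simps)
    then show ?thesis
      unfolding C_def by (simp only: cubic_expand[OF f] triple pol_diag[OF f, of v]) simp
  qed
  have "\<forall>\<^sub>F t in at 0. t * C = (p t / t)^2 + (q t / t)^2 * q t ^ (k - 1)"
    using ev eventually_neq_at_within[of 0]
  proof eventually_elim
    case (elim t)
    have kk: "q t ^ (k + 1) = q t ^ 2 * q t ^ (k - 1)"
      using k by (simp add: power_add[symmetric])
    have "t^3 * C = p t ^ 2 + q t ^ 2 * q t ^ (k - 1)"
      using bspec[OF eq elim(1)] ft[of t] unfolding kk[symmetric] by (simp add: p_def q_def)
    then show ?case using elim(2) by (simp add: field_simps power2_eq_square power3_eq_cube)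
  qed
  moreover have "((\<lambda>t. t * C) \<longlongrightarrow> 0 * C) (at 0)" by (intro tendsto_intros)
  ultimately have "((\<lambda>t. (p t / t)^2 + (q t / t)^2 * q t ^ (k - 1)) \<longlongrightarrow> 0) (at 0)"
    by (simp add: filterlim_cong)
  \<comment> \<open>For \<open>k = 1\<close> the last factor of the limit is
    \<open>0 ^ 0 = 1\<close>; the factor \<open>0^2\<close> still makes that term vanish.\<close>
  moreover have "((\<lambda>t. (p t / t)^2 + (q t / t)^2 * q t ^ (k - 1)) \<longlongrightarrow> 1^2 + 0^2 * 0 ^ (k - 1)) (at 0)"
    by (intro tendsto_intros pl ql qc)
  ultimately show False using tendsto_unique[of "at (0::complex)"] by fastforce
qed

text \<open>The partial derivatives are carried along explicitly and required to be continuous, so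
  that a Jacobian that is nonzero at the origin stays nonzero nearby.\<close>

definition holo2 :: "(complex \<times> complex) set \<Rightarrow> (complex \<times> complex \<Rightarrow> complex) \<Rightarrow>
    (complex \<times> complex \<Rightarrow> complex) \<Rightarrow> (complex \<times> complex \<Rightarrow> complex) \<Rightarrow> bool" where
  "holo2 V \<psi> a b \<longleftrightarrow> continuous_on V a \<and> continuous_on V b \<and>
     (\<forall>z\<in>V. (\<psi> has_derivative (\<lambda>(h, k). a z * h + b z * k)) (at z))"

lemma holo2_continuous: "holo2 V \<psi> a b \<Longrightarrow> continuous_on V \<psi>"
  unfolding holo2_def
  by (meson continuous_at_imp_continuous_on has_derivative_continuous)

lemma holo2_subset: "holo2 V \<psi> a b \<Longrightarrow> W \<subseteq> V \<Longrightarrow> holo2 W \<psi> a b"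
  unfolding holo2_def by (meson continuous_on_subset subset_iff)

lemma holo2_const: "holo2 V (\<lambda>_. c) (\<lambda>_. 0) (\<lambda>_. 0)"
  by (simp add: holo2_def case_prod_unfold)

lemma holo2_fst: "holo2 V fst (\<lambda>_. 1) (\<lambda>_. 0)"
  by (auto simp: holo2_def case_prod_unfold intro!: derivative_eq_intros)

lemma holo2_snd: "holo2 V snd (\<lambda>_. 0) (\<lambda>_. 1)"
  by (auto simp: holo2_def case_prod_unfold intro!: derivative_eq_intros)

lemma holo2_add:
  assumes "holo2 V \<psi> a b" "holo2 V \<psi>' a' b'"
  shows "holo2 V (\<lambda>z. \<psi> z + \<psi>' z) (\<lambda>z. a z + a' z) (\<lambda>z. b z + b' z)"
  unfolding holo2_def
proof (intro conjI ballI)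
  fix z assume "z \<in> V"
  then have "((\<lambda>z. \<psi> z + \<psi>' z) has_derivative
      (\<lambda>w. (\<lambda>(h, k). a z * h + b z * k) w + (\<lambda>(h, k). a' z * h + b' z * k) w)) (at z)"
    using assms unfolding holo2_def by (intro has_derivative_add) auto
  then show "((\<lambda>z. \<psi> z + \<psi>' z) has_derivative (\<lambda>(h, k). (a z + a' z) * h + (b z + b' z) * k)) (at z)"
    by (rule has_derivative_eq_rhs) (auto simp: algebra_simps)
qed (use assms in \<open>auto simp: holo2_def intro: continuous_on_add\<close>)

lemma holo2_mult:
  assumes "holo2 V \<psi> a b" "holo2 V \<psi>' a' b'"
  shows "holo2 V (\<lambda>z. \<psi> z * \<psi>' z) (\<lambda>z. \<psi> z * a' z + a z * \<psi>' z) (\<lambda>z. \<psi> z * b' z + b z * \<psi>' z)"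
  unfolding holo2_def
proof (intro conjI ballI)
  fix z assume "z \<in> V"
  then have "((\<lambda>z. \<psi> z * \<psi>' z) has_derivative
      (\<lambda>w. \<psi> z * (\<lambda>(h, k). a' z * h + b' z * k) w + (\<lambda>(h, k). a z * h + b z * k) w * \<psi>' z)) (at z)"
    using assms unfolding holo2_def by (intro has_derivative_mult) auto
  then show "((\<lambda>z. \<psi> z * \<psi>' z) has_derivative
      (\<lambda>(h, k). (\<psi> z * a' z + a z * \<psi>' z) * h + (\<psi> z * b' z + b z * \<psi>' z) * k)) (at z)"
    by (rule has_derivative_eq_rhs) (auto simp: algebra_simps)
qed (use assms holo2_continuous[OF assms(1)] holo2_continuous[OF assms(2)] in
    \<open>auto simp: holo2_def intro!: continuous_intros\<close>)

text \<open>Used for roots and, with \<open>s = -1\<close>, for reciprocals.\<close>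

definition cpow :: "complex \<Rightarrow> complex \<Rightarrow> complex" where
  "cpow s w = exp (s * Ln w)"

lemma cpow_1: "cpow s 1 = 1"
  by (simp add: cpow_def)

lemma cpow_power: "cpow s w ^ n = cpow (of_nat n * s) w"
  by (simp add: cpow_def flip: exp_of_nat_mult) (simp add: mult_ac)

lemma cpow_one: "w \<noteq> 0 \<Longrightarrow> cpow 1 w = w"
  by (simp add: cpow_def)

lemma cpow_minus_one: "w \<noteq> 0 \<Longrightarrow> cpow (-1) w = 1 / w"
  by (simp add: cpow_def exp_minus field_simps)

text \<open>A positive real part keeps the values off the branch cut of \<open>Ln\<close>, so roots
  of functions close to 1 are differentiable with the expected partial derivatives.\<close>

lemma holo2_cpow:
  assumes \<psi>: "holo2 V \<psi> a b" and pos: "\<forall>z\<in>V. Re (\<psi> z) > 0"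
  shows "holo2 V (\<lambda>z. cpow s (\<psi> z)) (\<lambda>z. cpow s (\<psi> z) * s / \<psi> z * a z) (\<lambda>z. cpow s (\<psi> z) * s / \<psi> z * b z)"
  unfolding holo2_def
proof (intro conjI ballI)
  have nn: "\<psi> z \<notin> \<real>\<^sub>\<le>\<^sub>0" "\<psi> z \<noteq> 0" if "z \<in> V" for z
    using pos that by (auto simp: complex_nonpos_Reals_iff)
  have c: "continuous_on V (\<lambda>z. cpow s (\<psi> z))"
    unfolding cpow_def using nn(1) by (intro continuous_intros holo2_continuous[OF \<psi>]) auto
  show "continuous_on V (\<lambda>z. cpow s (\<psi> z) * s / \<psi> z * a z)" "continuous_on V (\<lambda>z. cpow s (\<psi> z) * s / \<psi> z * b z)"
    using c holo2_continuous[OF \<psi>] \<psi> nn(2) by (auto simp: holo2_def intro!: continuous_intros)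
  fix z assume z: "z \<in> V"
  have "(cpow s has_field_derivative cpow s (\<psi> z) * s / \<psi> z) (at (\<psi> z))"
    unfolding cpow_def using nn[OF z] by (auto intro!: derivative_eq_intros simp: divide_inverse mult_ac)
  then have outer: "(cpow s has_derivative (*) (cpow s (\<psi> z) * s / \<psi> z)) (at (\<psi> z))"
    by (simp only: has_field_derivative_def)
  have "(\<psi> has_derivative (\<lambda>(h, k). a z * h + b z * k)) (at z)" using \<psi> z by (simp add: holo2_def)
  from has_derivative_compose[OF this outer]
  have "((\<lambda>z. cpow s (\<psi> z)) has_derivative
      (\<lambda>w. cpow s (\<psi> z) * s / \<psi> z * (\<lambda>(h, k). a z * h + b z * k) w)) (at z)" .
  then show "((\<lambda>z. cpow s (\<psi> z)) has_derivative
      (\<lambda>(h, k). cpow s (\<psi> z) * s / \<psi> z * a z * h + cpow s (\<psi> z) * s / \<psi> z * b z * k)) (at z)"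
    by (rule has_derivative_eq_rhs) (auto simp: algebra_simps add_divide_distrib)
qed

lemma A_singI:
  assumes V: "open V" "(0, 0) \<in> V" and \<psi>: "holo2 V \<psi> a b" and \<theta>: "holo2 V \<theta> c d"
    and 0: "\<psi> (0, 0) = 0" "\<theta> (0, 0) = 0" "a (0, 0) * d (0, 0) - b (0, 0) * c (0, 0) \<noteq> 0"
    and k: "k \<ge> 1" "det3 v e1 e2 \<noteq> 0"
    and eq: "\<And>x y. (x, y) \<in> V \<Longrightarrow> f (v + x *s e1 + y *s e2) = \<psi> (x, y) ^ 2 + \<theta> (x, y) ^ (k + 1)"
  shows "A_sing k f v"
proof -
  \<comment> \<open>The neighbourhood is shrunk to the open set where the Jacobian is invertible,
    since \<open>local_biholo\<close> asks for this at every point.\<close>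
  define U where "U = {z \<in> V. a z * d z - b z * c z \<in> - {0}}"
  have "continuous_on V (\<lambda>z. a z * d z - b z * c z)"
    using \<psi> \<theta> by (auto simp: holo2_def intro!: continuous_intros)
  then have "open (V \<inter> (\<lambda>z. a z * d z - b z * c z) -` (- {0}))"
    by (rule continuous_open_preimage) (use V(1) in auto)
  then have "open U" by (simp add: U_def vimage_def Int_def)
  have "local_biholo (\<lambda>z. (\<psi> z, \<theta> z)) U"
    unfolding local_biholo_def
  proof (intro conjI ballI \<open>open U\<close>)
    fix z assume z: "z \<in> U"
    then have "((\<lambda>z. (\<psi> z, \<theta> z)) has_derivative
        (\<lambda>w. ((\<lambda>(h, k). a z * h + b z * k) w, (\<lambda>(h, k). c z * h + d z * k) w))) (at z)"
      using \<psi> \<theta> unfolding holo2_def U_def by (intro has_derivative_Pair) auto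
    then have "((\<lambda>z. (\<psi> z, \<theta> z)) has_derivative (\<lambda>(h, k). (a z * h + b z * k, c z * h + d z * k))) (at z)"
      by (rule has_derivative_eq_rhs) auto
    then show "\<exists>a b c d. a * d - b * c \<noteq> 0 \<and>
        ((\<lambda>z. (\<psi> z, \<theta> z)) has_derivative (\<lambda>(h, k). (a * h + b * k, c * h + d * k))) (at z)"
      using z by (intro exI[of _ "a z"] exI[of _ "b z"] exI[of _ "c z"] exI[of _ "d z"]) (auto simp: U_def)
  qed
  moreover have "(0, 0) \<in> U" using V(2) 0(3) by (simp add: U_def)
  moreover have "\<forall>(x, y) \<in> U. f (v + x *s e1 + y *s e2) = (fst (\<psi> (x, y), \<theta> (x, y)))^2 + (snd (\<psi> (x, y), \<theta> (x, y)))^(k + 1)"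
    using eq by (auto simp: U_def)
  moreover have "(\<psi> (0, 0), \<theta> (0, 0)) = (0, 0)" using 0 by simp
  ultimately show ?thesis
    unfolding A_sing_def det3_def[symmetric] using k
    by (intro conjI exI[of _ e1] exI[of _ e2] exI[of _ "\<lambda>z. (\<psi> z, \<theta> z)"] exI[of _ U])
qed

lemma holo2_affine: "holo2 V (\<lambda>z. 1 + (p * fst z + q * snd z))
    (\<lambda>z. 0 + ((p * 1 + 0 * fst z) + (q * 0 + 0 * snd z))) (\<lambda>z. 0 + ((p * 0 + 0 * fst z) + (q * 1 + 0 * snd z)))"
  by (intro holo2_add holo2_mult holo2_const holo2_fst holo2_snd)

lemma affine_half_space_open: "open {z. Re (1 + (p * fst z + q * snd z)) > 0}"
  by (intro open_Collect_less continuous_intros)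

text \<open>The square roots of the two unit factors are absorbed into the coordinates.\<close>

lemma A1_normal_form:
  assumes det: "det3 v e1 e2 \<noteq> 0"
    and eq: "\<And>x y. f (v + x *s e1 + y *s e2) = x^2 * (1 + (p * x + q * y)) + y^2 * (1 + (r * x + s * y))"
  shows "A_sing 1 f v"
proof -
  define V where "V = {z. Re (1 + (p * fst z + q * snd z)) > 0} \<inter> {z. Re (1 + (r * fst z + s * snd z)) > 0}"
  have V: "open V" "(0, 0) \<in> V" unfolding V_def using affine_half_space_open by (auto intro!: open_Int)
  have pos: "\<forall>z\<in>V. Re (1 + (p * fst z + q * snd z)) > 0" "\<forall>z\<in>V. Re (1 + (r * fst z + s * snd z)) > 0"
    by (auto simp: V_def)
  note \<psi> = holo2_cpow[OF holo2_affine pos(1), of "1/2"]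
  note \<theta> = holo2_cpow[OF holo2_affine pos(2), of "1/2"]
  show ?thesis
  proof (rule A_singI[OF V holo2_mult[OF holo2_fst \<psi>] holo2_mult[OF holo2_snd \<theta>] _ _ _ _ det])
    fix x y assume xy: "(x, y) \<in> V"
    have "1 + (p * x + q * y) \<noteq> 0" "1 + (r * x + s * y) \<noteq> 0"
      using bspec[OF pos(1) xy] bspec[OF pos(2) xy] by (metis fst_conv snd_conv less_irrefl zero_complex.sel(1))+
    then show "f (v + x *s e1 + y *s e2) = (fst (x, y) * cpow (1/2) (1 + (p * fst (x, y) + q * snd (x, y))))^2 +
        (snd (x, y) * cpow (1/2) (1 + (r * fst (x, y) + s * snd (x, y)))) ^ (1 + 1)"
      unfolding eq one_add_one fst_conv snd_conv power_mult_distrib cpow_power by (simp add: cpow_one)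
  qed (simp_all add: cpow_1)
qed

text \<open>Both cases complete the square in \<open>x\<close>: \<open>U x\<^sup>2 + c x y\<^sup>2 = U (x + c y\<^sup>2 / (2 U))\<^sup>2 - c\<^sup>2 y\<^sup>4 / (4 U)\<close>.\<close>

lemma A2_normal_form:
  assumes det: "det3 v e1 e2 \<noteq> 0" and d: "d \<noteq> 0"
    and eq: "\<And>x y. f (v + x *s e1 + y *s e2) = x^2 * (1 + (p * x + q * y)) + c * x * y^2 + d * y^3"
  shows "A_sing 2 f v"
proof -
  define u where "u z = 1 + (p * fst z + q * snd z)" for z :: "complex \<times> complex"
  define V0 where "V0 = {z. Re (u z) > 0}"
  have V0: "open V0" "(0, 0) \<in> V0" unfolding V0_def u_def using affine_half_space_open by auto
  have u: "holo2 V0 u (\<lambda>z. 0 + ((p * 1 + 0 * fst z) + (q * 0 + 0 * snd z))) (\<lambda>z. 0 + ((p * 0 + 0 * fst z) + (q * 1 + 0 * snd z)))"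
    using holo2_affine unfolding u_def .
  have pos: "\<forall>z\<in>V0. Re (u z) > 0" by (simp add: V0_def)
  note ui = holo2_cpow[OF u pos, of "-1"] and us = holo2_cpow[OF u pos, of "1/2"]
  \<comment> \<open>After completing the square, \<open>d * y^3 * w\<close> remains, and its cube
    root is the second coordinate.\<close>
  define w where "w z = 1 + (- (c^2) / (4 * d)) * (snd z * cpow (-1) (u z))" for z
  note w = holo2_add[OF holo2_const[of _ 1] holo2_mult[OF holo2_const[of _ "- (c^2) / (4 * d)"] holo2_mult[OF holo2_snd ui]],
      folded w_def]
  define V where "V = {z \<in> V0. Re (w z) > 0}"
  have "open (V0 \<inter> w -` {z. Re z > 0})"
    by (rule continuous_open_preimage[OF holo2_continuous[OF w] V0(1)]) (rule open_halfspace_Re_gt)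
  then have V: "open V" "(0, 0) \<in> V"
    using V0(2) by (simp_all add: V_def vimage_def Int_def w_def)
  have sub: "V \<subseteq> V0" by (auto simp: V_def)
  have wpos: "\<forall>z\<in>V. Re (w z) > 0" by (simp add: V_def)
  note wr = holo2_cpow[OF holo2_subset[OF w sub] wpos, of "1/3"]
  obtain r where r: "r ^ 3 = d" "r \<noteq> 0" using exists_nth_root[OF d, of 3] by auto
  note \<psi> = holo2_mult[OF holo2_subset[OF us sub] holo2_add[OF holo2_fst
        holo2_mult[OF holo2_const[of _ "c / 2"] holo2_mult[OF holo2_mult[OF holo2_snd holo2_snd] holo2_subset[OF ui sub]]]]]
  note \<theta> = holo2_mult[OF holo2_const[of _ r] holo2_mult[OF holo2_snd wr]]
  have u0: "u (0, 0) = 1" "w (0, 0) = 1" by (simp_all add: u_def w_def)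
  show ?thesis
  proof (rule A_singI[OF V \<psi> \<theta> _ _ _ _ det])
    fix x y assume xy: "(x, y) \<in> V"
    define U where "U = u (x, y)"
    have U: "U \<noteq> 0" "w (x, y) \<noteq> 0" using xy by (force simp: V_def V0_def U_def)+
    have s: "cpow (1/2) U ^ 2 = U" using U(1) by (simp add: cpow_power cpow_one)
    have t: "cpow (1/3) (w (x, y)) ^ 3 = 1 - (c^2) / (4 * d) * (y / U)"
      using U by (simp add: cpow_power cpow_one) (simp add: w_def cpow_minus_one U_def)
    have "(r * (y * cpow (1/3) (w (x, y)))) ^ 3 = d * (y^3 * (1 - c^2 / (4 * d) * (y / U)))"
      by (simp only: power_mult_distrib t r(1))
    moreover have "f (v + x *s e1 + y *s e2) = x^2 * U + c * x * y^2 + d * y^3"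
      by (simp add: eq U_def u_def)
    moreover have "x^2 * U + c * x * y^2 + d * y^3 =
        U * (x + c / 2 * (y * y * (1 / U)))^2 + d * (y^3 * (1 - c^2 / (4 * d) * (y / U)))"
      using U(1) d by (simp add: field_simps power2_eq_square power3_eq_cube)
    moreover have "(2::nat) + 1 = 3" by simp
    ultimately show "f (v + x *s e1 + y *s e2) =
        (cpow (1/2) (u (x, y)) * (fst (x, y) + c / 2 * (snd (x, y) * snd (x, y) * cpow (-1) (u (x, y)))))^2 +
        (r * (snd (x, y) * cpow (1/3) (w (x, y)))) ^ (2 + 1)"
      by (simp only: U_def[symmetric] fst_conv snd_conv power_mult_distrib[of "cpow _ _"] s cpow_minus_one[OF U(1)])
  qed (use r in \<open>simp_all add: cpow_1 u0\<close>)
qed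

lemma A3_normal_form:
  assumes det: "det3 v e1 e2 \<noteq> 0" and c: "c \<noteq> 0"
    and eq: "\<And>x y. f (v + x *s e1 + y *s e2) = x^2 * (1 + (p * x + q * y)) + c * x * y^2"
  shows "A_sing 3 f v"
proof -
  define u where "u z = 1 + (p * fst z + q * snd z)" for z :: "complex \<times> complex"
  define V where "V = {z. Re (u z) > 0}"
  have V: "open V" "(0, 0) \<in> V" unfolding V_def u_def using affine_half_space_open by auto
  have u: "holo2 V u (\<lambda>z. 0 + ((p * 1 + 0 * fst z) + (q * 0 + 0 * snd z))) (\<lambda>z. 0 + ((p * 0 + 0 * fst z) + (q * 1 + 0 * snd z)))"
    using holo2_affine unfolding u_def .
  have pos: "\<forall>z\<in>V. Re (u z) > 0" by (simp add: V_def)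
  note ui = holo2_cpow[OF u pos, of "-1"] and us = holo2_cpow[OF u pos, of "1/2"]
    and uq = holo2_cpow[OF u pos, of "-1/4"]
  \<comment> \<open>After completing the square, \<open>- c^2 * y^4 / (4 * U)\<close> remains, the
    fourth power of \<open>r * y\<close> times \<open>U\<close> to the exponent
    \<open>-1/4\<close>.\<close>
  obtain r where r: "r ^ 4 = - (c^2) / 4" "r \<noteq> 0" using exists_nth_root[of "- (c^2) / 4" 4] c by auto
  note \<psi> = holo2_mult[OF us holo2_add[OF holo2_fst
        holo2_mult[OF holo2_const[of _ "c / 2"] holo2_mult[OF holo2_mult[OF holo2_snd holo2_snd] ui]]]]
  note \<theta> = holo2_mult[OF holo2_const[of _ r] holo2_mult[OF holo2_snd uq]]
  have u0: "u (0, 0) = 1" by (simp add: u_def)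
  show ?thesis
  proof (rule A_singI[OF V \<psi> \<theta> _ _ _ _ det])
    fix x y assume xy: "(x, y) \<in> V"
    define U where "U = u (x, y)"
    have U: "U \<noteq> 0" using xy by (force simp: V_def U_def)
    have s: "cpow (1/2) U ^ 2 = U" using U by (simp add: cpow_power cpow_one)
    have t: "cpow (-1/4) U ^ 4 = 1 / U"
      using U by (simp add: cpow_power cpow_minus_one)
    have "(r * (y * cpow (-1/4) U)) ^ 4 = - (c^2) / 4 * (y^4 * (1 / U))"
      by (simp only: power_mult_distrib t r(1))
    moreover have "f (v + x *s e1 + y *s e2) = x^2 * U + c * x * y^2"
      by (simp add: eq U_def u_def)
    moreover have "x^2 * U + c * x * y^2 =
        U * (x + c / 2 * (y * y * (1 / U)))^2 + - (c^2) / 4 * (y^4 * (1 / U))"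
      using U by (simp add: field_simps power2_eq_square power4_eq_xxxx)
    moreover have "(3::nat) + 1 = 4" by simp
    ultimately show "f (v + x *s e1 + y *s e2) =
        (cpow (1/2) (u (x, y)) * (fst (x, y) + c / 2 * (snd (x, y) * snd (x, y) * cpow (-1) (u (x, y)))))^2 +
        (r * (snd (x, y) * cpow (-1/4) (u (x, y)))) ^ (3 + 1)"
      by (simp only: U_def[symmetric] fst_conv snd_conv power_mult_distrib[of "cpow _ _"] s cpow_minus_one[OF U])
  qed (use r in \<open>simp_all add: cpow_1 u0\<close>)
qed

text \<open>The directions \<open>e1\<close> and \<open>w'\<close> diagonalize the quadratic part of
  \<open>f\<close> at \<open>v\<close>. Rank two gives A_1, and rank one gives A_2 or A_3 according
  to the cubic terms along \<open>w'\<close>. If those vanish as well, the cubic is singular along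
  the whole line through \<open>v\<close> and \<open>w'\<close>; this line meets \<open>l\<close>,
  contrary to transversality.\<close>

lemma transverse_double_point_A:
  assumes f: "f \<in> plane_forms 3" and l: "l \<in> plane_forms 1" and tr: "transverse f l"
    and v: "v \<noteq> 0" "singular_at f v" and double: "pol f v u w \<noteq> 0"
  shows "\<exists>k. A_sing k f v"
proof -
  have lc: "clin l" using l unfolding plane_form_1_iff .
  have vv: "pol f v v x = 0" for x
    using v(2) by (simp add: singular_at_def dir_deriv_cubic[OF f])
  have vvs: "pol f v x v = 0" "pol f x v v = 0" for x
    using vv[of x] by (metis pol_commute)+
  have "\<exists>u. pol f v u u \<noteq> 0"
  proof (rule ccontr)
    assume "\<nexists>u. pol f v u u \<noteq> 0"
    then have "pol f v u u = 0" "pol f v w w = 0" "pol f v (u + w) (u + w) = 0" by auto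
    then show False using double pol_commute(2)[of f v u w] by (simp add: pol_simps)
  qed
  then obtain u where u: "pol f v u u \<noteq> 0" by blast
  obtain \<sigma> where \<sigma>: "\<sigma>^2 = 1 / (3 * pol f v u u)" "\<sigma> \<noteq> 0"
    using exists_nth_root[of "1 / (3 * pol f v u u)" 2] u by auto
  define e1 where "e1 = \<sigma> *s u"
  have e1: "3 * pol f v e1 e1 = 1"
    using \<sigma>(1) u by (simp add: e1_def pol_simps power2_eq_square[symmetric] mult.assoc[symmetric])
  obtain w where w: "det3 v e1 w = 1"
  proof (rule frame_cases[OF v(1), of e1])
    fix u w c assume "e1 = c *s v"
    then have "pol f v e1 e1 = 0" using vv by (simp add: pol_simps)
    then show thesis using e1 by simp
  qed
  define w' where "w' = w - (3 * pol f v e1 w) *s e1"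
  have w': "det3 v e1 w' = 1"
    using w by (simp add: w'_def det3_expand algebra_simps)
  have e1w': "pol f v e1 w' = 0"
    using e1 by (simp add: w'_def pol_minus pol_simps mult.commute[of 3])
  have expand: "f (v + x *s e1 + y *s e2) = x^2 + 3 * y^2 * pol f v e2 e2 + x^2 * (f e1 * x + 3 * pol f e1 e1 e2 * y)
      + 3 * x * y^2 * pol f e1 e2 e2 + y^3 * f e2" if "pol f v e1 e2 = 0" for x y e2
    using cubic_expand[OF f, of 1 v x e1 y e2] e1 vv that pol_diag[OF f, of v]
    by (simp add: algebra_simps power2_eq_square power3_eq_cube)
  show ?thesis
  proof (cases "pol f v w' w' = 0")
    case False
    obtain \<tau> where \<tau>: "\<tau>^2 = 1 / (3 * pol f v w' w')" "\<tau> \<noteq> 0"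
      using exists_nth_root[of "1 / (3 * pol f v w' w')" 2] False by auto
    have d: "det3 v e1 (\<tau> *s w') \<noteq> 0" using w' \<tau>(2) clin_scale[OF clin_det3] by simp
    have "pol f v e1 (\<tau> *s w') = 0" using e1w' by (simp add: pol_simps)
    moreover have "3 * pol f v (\<tau> *s w') (\<tau> *s w') = 1"
      using \<tau>(1) False by (simp add: pol_simps power2_eq_square[symmetric] mult.assoc[symmetric])
    ultimately have "f (v + x *s e1 + y *s (\<tau> *s w')) = x^2 * (1 + (f e1 * x + 3 * pol f e1 e1 (\<tau> *s w') * y))
        + y^2 * (1 + (3 * pol f e1 (\<tau> *s w') (\<tau> *s w') * x + f (\<tau> *s w') * y))" for x y
      unfolding expand[OF \<open>pol f v e1 (\<tau> *s w') = 0\<close>] by algebra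
    then show ?thesis using A1_normal_form[OF d] by blast
  next
    case True
    have d: "det3 v e1 w' \<noteq> 0" using w' by simp
    have eq: "f (v + x *s e1 + y *s w') = x^2 * (1 + (f e1 * x + 3 * pol f e1 e1 w' * y))
        + 3 * pol f e1 w' w' * x * y^2 + f w' * y^3" for x y
      unfolding expand[OF e1w'] True by algebra
    consider "f w' \<noteq> 0" | "f w' = 0" "3 * pol f e1 w' w' \<noteq> 0" | "f w' = 0" "pol f e1 w' w' = 0" by auto
    then show ?thesis
    proof cases
      case 1
      then show ?thesis using A2_normal_form[OF d _ eq] by blast
    next
      case 2
      show ?thesis using A3_normal_form[OF d 2(2), of f] eq 2(1) by auto
    next
      case 3
      have w'w': "pol f w' w' x = 0" for x
      proof -
        have "pol f w' w' = (\<lambda>_. 0)"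
          by (rule clin_eqI[OF clin_pol(1) _ d])
            (use 3 True pol_diag[OF f, of w'] in \<open>simp_all add: clin_def pol_commute\<close>)
        then show ?thesis by simp
      qed
      have vw': "pol f v w' x = 0" for x
      proof -
        have "pol f v w' = (\<lambda>_. 0)"
          by (rule clin_eqI[OF clin_pol(1) _ d])
            (use True e1w' vvs pol_commute(2)[of f v w' e1] in \<open>simp_all add: clin_def\<close>)
        then show ?thesis by simp
      qed
      \<comment> \<open>A point where the line through \<open>v\<close> and \<open>w'\<close> meets
        \<open>l\<close>. The case \<open>l v = 0\<close> is separate because the second formula
        gives zero when \<open>l\<close> vanishes on the whole line.\<close>
      define P where "P = (if l v = 0 then v else l w' *s v - l v *s w')"
      have "l P = 0" by (simp add: P_def clin_diff[OF lc] clin_scale[OF lc])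
      moreover have "P \<noteq> 0"
      proof
        assume P0: "P = 0"
        then have lv: "l v \<noteq> 0" "l w' *s v = l v *s w'" using v(1) by (auto simp: P_def split: if_splits)
        have "l v * det3 v e1 w' = det3 v e1 (l v *s w')" using clin_scale[OF clin_det3] by simp
        also have "\<dots> = l w' * det3 v e1 v" unfolding lv(2)[symmetric] using clin_scale[OF clin_det3] by simp
        also have "det3 v e1 v = 0" by (simp add: det3_expand algebra_simps)
        finally show False using w' lv(1) by simp
      qed
      moreover have PP: "pol f P P x = 0" for x
        using vv vw' w'w' pol_commute(1)[of f w' v x] by (auto simp: P_def pol_minus pol_simps)
      moreover have "f P = 0" using pol_diag[OF f, of P] PP by simp
      ultimately show ?thesis
        using tr dir_deriv_cubic[OF f, of P] unfolding transverse_def by (metis mult_zero_left mult_zero_right)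
    qed
  qed
qed

section \<open>Invariants of a cubic and a line\<close>

text \<open>
  Contraction of a bilinear form with the bivector dual to the linear form \<open>l\<close>; it only depends on the
  restriction to the line \<open>l = 0\<close>, and \<open>SL(3)\<close> respects it.
\<close>

definition contract :: "(complex^3 \<Rightarrow> complex) \<Rightarrow> (complex^3 \<Rightarrow> complex^3 \<Rightarrow> complex) \<Rightarrow> complex" where
  "contract l B =
     l (axis 1 1) * (B (axis 2 1) (axis 3 1) - B (axis 3 1) (axis 2 1))
     + l (axis 2 1) * (B (axis 3 1) (axis 1 1) - B (axis 1 1) (axis 3 1))
     + l (axis 3 1) * (B (axis 1 1) (axis 2 1) - B (axis 2 1) (axis 1 1))"

definition bilin :: "(complex^3 \<Rightarrow> complex^3 \<Rightarrow> complex) \<Rightarrow> bool" where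
  "bilin B \<longleftrightarrow> (\<forall>y. clin (\<lambda>x. B x y)) \<and> (\<forall>x. clin (B x))"

text \<open>\<open>contract l B\<close> is the coefficient of the 3-form obtained by wedging
  \<open>l\<close> with the antisymmetric part of \<open>B\<close>, up to normalization; a 3-form is
  multiplied by \<open>det G\<close> under pullback.\<close>

lemma contract_comp:
  assumes l: "clin l" and B: "bilin B"
  shows "contract (\<lambda>x. l (G *v x)) (\<lambda>x y. B (G *v x) (G *v y)) = det G * contract l B"
proof -
  define b where "b i j = B (axis i 1) (axis j 1)" for i j
  have lG: "l (G *v axis j 1) = G $ 1 $ j * l (axis 1 1) + G $ 2 $ j * l (axis 2 1) + G $ 3 $ j * l (axis 3 1)" for j
    by (subst clin_basis[OF l]) (simp add: matrix_vector_axis sum_3)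
  have B1: "B x y = x $ 1 * B (axis 1 1) y + x $ 2 * B (axis 2 1) y + x $ 3 * B (axis 3 1) y" for x y
    using clin_basis[of "\<lambda>x. B x y" x] B by (simp add: bilin_def sum_3)
  have B2: "B x y = y $ 1 * B x (axis 1 1) + y $ 2 * B x (axis 2 1) + y $ 3 * B x (axis 3 1)" for x y
    using clin_basis[of "B x" y] B by (simp add: bilin_def sum_3)
  have BG: "B (G *v axis i 1) (G *v axis j 1) =
      G $ 1 $ i * (G $ 1 $ j * b 1 1 + G $ 2 $ j * b 1 2 + G $ 3 $ j * b 1 3)
      + G $ 2 $ i * (G $ 1 $ j * b 2 1 + G $ 2 $ j * b 2 2 + G $ 3 $ j * b 2 3)
      + G $ 3 $ i * (G $ 1 $ j * b 3 1 + G $ 2 $ j * b 3 2 + G $ 3 $ j * b 3 3)" for i j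
    unfolding B1[of "G *v axis i 1" "G *v axis j 1"] B2[of "axis _ 1" "G *v axis j 1"] matrix_vector_axis b_def ..
  show ?thesis
    unfolding contract_def lG BG b_def[symmetric] det_3 by algebra
qed

lemma contract_scale:
  "contract (\<lambda>x. c * l x) B = c * contract l B" "contract l (\<lambda>x y. c * B x y) = c * contract l B"
  by (simp_all add: contract_def algebra_simps)

lemma contract_add: "contract l (\<lambda>x y. B x y + B' x y) = contract l B + contract l B'"
  by (simp add: contract_def algebra_simps)

definition hes :: "(complex^3 \<Rightarrow> complex) \<Rightarrow> (complex^3 \<Rightarrow> complex) \<Rightarrow> complex^3 \<Rightarrow> complex^3 \<Rightarrow> complex" where
  "hes f l x y = contract l (\<lambda>p q. contract l (\<lambda>r s. pol f x p r * pol f y q s))"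

text \<open>
  On the line \<open>l = 0\<close>, \<open>hes f l\<close> is the Hessian of the binary cubic \<open>f\<close>; up to a factor, \<open>pole f l\<close> is the pole
  of this line with respect to the conic \<open>hes f l\<close>.
\<close>

definition pole :: "(complex^3 \<Rightarrow> complex) \<Rightarrow> (complex^3 \<Rightarrow> complex) \<Rightarrow> complex^3" where
  "pole f l = (\<chi> i. contract l (\<lambda>p q. cr (hes f l p) (hes f l q) $ i))"

text \<open>A linear form in \<open>x\<close>: the polar conic of \<open>x\<close> is paired with
  the conic \<open>hes f l\<close> along the line, a second transvectant.\<close>

definition theta :: "(complex^3 \<Rightarrow> complex) \<Rightarrow> (complex^3 \<Rightarrow> complex) \<Rightarrow> complex^3 \<Rightarrow> complex" where
  "theta f l x = contract l (\<lambda>p q. contract l (\<lambda>r s. pol f x p r * hes f l q s))"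

text \<open>The intersection of the line with the polar line of \<open>pole f l\<close>: a point of
  the line obtained without choosing among its intersections with the cubic.\<close>

definition base_point :: "(complex^3 \<Rightarrow> complex) \<Rightarrow> (complex^3 \<Rightarrow> complex) \<Rightarrow> complex^3" where
  "base_point f l = cr l (pol f (pole f l) (pole f l))"

lemma bilin_hes: "bilin (hes f l)"
  unfolding bilin_def clin_def hes_def contract_def by (simp add: pol_simps algebra_simps)

lemma clin_hes: "clin (hes f l x)" "clin (\<lambda>x. hes f l x y)"
  using bilin_hes by (auto simp: bilin_def)

lemma clin_scale_add: "clin p \<Longrightarrow> clin (\<lambda>x. c * p x)" "clin p \<Longrightarrow> clin q \<Longrightarrow> clin (\<lambda>x. p x + q x)"
    "clin p \<Longrightarrow> clin q \<Longrightarrow> clin (\<lambda>x. p x - q x)" "clin p \<Longrightarrow> clin (\<lambda>x. p x * c)"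
  by (simp_all add: clin_def algebra_simps)

lemma bilin_pol_product: "bilin (\<lambda>r s. pol f x p r * pol f y q s)" "bilin (\<lambda>r s. pol f x p r * hes f l q s)"
  unfolding bilin_def by (intro conjI allI clin_scale_add clin_pol clin_hes)+

lemma bilin_contract_product:
  "bilin (\<lambda>p q. contract l (\<lambda>r s. pol f x p r * pol f y q s))"
  "bilin (\<lambda>p q. contract l (\<lambda>r s. pol f x p r * hes f l' q s))"
  unfolding bilin_def contract_def by (intro conjI allI clin_scale_add clin_pol clin_hes)+

lemma bilin_cr_hes: "bilin (\<lambda>p q. cr (hes f l p) (hes f l q) $ i)"
proof -
  have "\<forall>i. bilin (\<lambda>p q. cr (hes f l p) (hes f l q) $ i)"
    unfolding forall_3 bilin_def cr_def vector_3
    by (intro conjI allI clin_scale_add clin_hes)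
  then show ?thesis ..
qed

context
  fixes G :: "complex^3^3" and f l f' l' :: "complex^3 \<Rightarrow> complex"
  assumes det: "det G = 1" and f: "f \<in> plane_forms 3" and l: "clin l"
    and f': "f' = (\<lambda>v. f (G *v v))" and l': "l' = (\<lambda>v. l (G *v v))"
begin

lemma pol_f': "pol f' x y z = pol f (G *v x) (G *v y) (G *v z)"
  unfolding f' by (rule pol_comp[OF f])

lemma contract_l': "bilin B \<Longrightarrow> contract l' (\<lambda>x y. B (G *v x) (G *v y)) = contract l B"
  unfolding l' by (simp add: contract_comp[OF l] det)

lemma hes_comp: "hes f' l' x y = hes f l (G *v x) (G *v y)"
proof -
  have "hes f' l' x y = contract l' (\<lambda>p q. contract l (\<lambda>r s. pol f (G *v x) (G *v p) r * pol f (G *v y) (G *v q) s))"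
    unfolding hes_def pol_f' contract_l'[OF bilin_pol_product(1)] ..
  also have "\<dots> = hes f l (G *v x) (G *v y)"
    unfolding hes_def by (rule contract_l'[OF bilin_contract_product(1)])
  finally show ?thesis .
qed

lemma theta_comp: "theta f' l' x = theta f l (G *v x)"
proof -
  have "theta f' l' x = contract l' (\<lambda>p q. contract l (\<lambda>r s. pol f (G *v x) (G *v p) r * hes f l (G *v q) s))"
    unfolding theta_def pol_f' hes_comp contract_l'[OF bilin_pol_product(2)] ..
  also have "\<dots> = theta f l (G *v x)"
    unfolding theta_def by (rule contract_l'[OF bilin_contract_product(2)])
  finally show ?thesis .
qed

lemma pole_comp: "G *v pole f' l' = pole f l"
proof -
  have h: "hes f' l' p = (\<lambda>x. hes f l (G *v p) (G *v x))" for p by (rule ext) (rule hes_comp)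
  have "(G *v pole f' l') $ k = pole f l $ k" for k
  proof -
    have "(G *v pole f' l') $ k = contract l' (\<lambda>p q. (G *v cr (hes f' l' p) (hes f' l' q)) $ k)"
      by (simp add: matrix_vector_mult_def pole_def sum_3 contract_add contract_scale)
    also have "\<dots> = contract l' (\<lambda>p q. cr (hes f l (G *v p)) (hes f l (G *v q)) $ k)"
      unfolding h cr_comp[OF clin_hes(1) clin_hes(1)] det by simp
    also have "\<dots> = pole f l $ k"
      unfolding pole_def by (simp add: contract_l'[OF bilin_cr_hes])
    finally show ?thesis .
  qed
  then show ?thesis by (simp add: vec_eq_iff)
qed

lemma base_point_comp: "G *v base_point f' l' = base_point f l"
proof -
  have "pol f' (pole f' l') (pole f' l') = (\<lambda>x. pol f (pole f l) (pole f l) (G *v x))"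
    by (rule ext) (simp add: pol_f' pole_comp)
  then show ?thesis
    unfolding base_point_def using cr_comp[OF l clin_pol(1), of G f "pole f l" "pole f l"] det by (simp add: l')
qed

lemma pair_invariants_comp:
  "l' (pole f' l') = l (pole f l)"
  "theta f' l' (pole f' l') = theta f l (pole f l)"
  "pol f' (pole f' l') (pole f' l') (pole f' l') = pol f (pole f l) (pole f l) (pole f l)"
  "hes f' l' (base_point f' l') (base_point f' l') = hes f l (base_point f l) (base_point f l)"
  "pol f' (base_point f' l') (base_point f' l') (base_point f' l') = pol f (base_point f l) (base_point f l) (base_point f l)"
proof -
  have "l' x = l (G *v x)" for x by (simp add: l')
  then show "l' (pole f' l') = l (pole f l)" by (simp only: pole_comp)
qed (simp_all add: pol_f' hes_comp theta_comp pole_comp base_point_comp)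

end

lemma hes_scale: "hes (\<lambda>v. c * f v) (\<lambda>v. b * l v) x y = c^2 * b^2 * hes f l x y"
proof -
  have "pol (\<lambda>v. c * f v) x p r * pol (\<lambda>v. c * f v) y q s = c^2 * (pol f x p r * pol f y q s)" for p q r s
    by (simp add: pol_cmult power2_eq_square)
  then show ?thesis unfolding hes_def by (simp add: contract_scale power2_eq_square)
qed

lemma theta_scale: "theta (\<lambda>v. c * f v) (\<lambda>v. b * l v) x = c^3 * b^4 * theta f l x"
proof -
  have "pol (\<lambda>v. c * f v) x p r * hes (\<lambda>v. c * f v) (\<lambda>v. b * l v) q s = (c^3 * b^2) * (pol f x p r * hes f l q s)" for p q r s
    by (simp add: pol_cmult hes_scale power2_eq_square power3_eq_cube)
  then show ?thesis unfolding theta_def by (simp add: contract_scale eval_nat_numeral)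
qed

lemma pole_scale: "pole (\<lambda>v. c * f v) (\<lambda>v. b * l v) = (c^4 * b^5) *s pole f l"
proof -
  have "hes (\<lambda>v. c * f v) (\<lambda>v. b * l v) p = (\<lambda>x. (c^2 * b^2) * hes f l p x)" for p
    by (rule ext) (rule hes_scale)
  then have "cr (hes (\<lambda>v. c * f v) (\<lambda>v. b * l v) p) (hes (\<lambda>v. c * f v) (\<lambda>v. b * l v) q) $ i
      = (c^4 * b^4) * cr (hes f l p) (hes f l q) $ i" for p q i
    by (simp add: cr_scale) (simp add: eval_nat_numeral)
  then show ?thesis unfolding pole_def by (simp add: vec_eq_iff contract_scale) (simp add: eval_nat_numeral)
qed

lemma base_point_scale: "base_point (\<lambda>v. c * f v) (\<lambda>v. b * l v) = (c^9 * b^11) *s base_point f l"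
proof -
  have "pol (\<lambda>v. c * f v) (pole (\<lambda>v. c * f v) (\<lambda>v. b * l v)) (pole (\<lambda>v. c * f v) (\<lambda>v. b * l v))
      = (\<lambda>x. (c^9 * b^10) * pol f (pole f l) (pole f l) x)"
    by (rule ext) (simp add: pole_scale pol_cmult pol_simps eval_nat_numeral)
  then show ?thesis unfolding base_point_def by (simp add: cr_scale) (simp add: eval_nat_numeral mult_ac)
qed

lemma polyfuns_contract:
  assumes "\<And>u. (\<lambda>z. L z u) \<in> polyfuns K" "\<And>i j. (\<lambda>z. B z (axis i 1) (axis j 1)) \<in> polyfuns K"
  shows "(\<lambda>z. contract (L z) (B z)) \<in> polyfuns K"
  unfolding contract_def by (intro polyfuns_intros assms)

context
  fixes F L :: "'a \<Rightarrow> complex^3 \<Rightarrow> complex" and K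
  assumes F: "\<And>u. (\<lambda>z. F z u) \<in> polyfuns K" and L: "\<And>u. (\<lambda>z. L z u) \<in> polyfuns K"
begin

lemma polyfuns_hes:
  assumes "\<And>i. (\<lambda>z. x z $ i) \<in> polyfuns K" "\<And>i. (\<lambda>z. y z $ i) \<in> polyfuns K"
  shows "(\<lambda>z. hes (F z) (L z) (x z) (y z)) \<in> polyfuns K"
  unfolding hes_def by (intro polyfuns_contract polyfuns_intros polyfuns_pol F L assms)

lemma polyfuns_theta:
  assumes "\<And>i. (\<lambda>z. x z $ i) \<in> polyfuns K"
  shows "(\<lambda>z. theta (F z) (L z) (x z)) \<in> polyfuns K"
  unfolding theta_def by (intro polyfuns_contract polyfuns_hes polyfuns_intros polyfuns_pol F L assms)

lemma polyfuns_pole: "(\<lambda>z. pole (F z) (L z) $ i) \<in> polyfuns K"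
  unfolding pole_def vec_lambda_beta
  by (intro polyfuns_contract polyfuns_hes polyfuns_cr polyfuns_intros F L)

lemma polyfuns_base_point: "(\<lambda>z. base_point (F z) (L z) $ i) \<in> polyfuns K"
  unfolding base_point_def by (intro polyfuns_cr polyfuns_pol polyfuns_pole polyfuns_intros F L)

end

section \<open>Invariant sections on the space of pairs\<close>

definition pair_invariant :: "(pair_vec \<Rightarrow> complex) \<Rightarrow> nat \<Rightarrow> nat \<Rightarrow> bool" where
  "pair_invariant X p q \<longleftrightarrow> X \<in> polyfuns pair_coords \<and>
     (\<forall>f l c b. clin l \<longrightarrow> X ((\<lambda>v. c * f v), (\<lambda>v. b * l v)) = c ^ p * b ^ q * X (f, l)) \<and>
     (\<forall>g f l. g \<in> SL3 \<and> f \<in> plane_forms 3 \<and> clin l \<longrightarrow> X (act_form g f, act_form g l) = X (f, l))"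

lemma pair_invariant_mult:
  assumes "pair_invariant X p q" "pair_invariant Y p' q'"
  shows "pair_invariant (\<lambda>z. X z * Y z) (p + p') (q + q')"
  using assms unfolding pair_invariant_def by (simp add: polyfuns.mult power_add)

lemma pair_invariant_power:
  assumes "pair_invariant X p q"
  shows "pair_invariant (\<lambda>z. X z ^ k) (k * p) (k * q)"
  using assms unfolding pair_invariant_def
  by (simp add: polyfuns_power power_mult_distrib power_mult[symmetric] mult.commute[of k])

lemma pair_invariant_section:
  assumes "pair_invariant S d a"
  shows "S \<in> pair_invariant_sections d a"
proof -
  have cone: "f \<in> plane_forms 3 \<and> clin l" if "(f, l) \<in> pair_cone" for f l
    using that unfolding pair_cone_def plane_form_1_iff by simp
  show ?thesis
    unfolding pair_invariant_sections_def
  proof (intro CollectI conjI ballI)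
    show "S \<in> fs_regular (quasi_affine pair_coords pair_cone) pair_cone"
      using assms by (intro polyfuns_regular) (simp add: pair_invariant_def)
  qed (use assms cone in \<open>auto simp: pair_invariant_def\<close>)
qed

lemma pair_coords_polyfuns: "(\<lambda>z. fst z u) \<in> polyfuns pair_coords" "(\<lambda>z. snd z u) \<in> polyfuns pair_coords"
  by (rule polyfuns.coord; force simp: pair_coords_def fun_eq_iff)+

abbreviation lift2 :: "((complex^3 \<Rightarrow> complex) \<Rightarrow> (complex^3 \<Rightarrow> complex) \<Rightarrow> 'b) \<Rightarrow> pair_vec \<Rightarrow> 'b" where
  "lift2 P \<equiv> \<lambda>z. P (fst z) (snd z)"

lemma det_matrix_inv:
  assumes "g \<in> SL3" shows "det (matrix_inv g) = 1"
proof -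
  obtain h where h: "h \<in> SL3" "h ** g = mat 1" using SL3_inverse[OF assms] .
  have "h *v x = matrix_inv g *v x" for x
  proof -
    have "h *v x = h *v (g *v (matrix_inv g *v x))" by (simp add: matrix_inv_mult SL3_nz[OF assms])
    also have "\<dots> = (h ** g) *v (matrix_inv g *v x)" by (rule matrix_vector_mul_assoc)
    finally show ?thesis by (simp add: h(2))
  qed
  then have "h = matrix_inv g" by (simp add: matrix_eq)
  then show ?thesis using h(1) by (simp add: SL3_def)
qed

lemma pair_invariantI:
  assumes "lift2 P \<in> polyfuns pair_coords"
    and "\<And>f l c b. clin l \<Longrightarrow> P (\<lambda>v. c * f v) (\<lambda>v. b * l v) = c ^ p * b ^ q * P f l"
    and "\<And>G f l. \<lbrakk>det G = 1; f \<in> plane_forms 3; clin l\<rbrakk> \<Longrightarrow> P (\<lambda>v. f (G *v v)) (\<lambda>v. l (G *v v)) = P f l"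
  shows "pair_invariant (lift2 P) p q"
  using assms unfolding pair_invariant_def act_form_def by (auto simp: det_matrix_inv)

text \<open>The numbers are the bidegrees in the cubic and the line. The first invariant is
  \<open>l (pole f l)\<close>, up to a constant the discriminant of the binary cubic on the line; it
  is expanded over the basis because \<open>pair_coords\<close> evaluates \<open>l\<close> at fixed
  vectors only.\<close>

lemma pair_invariants:
  "pair_invariant (lift2 (\<lambda>f l. \<Sum>i\<in>UNIV. pole f l $ i * l (axis i 1))) 4 6"
  "pair_invariant (lift2 (\<lambda>f l. theta f l (pole f l))) 7 9"
  "pair_invariant (lift2 (\<lambda>f l. pol f (pole f l) (pole f l) (pole f l))) 13 15"
  "pair_invariant (lift2 (\<lambda>f l. hes f l (base_point f l) (base_point f l))) 20 24"
  "pair_invariant (lift2 (\<lambda>f l. pol f (base_point f l) (base_point f l) (base_point f l))) 28 33"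
proof -
  note inv = pair_invariants_comp[OF _ _ _ refl refl]
  show "pair_invariant (lift2 (\<lambda>f l. \<Sum>i\<in>UNIV. pole f l $ i * l (axis i 1))) 4 6"
  proof (rule pair_invariantI)
    show "lift2 (\<lambda>f l. \<Sum>i\<in>UNIV. pole f l $ i * l (axis i 1)) \<in> polyfuns pair_coords"
      by (intro polyfuns_intros polyfuns_pole pair_coords_polyfuns)
    fix f l :: "complex^3 \<Rightarrow> complex" and c b assume l: "clin l"
    have "(\<Sum>i\<in>UNIV. pole (\<lambda>v. c * f v) (\<lambda>v. b * l v) $ i * (b * l (axis i 1))) = b * l (pole (\<lambda>v. c * f v) (\<lambda>v. b * l v))"
      by (simp add: clin_basis[OF l, of "pole _ _"] sum_distrib_left mult_ac)
    also have "\<dots> = c^4 * b^6 * l (pole f l)"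
      by (simp add: pole_scale clin_scale[OF l] eval_nat_numeral)
    also have "l (pole f l) = (\<Sum>i\<in>UNIV. pole f l $ i * l (axis i 1))" by (rule clin_basis[OF l])
    finally show "(\<Sum>i\<in>UNIV. pole (\<lambda>v. c * f v) (\<lambda>v. b * l v) $ i * (b * l (axis i 1))) =
        c^4 * b^6 * (\<Sum>i\<in>UNIV. pole f l $ i * l (axis i 1))" .
  next
    fix G :: "complex^3^3" and f l :: "complex^3 \<Rightarrow> complex" assume *: "det G = 1" "f \<in> plane_forms 3" "clin l"
    show "(\<Sum>i\<in>UNIV. pole (\<lambda>v. f (G *v v)) (\<lambda>v. l (G *v v)) $ i * l (G *v axis i 1)) = (\<Sum>i\<in>UNIV. pole f l $ i * l (axis i 1))"
      by (rule trans[OF clin_basis[OF clin_comp[OF *(3), of G], symmetric] trans[OF inv(1)[OF *] clin_basis[OF *(3)]]])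
  qed
  show "pair_invariant (lift2 (\<lambda>f l. theta f l (pole f l))) 7 9"
  proof (rule pair_invariantI)
    show "lift2 (\<lambda>f l. theta f l (pole f l)) \<in> polyfuns pair_coords"
      by (intro polyfuns_theta polyfuns_pole pair_coords_polyfuns)
    have t: "clin (theta f l)" for f l
      unfolding clin_def theta_def contract_def by (simp add: pol_simps algebra_simps)
    show "theta (\<lambda>v. c * f v) (\<lambda>v. b * l v) (pole (\<lambda>v. c * f v) (\<lambda>v. b * l v)) = c^7 * b^9 * theta f l (pole f l)" for f l c b
      by (simp add: theta_scale pole_scale clin_scale[OF t] eval_nat_numeral)
  qed (rule inv(2))
  show "pair_invariant (lift2 (\<lambda>f l. pol f (pole f l) (pole f l) (pole f l))) 13 15"
  proof (rule pair_invariantI)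
    show "lift2 (\<lambda>f l. pol f (pole f l) (pole f l) (pole f l)) \<in> polyfuns pair_coords"
      by (intro polyfuns_pol polyfuns_pole pair_coords_polyfuns)
    show "pol (\<lambda>v. c * f v) (pole (\<lambda>v. c * f v) (\<lambda>v. b * l v)) (pole (\<lambda>v. c * f v) (\<lambda>v. b * l v))
        (pole (\<lambda>v. c * f v) (\<lambda>v. b * l v)) = c^13 * b^15 * pol f (pole f l) (pole f l) (pole f l)" for f l c b
      by (simp add: pole_scale pol_cmult pol_simps eval_nat_numeral)
  qed (rule inv(3))
  show "pair_invariant (lift2 (\<lambda>f l. hes f l (base_point f l) (base_point f l))) 20 24"
  proof (rule pair_invariantI)
    show "lift2 (\<lambda>f l. hes f l (base_point f l) (base_point f l)) \<in> polyfuns pair_coords"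
      by (intro polyfuns_hes polyfuns_base_point pair_coords_polyfuns)
    show "hes (\<lambda>v. c * f v) (\<lambda>v. b * l v) (base_point (\<lambda>v. c * f v) (\<lambda>v. b * l v)) (base_point (\<lambda>v. c * f v) (\<lambda>v. b * l v))
        = c^20 * b^24 * hes f l (base_point f l) (base_point f l)" for f l c b
      by (simp add: hes_scale base_point_scale clin_scale[OF clin_hes(1)] clin_scale[OF clin_hes(2)] eval_nat_numeral)
  qed (rule inv(4))
  show "pair_invariant (lift2 (\<lambda>f l. pol f (base_point f l) (base_point f l) (base_point f l))) 28 33"
  proof (rule pair_invariantI)
    show "lift2 (\<lambda>f l. pol f (base_point f l) (base_point f l) (base_point f l)) \<in> polyfuns pair_coords"
      by (intro polyfuns_pol polyfuns_base_point pair_coords_polyfuns)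
    show "pol (\<lambda>v. c * f v) (base_point (\<lambda>v. c * f v) (\<lambda>v. b * l v)) (base_point (\<lambda>v. c * f v) (\<lambda>v. b * l v))
        (base_point (\<lambda>v. c * f v) (\<lambda>v. b * l v)) = c^28 * b^33 * pol f (base_point f l) (base_point f l) (base_point f l)" for f l c b
      by (simp add: base_point_scale pol_cmult pol_simps eval_nat_numeral)
  qed (rule inv(5))
qed

text \<open>The discriminant \<open>l (pole f l)\<close> has slope \<open>6 / 4 = 3 / 2\<close>,
  while \<open>X\<close> has slope at most \<open>9 / 7\<close>. Products of their powers, with a
  positive power of \<open>X\<close>, realize every slope of the stated range.\<close>

lemma pair_semistableI:
  assumes X: "pair_invariant X p q" "p > 0" "7 * q \<le> 9 * p" and t: "9 / 7 \<le> t" "t < 3 / 2"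
    and z: "(f, l) \<in> pair_cone" "X (f, l) \<noteq> 0" "l (pole f l) \<noteq> 0"
  shows "(f, l) \<in> pair_semistable t"
proof -
  have lc: "clin l" using z(1) by (simp add: pair_cone_def plane_form_1_clin)
  obtain u w :: nat where uw: "w > 0" "t = of_nat u / of_nat w"
  proof (cases t rule: Rat_cases)
    case (Fract a b)
    have "a > 0" using t(1) Fract by (simp add: zero_less_Fract_iff[of b a, symmetric])
    then show thesis using Fract that[of "nat b" "nat a"] by (simp add: Fract_of_int_quotient)
  qed
  have "rat_of_nat (9 * w) \<le> of_nat (7 * u)" "rat_of_nat (2 * u) < of_nat (3 * w)"
    using t uw by (simp_all add: field_simps)
  then have ineq: "9 * w \<le> 7 * u" "2 * u < 3 * w" unfolding of_nat_le_iff of_nat_less_iff .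
  \<comment> \<open>Equating the slope of \<open>X ^ m * D ^ n\<close>, with \<open>D\<close> the
    discriminant, to \<open>u / w\<close> gives
    \<open>n (6 w - 4 u) = m (u p - w q)\<close>.\<close>
  define m n where "m = 6 * w - 4 * u" and "n = u * p - w * q"
  have "7 * (w * q) \<le> 9 * (w * p)" using X(3) by (metis mult.left_commute mult_le_mono2)
  also have "\<dots> \<le> 7 * (u * p)" using ineq(1) by (metis mult.assoc mult_le_mono1)
  finally have "w * q \<le> u * p" by simp
  then have i: "int m = 6 * int w - 4 * int u" "int n = int u * int p - int w * int q"
    using ineq by (simp_all add: m_def n_def of_nat_diff)
  have m: "m > 0" using ineq by (simp add: m_def)
  let ?D = "lift2 (\<lambda>f l. \<Sum>i\<in>UNIV. pole f l $ i * l (axis i 1))"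
  let ?S = "\<lambda>z. X z ^ m * ?D z ^ n"
  let ?d = "m * p + n * 4" and ?a = "m * q + n * 6"
  have S: "pair_invariant ?S ?d ?a"
    by (intro pair_invariant_mult pair_invariant_power X(1) pair_invariants(1))
  have "int w * int ?a = int u * int ?d" unfolding of_nat_add of_nat_mult i by (simp add: algebra_simps)
  then have "w * ?a = u * ?d" by (metis of_nat_eq_iff of_nat_mult)
  then have "rat_of_nat w * of_nat ?a = of_nat u * of_nat ?d" by (metis of_nat_mult)
  moreover have "rat_of_nat A = t * of_nat D" if "rat_of_nat w * of_nat A = of_nat u * of_nat D" for A D
  proof -
    have "rat_of_nat A = of_nat u * of_nat D / of_nat w" using that uw(1) by (simp add: eq_divide_eq mult.commute)
    then show ?thesis using uw(2) by simp
  qed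
  ultimately have "rat_of_nat ?a = t * of_nat ?d" by blast
  moreover have "?d > 0" using m X(2) by simp
  moreover have "?S \<in> pair_invariant_sections ?d ?a"
    by (rule pair_invariant_section[OF S])
  moreover have "?S (f, l) \<noteq> 0" using z(2,3) by (simp add: clin_basis[OF lc, symmetric])
  ultimately show ?thesis
    unfolding pair_semistable_def mem_Collect_eq
    by (intro conjI exI[of _ ?d] exI[of _ ?a] z(1) bexI[of _ ?S])
qed

section \<open>Labeled pairs\<close>

definition zform :: "complex^3 \<Rightarrow> complex" where
  "zform v = v $ 3"

lemma clin_zform: "clin zform"
  by (simp add: clin_def zform_def)

lemma zform_plane_form: "zform \<in> plane_forms 1"
  using clin_zform unfolding plane_form_1_iff .

lemma zform_nonzero: "zform \<noteq> (\<lambda>_. 0)"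
proof
  assume "zform = (\<lambda>_. 0)"
  then have "zform (axis 3 1) = 0" by (rule fun_cong)
  then show False by (simp add: zform_def axis3 vector_3)
qed

lemma contract_zform: "contract zform B = B (axis 1 1) (axis 2 1) - B (axis 2 1) (axis 1 1)"
  by (simp add: contract_def zform_def axis3 vector_3)

lemma hes_slice: "hes (slice x) zform u v =
    - (2 * u $ 1 * v $ 1 + 2 * u $ 2 * v $ 2 + u $ 1 * v $ 2 + u $ 2 * v $ 1) / 9
    - x $ 1 * (u $ 1 * v $ 3 + u $ 3 * v $ 1 + u $ 2 * v $ 3 + u $ 3 * v $ 2) / 9
    - x $ 1 ^ 2 * u $ 3 * v $ 3 / 18"
  unfolding hes_def contract_zform by (simp add: pol_slice axis3 vector_3 field_simps power2_eq_square)

lemma pole_slice: "pole (slice x) zform = vector [- 2 * x $ 1 / 81, - 2 * x $ 1 / 81, 2 / 27]"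
  unfolding pole_def contract_zform vec_eq_iff forall_3
  by (simp add: cr_def hes_slice axis3 vector_3 field_simps)

lemma theta_slice: "theta (slice x) zform (pole (slice x) zform) = 2 * x $ 1 / 729"
  unfolding theta_def contract_zform
  by (simp add: pol_slice hes_slice pole_slice axis3 vector_3 field_simps)

text \<open>The entry \<open>x $ 1\<close> is detected by \<open>theta\<close> at the pole. If it is
  zero, the pole lies over \<open>axis 3 1\<close>, where the cubic detects \<open>x $ 4\<close>. If
  that is zero too, the base point is a multiple of \<open>(- x3, x2, 0)\<close>; there the Hessian
  and the cubic are multiples of \<open>x2^2 - x2 x3 + x3^2\<close> and
  \<open>x2 x3 (x2 - x3)\<close>, which have only the trivial common zero.\<close>

lemma slice_semistable:
  assumes t: "9 / 7 \<le> t" "t < 3 / 2" and x: "x \<noteq> 0"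
  shows "(slice x, zform) \<in> pair_semistable t"
proof -
  have z: "(slice x, zform) \<in> pair_cone"
    unfolding pair_cone_def using slice_plane_form slice_nonzero zform_plane_form zform_nonzero by simp
  have D: "zform (pole (slice x) zform) \<noteq> 0" by (simp add: pole_slice zform_def vector_3)
  show ?thesis
  proof (cases "x $ 1 = 0")
    case False
    show ?thesis
      by (rule pair_semistableI[OF pair_invariants(2) _ _ t z _ D]) (use False in \<open>simp_all add: theta_slice\<close>)
  next
    case True
    have p: "pole (slice x) zform = vector [0, 0, 2 / 27]" by (simp add: pole_slice True)
    have b: "base_point (slice x) zform = vector [- (4 * x $ 3 / 2187), 4 * x $ 2 / 2187, 0]"
      unfolding base_point_def p cr_def by (simp add: pol_slice zform_def axis3 vector_3 mult.commute)
    show ?thesis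
    proof (cases "x $ 4 = 0")
      case False
      show ?thesis
        by (rule pair_semistableI[OF pair_invariants(3) _ _ t z _ D])
          (use False in \<open>simp_all add: p pol_slice vector_3 True\<close>)
    next
      case x4: True
      show ?thesis
      proof (cases "hes (slice x) zform (base_point (slice x) zform) (base_point (slice x) zform) = 0")
        case False
        show ?thesis
          by (rule pair_semistableI[OF pair_invariants(4) _ _ t z _ D]) (use False in simp_all)
      next
        case h: True
        have "hes (slice x) zform (vector [- (\<kappa> * x $ 3), \<kappa> * x $ 2, 0]) (vector [- (\<kappa> * x $ 3), \<kappa> * x $ 2, 0])
            = - 2 / 9 * \<kappa>^2 * (x $ 3 ^ 2 + x $ 2 ^ 2 - x $ 2 * x $ 3)" for \<kappa>
          unfolding hes_slice True vector_3 by (simp add: field_simps power2_eq_square)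
        from this[of "4 / 2187"] have e: "x $ 3 ^ 2 + x $ 2 ^ 2 = x $ 2 * x $ 3"
          using h unfolding b by simp
        have "pol (slice x) (base_point (slice x) zform) (base_point (slice x) zform) (base_point (slice x) zform) \<noteq> 0"
        proof
          assume "pol (slice x) (base_point (slice x) zform) (base_point (slice x) zform) (base_point (slice x) zform) = 0"
          then have "x $ 3 * x $ 2 * (x $ 2 - x $ 3) = 0"
            unfolding b pol_slice by (auto simp: vector_3 True field_simps power2_eq_square)
          then have "x $ 2 = 0 \<and> x $ 3 = 0" using e by (auto simp: power2_eq_square)
          then show False using x True x4 by (simp add: vec4_eq_iff)
        qed
        then show ?thesis
          by (intro pair_semistableI[OF pair_invariants(5) _ _ t z _ D]) simp_all
      qed
    qed
  qed
qed

lemma slice_transverse: "transverse (slice x) zform"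
  unfolding transverse_def
proof (intro allI impI notI)
  fix v assume v: "v \<noteq> 0 \<and> slice x v = 0 \<and> zform v = 0" and "\<exists>c. \<forall>u. dir_deriv (slice x) v u = c * zform u"
  then obtain c where c: "\<And>u. 3 * pol (slice x) v v u = c * zform u"
    unfolding dir_deriv_cubic[OF slice_plane_form] by blast
  have v3: "v $ 3 = 0" using v by (simp add: zform_def)
  have "3 * (v $ 2 * (2 * v $ 1 + v $ 2)) = 0"
    using c[of "axis 1 1"] v3 by (simp add: pol_slice zform_def axis3 vector_3 algebra_simps)
  moreover have "3 * (v $ 1 * (v $ 1 + 2 * v $ 2)) = 0"
    using c[of "axis 2 1"] v3 by (simp add: pol_slice zform_def axis3 vector_3 algebra_simps)
  ultimately have "v $ 1 = 0 \<and> v $ 2 = 0" by (auto simp: add_eq_0_iff)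
  then show False using v v3 by (simp add: vec_eq_iff forall_3)
qed

text \<open>By \<open>transverse_double_point_A\<close> only a triple point could fail. On a slice
  cubic it would be a multiple of \<open>axis 3 1\<close>, and the polar quantities there are
  multiples of the entries of \<open>x\<close>.\<close>

lemma slice_at_worst_A: "x \<noteq> 0 \<Longrightarrow> at_worst_A_sings (slice x)"
  unfolding at_worst_A_sings_def
proof (intro allI impI)
  fix v assume x: "x \<noteq> 0" and v: "v \<noteq> 0 \<and> singular_at (slice x) v"
  have "\<exists>u w. pol (slice x) v u w \<noteq> 0"
  proof (rule ccontr)
    assume "\<not> ?thesis"
    then have a: "pol (slice x) v (axis i 1) (axis j 1) = 0" for i j by blast
    have "v $ 1 = 0" "v $ 2 = 0"
      using a[of 1 1] a[of 2 2] by (simp_all add: pol_slice axis3 vector_3)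
    moreover from this v have "v $ 3 \<noteq> 0" by (auto simp: vec_eq_iff forall_3)
    ultimately have "x = 0"
      using a[of 1 2] a[of 1 3] a[of 2 3] a[of 3 3] by (simp add: pol_slice axis3 vector_3 vec4_eq_iff)
    then show False using x by simp
  qed
  then show "\<exists>k. A_sing k (slice x) v"
    using transverse_double_point_A[OF slice_plane_form zform_plane_form slice_transverse] v by blast
qed

lemma proj_pt_vanish: "clin l \<Longrightarrow> proj_pt u = proj_pt v \<Longrightarrow> l v = 0 \<Longrightarrow> l u = 0"
  by (auto simp: proj_pt_eq_iff clin_scale)

lemma proj_pt_vanish_form: "f \<in> plane_forms d \<Longrightarrow> proj_pt u = proj_pt v \<Longrightarrow> f v = 0 \<Longrightarrow> f u = 0"
  by (auto simp: proj_pt_eq_iff plane_form_scale)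

definition slice_lab :: "complex^4 \<Rightarrow> lab_vec" where
  "slice_lab x = (slice x, zform, axis 1 1, axis 2 1, axis 1 1 - axis 2 1)"

lemma slice_lab_cone:
  assumes t: "9 / 7 \<le> t" "t < 3 / 2" and x: "x \<noteq> 0"
  shows "slice_lab x \<in> lab_cone t"
proof -
  let ?p = "axis 1 1 :: complex^3" and ?q = "axis 2 1 :: complex^3" and ?r = "axis 1 1 - axis 2 1 :: complex^3"
  have nz: "?p \<noteq> 0" "?q \<noteq> 0" "?r \<noteq> 0" by (simp_all add: axis3 vec_eq_iff forall_3 vector_3)
  have dist: "distinct [proj_pt ?p, proj_pt ?q, proj_pt ?r]"
    by (auto simp: proj_pt_eq_iff axis3 vec_eq_iff forall_3 vector_3)
  have on: "slice x ?p = 0" "slice x ?q = 0" "slice x ?r = 0" "zform ?p = 0" "zform ?q = 0" "zform ?r = 0"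
    by (simp_all add: slice_def zform_def axis3 vector_3)
  have "{proj_pt v | v. v \<noteq> 0 \<and> slice x v = 0 \<and> zform v = 0} = {proj_pt ?p, proj_pt ?q, proj_pt ?r}"
  proof
    show "{proj_pt v | v. v \<noteq> 0 \<and> slice x v = 0 \<and> zform v = 0} \<subseteq> {proj_pt ?p, proj_pt ?q, proj_pt ?r}"
    proof
      fix P assume "P \<in> {proj_pt v | v. v \<noteq> 0 \<and> slice x v = 0 \<and> zform v = 0}"
      then obtain v where v: "P = proj_pt v" "v \<noteq> 0" "slice x v = 0" "v $ 3 = 0" by (auto simp: zform_def)
      then have "v $ 1 * v $ 2 * (v $ 1 + v $ 2) = 0" by (simp add: slice_def)
      then consider "v $ 1 = 0" | "v $ 2 = 0" | "v $ 1 + v $ 2 = 0" by auto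
      then show "P \<in> {proj_pt ?p, proj_pt ?q, proj_pt ?r}"
      proof cases
        case 1
        then have "v = v $ 2 *s ?q" "v $ 2 \<noteq> 0" using v by (auto simp: axis3 vec_eq_iff forall_3 vector_3)
        then show ?thesis unfolding v(1) using proj_pt_eq_iff by blast
      next
        case 2
        then have "v = v $ 1 *s ?p" "v $ 1 \<noteq> 0" using v by (auto simp: axis3 vec_eq_iff forall_3 vector_3)
        then show ?thesis unfolding v(1) using proj_pt_eq_iff by blast
      next
        case 3
        then have "v = v $ 1 *s ?r" "v $ 1 \<noteq> 0"
          using v by (auto simp: axis3 vec_eq_iff forall_3 vector_3 add_eq_0_iff)
        then show ?thesis unfolding v(1) using proj_pt_eq_iff by blast
      qed
    qed
    show "{proj_pt ?p, proj_pt ?q, proj_pt ?r} \<subseteq> {proj_pt v | v. v \<noteq> 0 \<and> slice x v = 0 \<and> zform v = 0}"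
      using nz on by blast
  qed
  then show ?thesis
    unfolding lab_cone_def slice_lab_def
    using slice_semistable[OF t x] slice_at_worst_A[OF x] slice_transverse nz dist by simp
qed

lemma lab_cone_forms:
  assumes "(f, l, v1, v2, v3) \<in> lab_cone t"
  shows "f \<in> plane_forms 3" "f \<noteq> (\<lambda>_. 0)" "clin l" "l \<noteq> (\<lambda>_. 0)"
    "f v1 = 0" "f v2 = 0" "f v3 = 0" "l v1 = 0" "l v2 = 0" "l v3 = 0" "v1 \<noteq> 0" "v2 \<noteq> 0" "v3 \<noteq> 0"
proof -
  have z: "(f, l) \<in> pair_cone" "v1 \<noteq> 0" "v2 \<noteq> 0" "v3 \<noteq> 0"
    "{proj_pt v | v. v \<noteq> 0 \<and> f v = 0 \<and> l v = 0} = {proj_pt v1, proj_pt v2, proj_pt v3}"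
    using assms by (auto simp: lab_cone_def pair_semistable_def)
  show f: "f \<in> plane_forms 3" "f \<noteq> (\<lambda>_. 0)" "clin l" "l \<noteq> (\<lambda>_. 0)"
    using z(1) plane_form_1_clin by (auto simp: pair_cone_def)
  have "f u = 0 \<and> l u = 0" if "proj_pt u \<in> {proj_pt v1, proj_pt v2, proj_pt v3}" for u
  proof -
    have "proj_pt u \<in> {proj_pt v | v. v \<noteq> 0 \<and> f v = 0 \<and> l v = 0}" unfolding z(5) by (rule that)
    then obtain v where v: "proj_pt u = proj_pt v" "f v = 0" "l v = 0" by blast
    then show ?thesis using proj_pt_vanish[OF f(3) v(1)] proj_pt_vanish_form[OF f(1) v(1)] by blast
  qed
  then show "f v1 = 0" "f v2 = 0" "f v3 = 0" "l v1 = 0" "l v2 = 0" "l v3 = 0" by auto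
  show "v1 \<noteq> 0" "v2 \<noteq> 0" "v3 \<noteq> 0" by (rule z(2-4))+
qed

lemma lab_cone_good:
  assumes z: "(f, l, v1, v2, v3) \<in> lab_cone t"
  shows "good f v1 v2"
proof -
  note f = lab_cone_forms[OF z]
  have tr: "transverse f l" and A: "at_worst_A_sings f" and d: "distinct [proj_pt v1, proj_pt v2, proj_pt v3]"
    using z by (auto simp: lab_cone_def)
  obtain w where w: "det3 v1 v2 w = 1"
  proof (rule frame_cases[OF f(11), of v2])
    fix u w c assume c: "v2 = c *s v1"
    with f(12) have "c \<noteq> 0" by auto
    then have "proj_pt v2 = proj_pt v1" using c proj_pt_eq_iff by blast
    then show thesis using d by auto
  qed
  have lw: "l w \<noteq> 0"
  proof
    assume "l w = 0"
    then have "l = (\<lambda>_. 0)" using w f(8,9) by (intro clin_eqI[OF f(3) _, of _ v1 v2 w]) (auto simp: clin_def)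
    then show False using f(4) by simp
  qed
  \<comment> \<open>A linear form vanishing at \<open>v1\<close> and \<open>v2\<close> is a multiple
    of \<open>l\<close>, so \<open>pol f v v\<close> would make \<open>l\<close> the tangent line at
    \<open>v\<close>, or \<open>v\<close> would be singular.\<close>
  have tangent: False if v: "f v = 0" "l v = 0" "v \<noteq> 0" and 0: "pol f v v v1 = 0" "pol f v v v2 = 0" for v
  proof -
    have "pol f v v = (\<lambda>u. pol f v v w / l w * l u)"
      by (rule clin_eqI[OF clin_pol(1) clin_scale_add(1)[OF f(3)], of v1 v2 w])
        (use w lw 0 f(8,9) in auto)
    then have "dir_deriv f v u = (3 * (pol f v v w / l w)) * l u" for u
      unfolding dir_deriv_cubic[OF f(1)] by (metis mult.assoc)
    then show False using tr v unfolding transverse_def by blast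
  qed
  have e: "pol f v1 v1 v1 = 0" "pol f v2 v2 v2 = 0" using f(5,6) pol_diag[OF f(1)] by metis+
  have nz: "invA f v1 v2 \<noteq> 0" "invB f v1 v2 \<noteq> 0"
    using tangent[OF f(5,8,11)] tangent[OF f(6,9,12)] e by (auto simp: invA_def invB_def pol_commute)
  moreover have "moduli f v1 v2 \<noteq> 0"
  proof
    assume 0: "moduli f v1 v2 = 0"
    let ?G = "slice_frame f v1 v2" and ?c = "1 / (9 * invA f v1 v2 * invB f v1 v2)"
    have fG: "(\<lambda>y. f (?G *v y)) = (\<lambda>y. ?c * slice 0 y)"
      using slice_frame(1)[OF f(1,5,6) nz] unfolding 0 by auto
    have G: "det ?G \<noteq> 0" by (rule slice_frame(2)[OF f(1,5,6) nz])
    \<comment> \<open>The point where the three lines \<open>slice 0\<close> meet, carried back to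
      the original coordinates.\<close>
    define P where "P = ?G *v axis 3 1"
    have "pol f P (?G *v u) (?G *v v) = 0" for u v
      unfolding P_def pol_comp[OF f(1), symmetric] fG pol_cmult by (simp add: pol_slice axis3 vector_3)
    then have triple: "pol f P u v = 0" for u v
      using matrix_inv_mult(1)[OF G] by metis
    have "P \<noteq> 0"
    proof
      assume "P = 0"
      then have "matrix_inv ?G *v P = 0" by simp
      then have "axis 3 1 = (0 :: complex^3)" unfolding P_def matrix_inv_mult(2)[OF G] .
      then show False by (simp add: axis3 vec_eq_iff forall_3 vector_3)
    qed
    moreover have "singular_at f P"
      unfolding singular_at_def dir_deriv_cubic[OF f(1)] by (simp add: triple pol_diag[OF f(1), of P])
    ultimately obtain k where "A_sing k f P" using A unfolding at_worst_A_sings_def by blast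
    then show False using triple_point_not_A[OF f(1) triple] by blast
  qed
  ultimately show ?thesis by (simp add: good_def)
qed

text \<open>The line and the third point are determined by the rest. In the frame the line is
  \<open>z = 0\<close>, because \<open>l\<close> vanishes at \<open>v1\<close> and
  \<open>v2\<close>; the third point satisfies \<open>x y (x + y) = 0\<close>, and distinctness
  leaves only \<open>x + y = 0\<close>.\<close>

lemma lab_orbit_slice:
  assumes z: "(f, l, v1, v2, v3) \<in> lab_cone t"
  shows "lab_orbit (lab_proj (f, l, v1, v2, v3)) = lab_orbit (lab_proj (slice_lab (moduli f v1 v2)))"
proof -
  note f = lab_cone_forms[OF z]
  have nz: "invA f v1 v2 \<noteq> 0" "invB f v1 v2 \<noteq> 0" using lab_cone_good[OF z] by (auto simp: good_def)
  have d: "distinct [proj_pt v1, proj_pt v2, proj_pt v3]" using z by (simp add: lab_cone_def)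
  let ?G = "slice_frame f v1 v2" and ?c = "1 / (9 * invA f v1 v2 * invB f v1 v2)"
  note fG = slice_frame(1)[OF f(1,5,6) nz] and G = slice_frame(2)[OF f(1,5,6) nz]
  obtain g \<kappa> where g: "g \<in> SL3" "\<kappa> \<noteq> 0" "\<And>y. g *v (?G *v y) = \<kappa> *s y"
    using normalise_frame[OF G] by blast
  have p1: "?G *v axis 1 1 = (1 / (3 * invA f v1 v2)) *s v1" and p2: "?G *v axis 2 1 = (1 / (3 * invB f v1 v2)) *s v2"
    by (simp_all add: slice_frame_def cols_mult axis3 vector_3)
  have lG: "l (?G *v y) = l (centre f v1 v2) * zform y" for y
    by (simp add: slice_frame_def cols_mult clin_add[OF f(3)] clin_scale[OF f(3)] f(8,9) zform_def)
  have lw: "l (centre f v1 v2) \<noteq> 0"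
  proof
    assume "l (centre f v1 v2) = 0"
    then have "l (?G *v (matrix_inv ?G *v y)) = 0" for y using lG by simp
    then show False using f(4) unfolding matrix_inv_mult(1)[OF G] by blast
  qed
  define y where "y = matrix_inv ?G *v v3"
  have Gy: "?G *v y = v3" by (simp add: y_def matrix_inv_mult(1)[OF G])
  have y3: "y $ 3 = 0" using lG[of y] lw f(10) by (simp add: Gy zform_def)
  have "slice (moduli f v1 v2) y = 0" using fG[of y] f(7) nz by (simp add: Gy)
  then have y12: "y $ 1 * y $ 2 * (y $ 1 + y $ 2) = 0" by (simp add: slice_def y3)
  have y1: "y $ 1 \<noteq> 0"
  proof
    assume "y $ 1 = 0"
    then have "y = y $ 2 *s axis 2 1" using y3 by (simp add: axis3 vec_eq_iff forall_3 vector_3)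
    then have v3: "v3 = (y $ 2 * (1 / (3 * invB f v1 v2))) *s v2"
      using Gy p2 by (metis vector_scalar_commute vector_smult_assoc)
    then have "y $ 2 * (1 / (3 * invB f v1 v2)) \<noteq> 0" using f(13) by auto
    then have "proj_pt v3 = proj_pt v2" using v3 proj_pt_eq_iff by blast
    then show False using d by simp
  qed
  have y2: "y $ 2 \<noteq> 0"
  proof
    assume "y $ 2 = 0"
    then have "y = y $ 1 *s axis 1 1" using y3 by (simp add: axis3 vec_eq_iff forall_3 vector_3)
    then have v3: "v3 = (y $ 1 * (1 / (3 * invA f v1 v2))) *s v1"
      using Gy p1 by (metis vector_scalar_commute vector_smult_assoc)
    then have "y $ 1 * (1 / (3 * invA f v1 v2)) \<noteq> 0" using f(13) by auto
    then have "proj_pt v3 = proj_pt v1" using v3 proj_pt_eq_iff by blast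
    then show False using d by simp
  qed
  have y21: "y $ 2 = - y $ 1" using y12 y1 y2 by (simp add: add_eq_0_iff2)
  have "axis 1 1 - axis 2 1 = (1 / y $ 1) *s y"
    using y1 y3 y21 by (simp add: axis3 vec_eq_iff forall_3 vector_3)
  then have p3: "?G *v (axis 1 1 - axis 2 1) = (1 / y $ 1) *s v3"
    using Gy by (metis vector_scalar_commute)
  have "proj_form (act_form g f) = proj_form (slice (moduli f v1 v2))"
    by (rule act_to_frame[OF g f(1) slice_plane_form _ fG]) (use nz in simp)
  moreover have "proj_form (act_form g l) = proj_form zform"
    by (rule act_to_frame[OF g clin_plane_form[OF f(3)] zform_plane_form lw lG])
  moreover have "proj_pt (g *v v1) = proj_pt (axis 1 1)" "proj_pt (g *v v2) = proj_pt (axis 2 1)"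
    "proj_pt (g *v v3) = proj_pt (axis 1 1 - axis 2 1)"
    using act_point_to_frame[OF g(2,3) _ p1] act_point_to_frame[OF g(2,3) _ p2] act_point_to_frame[OF g(2,3) _ p3] nz y1
    by simp_all
  ultimately have "lab_act g (lab_proj (f, l, v1, v2, v3)) = lab_proj (slice_lab (moduli f v1 v2))"
    unfolding lab_act_proj slice_lab_def by (simp add: lab_proj_def)
  then show ?thesis using lab_orbit_act[OF g(1)] by metis
qed

lemma lab_orbit_slice_wact:
  assumes t: "t \<noteq> 0"
  shows "lab_orbit (lab_proj (slice_lab (wact t x))) = lab_orbit (lab_proj (slice_lab x))"
proof -
  let ?G = "cols (axis 1 1) (axis 2 1) ((1 / t) *s axis 3 1)"
  have "det ?G \<noteq> 0" using t by (simp add: det_diag_frame)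
  then obtain g \<kappa> where g: "g \<in> SL3" "\<kappa> \<noteq> 0" "\<And>y. g *v (?G *v y) = \<kappa> *s y"
    using normalise_frame by blast
  have "proj_form (act_form g (slice (wact t x))) = proj_form (slice x)"
    by (rule act_to_frame[OF g slice_plane_form slice_plane_form, of 1]) (simp_all add: slice_wact[OF t])
  moreover have "proj_form (act_form g zform) = proj_form zform"
    by (rule act_to_frame[OF g zform_plane_form zform_plane_form, of "1 / t"])
      (use t in \<open>simp_all add: zform_def cols_mult axis3 vector_3\<close>)
  moreover have "proj_pt (g *v axis 1 1) = proj_pt (axis 1 1)" "proj_pt (g *v axis 2 1) = proj_pt (axis 2 1)"
    "proj_pt (g *v (axis 1 1 - axis 2 1)) = proj_pt (axis 1 1 - axis 2 1)"
    by (rule act_point_to_frame[OF g(2,3), of 1]; simp add: cols_mult axis3 vector_3 vec_eq_iff forall_3)+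
  ultimately have "lab_act g (lab_proj (slice_lab (wact t x))) = lab_proj (slice_lab x)"
    unfolding slice_lab_def lab_act_proj by (simp add: lab_proj_def)
  then show ?thesis using lab_orbit_act[OF g(1)] by metis
qed

text \<open>Forgetting the line and the third point commutes with the action, so the invariance of
  \<open>moduli\<close> proved for two-pointed cubics carries over to labeled pairs.\<close>

lemma lab_orbit_imp_C23_orbit:
  assumes "lab_orbit (lab_proj (f', l', v1', v2', v3')) = lab_orbit (lab_proj (f, l, v1, v2, v3))"
  shows "C23_orbit (C23_proj (f', v1', v2')) = C23_orbit (C23_proj (f, v1, v2))"
proof -
  have "lab_proj (f', l', v1', v2', v3') \<in> lab_orbit (lab_proj (f, l, v1, v2, v3))"
    using assms lab_orbit_refl by blast
  then obtain g where g: "g \<in> SL3" "lab_proj (f', l', v1', v2', v3') = lab_act g (lab_proj (f, l, v1, v2, v3))"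
    by (auto simp: lab_orbit_def)
  then have "C23_proj (f', v1', v2') = C23_act g (C23_proj (f, v1, v2))"
    unfolding lab_act_proj C23_act_proj by (simp add: lab_proj_def C23_proj_def)
  then show ?thesis using C23_orbit_act[OF g(1)] by metis
qed

lemma lab_coords_polyfuns:
  "(\<lambda>z. fst z u) \<in> polyfuns lab_coords"
  "(\<lambda>z. fst (snd (snd z)) $ i) \<in> polyfuns lab_coords"
  "(\<lambda>z. fst (snd (snd (snd z))) $ i) \<in> polyfuns lab_coords"
  by (rule polyfuns.coord; force simp: lab_coords_def fun_eq_iff)+

lemma slice_lab_coords:
  assumes "k \<in> lab_coords"
  shows "(\<lambda>x. k (slice_lab x)) \<in> polyfuns {\<lambda>x. x $ i | i. True}"
proof -
  consider u where "\<And>x. k (slice_lab x) = slice x u" | c where "\<And>x. k (slice_lab x) = c"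
    using assms unfolding lab_coords_def slice_lab_def by auto
  then show ?thesis by cases (simp_all only: polyfuns_slice polyfuns.const)
qed

lemma M_lab_pairs_weighted:
  assumes t: "9 / 7 \<le> t" "t < 3 / 2"
  shows "\<exists>\<phi>. fs_isomorphism (M_lab_pairs t) (weighted_proj_space wt) \<phi>"
proof -
  let ?Q = "quasi_affine lab_coords (lab_cone t)"
  let ?\<mu> = "\<lambda>z::lab_vec. moduli (fst z) (fst (snd (snd z))) (fst (snd (snd (snd z))))"
  have "topspace (fs_top (fs_quotient lab_proj ?Q)) = lab_proj ` lab_cone t"
    by (simp add: topspace_quotient_top topspace_zariski_top)
  then have M: "M_lab_pairs t = fs_quotient lab_orbit (fs_open_sub (fs_quotient lab_proj ?Q) (lab_proj ` lab_cone t))"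
    using fs_open_sub_topspace[of "fs_quotient lab_proj ?Q"] by (simp add: M_lab_pairs_def lab_pairs_def)
  have pre: "{z \<in> lab_cone t. lab_proj z \<in> lab_proj ` lab_cone t} = lab_cone t" by blast
  have "openin (zariski_top lab_coords (lab_cone t)) (lab_cone t)"
    using openin_topspace[of "zariski_top lab_coords (lab_cone t)"] by (simp add: topspace_zariski_top)
  from presented_double_quotient[OF subset_refl, of lab_coords "lab_cone t" lab_proj lab_orbit, unfolded pre, OF this]
  have X: "presented (M_lab_pairs t) lab_coords (lab_cone t) (lab_cone t) (\<lambda>z. lab_orbit (lab_proj z))"
    unfolding M .
  show ?thesis
  proof (rule presented_isomorphism[OF X presented_weighted_proj_space,
        where \<mu> = ?\<mu> and \<sigma> = slice_lab])
    show "?\<mu> z \<in> {x. x \<noteq> 0}" if "z \<in> lab_cone t" for z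
      using that lab_cone_good by (cases z) (auto simp: good_def)
    show "(\<lambda>z. k (?\<mu> z)) \<in> polyfuns lab_coords" if "k \<in> {\<lambda>x. x $ i | i. True}" for k
      using that by (auto intro!: polyfuns_moduli lab_coords_polyfuns)
    show "slice_lab x \<in> lab_cone t" if "x \<in> {x. x \<noteq> 0}" for x
      using slice_lab_cone[OF t] that by blast
    show "(\<lambda>x. k (slice_lab x)) \<in> polyfuns {\<lambda>x. x $ i | i. True}" if "k \<in> lab_coords" for k
      by (rule slice_lab_coords[OF that])
    show "weighted_class wt (?\<mu> z) = weighted_class wt (?\<mu> z')"
      if "z \<in> lab_cone t" "z' \<in> lab_cone t" "lab_orbit (lab_proj z) = lab_orbit (lab_proj z')" for z z'
    proof -
      obtain f l v1 v2 v3 f' l' v1' v2' v3' where e: "z = (f, l, v1, v2, v3)" "z' = (f', l', v1', v2', v3')"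
        by (metis prod_cases5)
      show ?thesis
        using C23_orbit_invariants(1)[OF lab_cone_forms(1)[OF that(2)[unfolded e]] lab_orbit_imp_C23_orbit[OF that(3)[unfolded e]]]
        by (simp add: e weighted_class_eq_iff)
    qed
    show "lab_orbit (lab_proj (slice_lab x)) = lab_orbit (lab_proj (slice_lab x'))"
      if "weighted_class wt x = weighted_class wt x'" for x x'
      using that lab_orbit_slice_wact by (auto simp: weighted_class_eq_iff)
    show "weighted_class wt (?\<mu> (slice_lab x)) = weighted_class wt x" for x
      by (simp add: slice_lab_def moduli_slice weighted_class_eq_iff) (intro exI[of _ "- 1 / 9"], simp)
    show "lab_orbit (lab_proj (slice_lab (?\<mu> z))) = lab_orbit (lab_proj z)" if "z \<in> lab_cone t" for z
      using lab_orbit_slice that by (cases z) auto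
  qed
qed

theorem corollary6p3:
  shows "\<exists>\<epsilon>0 :: rat. \<epsilon>0 > 0 \<and> (\<forall>\<epsilon> :: rat. 0 < \<epsilon> \<and> \<epsilon> < \<epsilon>0 \<longrightarrow>
    (\<forall>(w1 :: rat) (w2 :: rat) (L :: line_bundle).
       w1 > 1 \<and> w2 > 1 \<and> w1 + w2 < 3 \<and> corresponds_to L (1, w1, w2) \<longrightarrow>
       (\<exists>\<phi>lab. fs_isomorphism (C23_quotient L) (M_lab_pairs (3/2 - \<epsilon>)) \<phi>lab)) \<and>
    (\<exists>\<psi>. fs_isomorphism (M_lab_pairs (3/2 - \<epsilon>))
       (weighted_proj_space (vector [1, 2, 2, 3] :: nat^4)) \<psi>))"
proof (intro exI[of _ "3 / 14 :: rat"] conjI allI impI)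
  fix \<epsilon> :: rat assume "0 < \<epsilon> \<and> \<epsilon> < 3 / 14"
  \<comment> \<open>The bound is \<open>3 / 14 = 3 / 2 - 9 / 7\<close>, where \<open>9 / 7\<close>
    is the slope of the invariant built from \<open>theta\<close>, the largest below
    \<open>3 / 2\<close> among those used.\<close>
  then have t: "9 / 7 \<le> 3 / 2 - \<epsilon>" "3 / 2 - \<epsilon> < 3 / 2" by (simp_all add: field_simps)
  obtain \<psi> where M: "fs_isomorphism (M_lab_pairs (3/2 - \<epsilon>)) (weighted_proj_space wt) \<psi>"
    using M_lab_pairs_weighted[OF t] by blast
  then show "\<exists>\<psi>. fs_isomorphism (M_lab_pairs (3/2 - \<epsilon>)) (weighted_proj_space (vector [1, 2, 2, 3] :: nat^4)) \<psi>"
    unfolding wt_def by blast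
  fix w1 w2 :: rat and L :: line_bundle
  assume w: "w1 > 1 \<and> w2 > 1 \<and> w1 + w2 < 3 \<and> corresponds_to L (1, w1, w2)"
  obtain d a1 a2 where L: "L = (d, a1, a2)" by (metis prod_cases3)
  obtain m :: nat where m: "m > 0" "rat_of_nat d = of_nat m" "rat_of_nat a1 = of_nat m * w1" "rat_of_nat a2 = of_nat m * w2"
    using w by (auto simp: corresponds_to_def L)
  have "rat_of_nat m * 1 < of_nat m * w1" "rat_of_nat m * 1 < of_nat m * w2" "rat_of_nat m * (w1 + w2) < of_nat m * 3"
    using w m(1) by (simp_all del: mult_1_right)
  then have "rat_of_nat d < of_nat a1" "rat_of_nat d < of_nat a2" "rat_of_nat (a1 + a2) < of_nat (3 * d)"
    using m by (simp_all add: algebra_simps)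
  then have a: "a1 > d" "a2 > d" "a1 + a2 < 3 * d" unfolding of_nat_less_iff .
  show "\<exists>\<phi>lab. fs_isomorphism (C23_quotient L) (M_lab_pairs (3/2 - \<epsilon>)) \<phi>lab"
    using C23_quotient_weighted[OF a] fs_isomorphism_compose_inverse[OF _ M] unfolding L by blast
qed simp

end
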